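(* Let $q \in L^1_{\mathbb{R}}[0,\pi]$, $\alpha \in (0,\pi]$, $\beta \in [0,\pi)$, and let $\lambda_n = \lambda_n(q,\alpha,\beta)$, $n = 0,1,2,\dots$, where $\lambda_n^2(q,\alpha,\beta)$ are the eigenvalues of the Sturm-Liouville problem $L(q,\alpha,\beta)$. 1. Let $\alpha, \beta \in (0,\pi)$. (a) If there are no zeros among the $\lambda_n$, $n = 0,1,2,\dots$, then the system $\{\sin(\lambda_n x)\}_{n=1}^\infty$ is a Riesz basis in $L^2[0,\pi]$. (b) If $\lambda_{n_0} = 0$ for some $n_0$, then the system $\{\sin(\lambda_n x)\}_{n=0}^{n_0-1} \cup \{\sin(\lambda_n x)\}_{n=n_0+1}^\infty$ is a Riesz basis in $L^2[0,\pi]$. 2. Let $\alpha = \pi$, $\beta \in (0,\pi)$, or $\alpha \in (0,\pi)$, $\beta = 0$. (a) If there are no zeros among the $\lambda_n$, $n = 0,1,2,\dots$, then the system $\{\sin(\lambda_n x)\}_{n=0}^\infty$ is a Riesz basis in $L^2[0,\pi]$. (b) If $\lambda_{n_0} = 0$ for some $n_0$, then the system $\{\sin(\lambda_n x)\}_{n=0}^{n_0-1} \cup \{x\} \cup \{\sin(\lambda_n x)\}_{n=n_0+1}^\infty$ is a Riesz basis in $L^2[0,\pi]$. 3. Let $\alpha = \pi$, $\beta = 0$. (a) If there are no zeros among the $\lambda_n$, $n = 0,1,2,\dots$, then the system $\{\sin(\lambda_n x)\}_{n=0}^\infty$ is a Riesz basis in $L^2[0,\pi]$. (b) If $\lambda_{n_0}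 = 0$ for some $n_0$, then the system $\{\sin(\lambda_n x)\}_{n=0}^{n_0-1} \cup \{x\} \cup \{\sin(\lambda_n x)\}_{n=n_0+1}^\infty$ is a Riesz basis in $L^2[0,\pi]$.
   Context: $L^1_{\mathbb{R}}[0,\pi]$ is the set of real-valued summable (Lebesgue integrable) functions on $[0,\pi]$. $L^2[0,\pi]$ is the usual (complex) Hilbert space of square-integrable functions. The Sturm-Liouville problem $L(q,\alpha,\beta)$, for $q \in L^1_{\mathbb{R}}[0,\pi]$, $\alpha \in (0,\pi]$, $\beta \in [0,\pi)$, is the boundary-value problem $$-y'' + q(x)y = \mu y, \quad x \in (0,\pi),\ \mu \in \mathbb{C},$$ $$y(0)\cos\alpha + y'(0)\sin\alpha = 0,$$ $$y(\pi)\cos\beta + y'(\pi)\sin\beta = 0,$$ where solutions are understood in the usual sense ($y, y'$ absolutely continuous on $[0,\pi]$, equation satisfied almost everywhere). Its eigenvalues are real and simple, bounded below, and enumerated in increasing order as $\mu_0 < \mu_1 < \mu_2 < \cdots$; write $\mu_n = \mu_n(q,\alpha,\beta) = \lambda_n^2(q,\alpha,\beta)$. Thus $\lambda_n$ is a square root of $\mu_n$: it is taken nonnegative if $\mu_n \ge 0$, and is purely imaginary for the (finitely many) negative $\mu_n$ (the choice of sign of the square root only changes $\sin(\lambda_n x)$ by a sign). For $n_0 = 0$ the system $\{\sin(\lambda_n x)\}_{n=0}^{n_0-1}$ is empty. A Riesz basis of a separable Hilbert space $H$ is a sequence $\{f_j\}$ of the form $f_j = A e_j$, where $\{e_j\}$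 is an orthonormal basis of $H$ and $A$ is a bounded invertible linear operator on $H$ (with bounded inverse). *)

theory Defs
  imports "HOL-Analysis.Analysis"
begin

section \<open>The Hilbert space of square-integrable functions\<close>

text \<open>
  Elements of the complex space L2(M) are represented by functions, two functions being the same
  element iff they agree almost everywhere.
\<close>

definition L2_fun :: "'a measure \<Rightarrow> ('a \<Rightarrow> complex) \<Rightarrow> bool" where
  "L2_fun M f \<longleftrightarrow> f \<in> borel_measurable M \<and> integrable M (\<lambda>x. (cmod (f x))\<^sup>2)"

definition L2_inner :: "'a measure \<Rightarrow> ('a \<Rightarrow> complex) \<Rightarrow> ('a \<Rightarrow> complex) \<Rightarrow> complex" where
  "L2_inner M f g = (LINT x|M. f x * cnj (g x))"

definition L2_norm :: "'a measure \<Rightarrow> ('a \<Rightarrow> complex) \<Rightarrow> real" where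
  "L2_norm M f = sqrt (LINT x|M. (cmod (f x))\<^sup>2)"

definition orthonormal_basis_L2 :: "'a measure \<Rightarrow> 'i set \<Rightarrow> ('i \<Rightarrow> 'a \<Rightarrow> complex) \<Rightarrow> bool" where
  "orthonormal_basis_L2 M J e \<longleftrightarrow>
     (\<forall>j\<in>J. L2_fun M (e j)) \<and>
     (\<forall>i\<in>J. \<forall>j\<in>J. L2_inner M (e i) (e j) = (if i = j then 1 else 0)) \<and>
     (\<forall>f. L2_fun M f \<longrightarrow> (\<forall>\<epsilon>>0. \<exists>F c. finite F \<and> F \<subseteq> J \<and>
        L2_norm M (\<lambda>x. f x - (\<Sum>j\<in>F. c j * e j x)) < \<epsilon>))"

text \<open>
  Linearity and boundedness together imply that the operator respects equality almost everywhere,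
  so it descends to equivalence classes.
\<close>

definition bounded_linear_L2 ::
  "'a measure \<Rightarrow> (('a \<Rightarrow> complex) \<Rightarrow> ('a \<Rightarrow> complex)) \<Rightarrow> bool" where
  "bounded_linear_L2 M A \<longleftrightarrow>
     (\<forall>f. L2_fun M f \<longrightarrow> L2_fun M (A f)) \<and>
     (\<forall>f g. L2_fun M f \<longrightarrow> L2_fun M g \<longrightarrow>
        (AE x in M. A (\<lambda>t. f t + g t) x = A f x + A g x)) \<and>
     (\<forall>f c. L2_fun M f \<longrightarrow> (AE x in M. A (\<lambda>t. c * f t) x = c * A f x)) \<and>
     (\<exists>C. \<forall>f. L2_fun M f \<longrightarrow> L2_norm M (A f) \<le> C * L2_norm M f)"

definition bounded_invertible_L2 ::
  "'a measure \<Rightarrow> (('a \<Rightarrow> complex) \<Rightarrow> ('a \<Rightarrow> complex)) \<Rightarrow> bool" where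
  "bounded_invertible_L2 M A \<longleftrightarrow>
     bounded_linear_L2 M A \<and>
     (\<exists>B. bounded_linear_L2 M B \<and>
        (\<forall>f. L2_fun M f \<longrightarrow> (AE x in M. A (B f) x = f x) \<and> (AE x in M. B (A f) x = f x)))"

text \<open>
  The index set is arbitrary, so that systems such as those indexed by the positive integers, or by
  the naturals without one element, need no renumbering.
\<close>

definition riesz_basis_L2 :: "'a measure \<Rightarrow> 'i set \<Rightarrow> ('i \<Rightarrow> 'a \<Rightarrow> complex) \<Rightarrow> bool" where
  "riesz_basis_L2 M J f \<longleftrightarrow>
     (\<forall>j\<in>J. L2_fun M (f j)) \<and>
     (\<exists>e A. orthonormal_basis_L2 M J e \<and> bounded_invertible_L2 M A \<and>
        (\<forall>j\<in>J. AE x in M. f j x = A (e j) x))"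


section \<open>The Sturm-Liouville problem\<close>

definition absolutely_continuous_fun_on ::
  "real \<Rightarrow> real \<Rightarrow> (real \<Rightarrow> 'b::real_normed_vector) \<Rightarrow> bool" where
  "absolutely_continuous_fun_on s t f \<longleftrightarrow>
     (\<forall>\<epsilon>>0. \<exists>\<delta>>0. \<forall>(n::nat) a b.
        (\<forall>i<n. s \<le> a i \<and> a i \<le> b i \<and> b i \<le> t) \<and>
        disjoint_family_on (\<lambda>i. {a i<..<b i}) {..<n} \<and>
        (\<Sum>i<n. b i - a i) < \<delta>
        \<longrightarrow> (\<Sum>i<n. norm (f (b i) - f (a i))) < \<epsilon>)"

text \<open>
  \<open>y'\<close> is the derivative of \<open>y\<close> at every point of \<open>[0, \<pi>]\<close>, one-sided at the end points;
  \<open>d\<close> is the value of the second derivative at \<open>x\<close>.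
\<close>

definition sl_solution ::
  "(real \<Rightarrow> real) \<Rightarrow> complex \<Rightarrow> (real \<Rightarrow> complex) \<Rightarrow> (real \<Rightarrow> complex) \<Rightarrow> bool" where
  "sl_solution q \<mu> y y' \<longleftrightarrow>
     absolutely_continuous_fun_on 0 pi y \<and>
     absolutely_continuous_fun_on 0 pi y' \<and>
     (\<forall>x\<in>{0..pi}. (y has_vector_derivative y' x) (at x within {0..pi})) \<and>
     (AE x in lebesgue. x \<in> {0<..<pi} \<longrightarrow>
        (\<exists>d. (y' has_vector_derivative d) (at x) \<and> - d + of_real (q x) * y x = \<mu> * y x))"

definition sl_eigenvalue :: "(real \<Rightarrow> real) \<Rightarrow> real \<Rightarrow> real \<Rightarrow> complex \<Rightarrow> bool" where
  "sl_eigenvalue q \<alpha> \<beta> \<mu> \<longleftrightarrow>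
     (\<exists>y y'. sl_solution q \<mu> y y' \<and> (\<exists>x\<in>{0..pi}. y x \<noteq> 0) \<and>
        y 0 * of_real (cos \<alpha>) + y' 0 * of_real (sin \<alpha>) = 0 \<and>
        y pi * of_real (cos \<beta>) + y' pi * of_real (sin \<beta>) = 0)"

definition sl_eigenvalue_enumeration ::
  "(real \<Rightarrow> real) \<Rightarrow> real \<Rightarrow> real \<Rightarrow> (nat \<Rightarrow> real) \<Rightarrow> bool" where
  "sl_eigenvalue_enumeration q \<alpha> \<beta> \<mu> \<longleftrightarrow>
     strict_mono \<mu> \<and> {z. sl_eigenvalue q \<alpha> \<beta> z} = range (\<lambda>n. complex_of_real (\<mu> n))"

end

(*
The eigenvalues are the zeros of an entire function, the boundary form at pi of the solution
normalised at 0. Variation of constants shows that on the circles |mu| = (N + kappa - 1/2)^2 this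
function is dominated by its leading term (the same function for q = 0), so Rouche's theorem together
with simplicity of the zeros locates every eigenvalue: lambda_n = n + kappa + O(1/n) with kappa = 0,
1/2, 1 in the three cases. Hence all but finitely many functions sin (lambda_n x) are, in the square
summable sense, close to an orthogonal basis of sines, and replacing the remaining ones by the
unperturbed sines gives a Riesz basis by a Neumann argument.

It remains to exchange finitely many functions s_mu, where s_mu'' = - mu s_mu, s_mu(0) = 0,
s_mu'(0) = 1. Let c_j be the coordinate functionals of a Riesz basis made of multiples of s_(mu_j), let
a = mu_i, and let s_b be new. Convolution V with s_a satisfies V s_mu = (s_a - s_mu) / (mu - a), so for
j other than i the functional c_j o V + c_j / (mu_j - a) annihilates all basis functions but the i-th,
i.e. it is a multiple of c_i. If c_i(s_b) = 0, evaluating at s_b gives c_j(s_b) = 0 for all j, which is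
absurd. So c_i(s_b) is nonzero and s_b may replace s_a.
*)

theory Submission
  imports Defs "HOL-Complex_Analysis.Complex_Analysis"
begin

subsection \<open>Absolutely continuous functions\<close>

text \<open>The obstacle is that closeness of the tail to a sine basis says nothing about the
  finitely many other functions, which may belong to negative eigenvalues or to 0; their
  independence from the tail must come from the form sin (lambda x) itself. The proof therefore uses
  the parameter mu = lambda^2: \<open>sin_sol\<close> mu is entire in mu, is sin (lambda x) / lambda
  for either root, and is x at mu = 0. Sines with imaginary lambda and the added function x are then
  members of one family, and outside the tail only the distinctness of the mu is used.

  The eigenfunctions never enter the basis argument; q matters only through the asymptotics. As q is
  merely summable, y' is only absolutely continuous, so integrations by parts go through the
  fundamental theorem of calculus for such functions. For kappa = 0 there is one function too many:
  sin (n x), n >= 0, contains the zero function. Removing any one function shifts the indices and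
  leads back to kappa = 1, so orthonormal sine bases are needed only for kappa = 1/2 and 1.\<close>

lemma abs_continuous_tagged_partial_division:
  fixes f :: "real \<Rightarrow> 'b::real_normed_vector"
  assumes ac: "absolutely_continuous_fun_on s t f" and e: "\<epsilon> > 0"
  obtains \<delta> where "\<delta> > 0"
    "\<And>p. p tagged_partial_division_of {s..t} \<Longrightarrow> (\<Sum>(x,K)\<in>p. measure lborel K) < \<delta> \<Longrightarrow>
       (\<Sum>(x,K)\<in>p. norm (f (Sup K) - f (Inf K))) < \<epsilon>"
proof -
  obtain \<delta> where d: "\<delta> > 0" and D: "\<And>(n::nat) a b. (\<forall>i<n. s \<le> a i \<and> a i \<le> b i \<and> b i \<le> t) \<Longrightarrow>
        disjoint_family_on (\<lambda>i. {a i<..<b i}) {..<n} \<Longrightarrow>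
        (\<Sum>i<n. b i - a i) < \<delta> \<Longrightarrow> (\<Sum>i<n. norm (f (b i) - f (a i))) < \<epsilon>"
    using ac e unfolding absolutely_continuous_fun_on_def by meson
  show ?thesis
  proof (rule that[OF d])
    fix p assume p: "p tagged_partial_division_of {s..t}" and c: "(\<Sum>(x,K)\<in>p. measure lborel K) < \<delta>"
    have fin: "finite p" using p by (simp add: tagged_partial_division_of_def)
    \<comment> \<open>Enumeration turns the members of the division, whose interiors are disjoint
      although they may share end points, into the finite sequences of intervals in the definition
      of absolute continuity.\<close>
    obtain h where h: "bij_betw h {..<card p} p"
      using ex_bij_betw_nat_finite[OF fin] by (auto simp: atLeast0LessThan)
    define a where "a i = Inf (snd (h i))" for i
    define b where "b i = Sup (snd (h i))" for i
    have int: "s \<le> a i \<and> a i \<le> b i \<and> b i \<le> t \<and> snd (h i) = {a i..b i} \<and> h i \<in> p" if "i < card p" for i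
    proof -
      have hp: "h i \<in> p" using h that by (auto simp: bij_betw_def)
      obtain x K where xK: "h i = (x,K)" by (cases "h i")
      obtain u v where uv: "K = {u..v}" "x \<in> K" "K \<subseteq> {s..t}"
        using tagged_partial_division_ofD(2-4)[OF p hp[unfolded xK]] by auto
      then have "u \<le> v" by auto
      then show ?thesis using uv xK hp by (auto simp: a_def b_def)
    qed
    have "disjoint_family_on (\<lambda>i. {a i<..<b i}) {..<card p}"
    proof (unfold disjoint_family_on_def, intro ballI impI)
      fix i j assume ij: "i \<in> {..<card p}" "j \<in> {..<card p}" "i \<noteq> j"
      then have ne: "h i \<noteq> h j" using h by (auto simp: bij_betw_def inj_on_def)
      have hp: "h i \<in> p" "h j \<in> p" using int ij by auto
      have "interior (snd (h i)) \<inter> interior (snd (h j)) = {}"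
        using tagged_partial_division_ofD(5)[OF p, of "fst (h i)" "snd (h i)" "fst (h j)" "snd (h j)"] hp ne
        by simp
      then show "{a i<..<b i} \<inter> {a j<..<b j} = {}" using int ij by (simp add: interior_atLeastAtMost_real)
    qed
    moreover have "(\<Sum>i<card p. b i - a i) = (\<Sum>(x,K)\<in>p. measure lborel K)"
    proof -
      have "(\<Sum>(x,K)\<in>p. measure lborel K) = (\<Sum>i<card p. measure lborel (snd (h i)))"
        using sum.reindex_bij_betw[OF h, of "\<lambda>z. measure lborel (snd z)"] by (simp add: case_prod_unfold)
      also have "\<dots> = (\<Sum>i<card p. b i - a i)" using int by (intro sum.cong) auto
      finally show ?thesis by simp
    qed
    ultimately have "(\<Sum>i<card p. norm (f (b i) - f (a i))) < \<epsilon>"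
      using D[of "card p" a b] int c by auto
    then show "(\<Sum>(x,K)\<in>p. norm (f (Sup K) - f (Inf K))) < \<epsilon>"
      using sum.reindex_bij_betw[OF h, of "\<lambda>z. norm (f (Sup (snd z)) - f (Inf (snd z)))"]
      by (simp add: case_prod_unfold a_def b_def)
  qed
qed

text \<open>The intervals overlap in null sets only, so their total length is the integral of 1 over
  their union, which lies in U.\<close>

lemma tagged_partial_division_content_le:
  assumes p: "p tagged_partial_division_of {s..t::real}" and U: "U \<in> lmeasurable"
    and sub: "\<And>x K. (x,K) \<in> p \<Longrightarrow> K \<subseteq> U"
  shows "(\<Sum>(x,K)\<in>p. measure lborel K) \<le> measure lebesgue U"
proof -
  have pp: "p tagged_division_of \<Union>(snd ` p)" by (rule tagged_partial_division_of_Union_self[OF p])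
  have dv: "snd ` p division_of \<Union>(snd ` p)" using division_of_tagged_division[OF pp] .
  have "(\<Sum>(x,K)\<in>p. measure lborel K) = sum (measure lborel) (snd ` p)"
    by (rule sum.over_tagged_division_lemma[OF pp]) (simp add: content_eq_0_interior)
  also have "\<dots> \<le> measure lebesgue U"
  proof -
    have lm: "\<Union>(snd ` p) \<in> lmeasurable"
      using division_ofD(1)[OF dv] division_ofD(4)[OF dv] by (intro fmeasurable.finite_Union) (force+)
    have "measure lborel K = integral K (\<lambda>x. 1)" if "K \<in> snd ` p" for K
      using division_ofD(4)[OF dv that] by auto
    then have "sum (measure lborel) (snd ` p) = (\<Sum>K\<in>snd ` p. integral K (\<lambda>x. 1))"
      by (intro sum.cong) auto
    also have "\<dots> = integral (\<Union>(snd ` p)) (\<lambda>x. 1)"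
      by (rule integral_combine_division_topdown[OF integrable_on_const[OF lm] dv, symmetric])
    also have "\<dots> \<le> integral U (\<lambda>x. 1)"
      by (intro integral_subset_le integrable_on_const lm U) (auto dest!: sub)
    finally show ?thesis using U by (simp add: lmeasure_integral)
  qed
  finally show ?thesis .
qed

text \<open>The fundamental theorem of calculus in gauge form, with integrability of the derivative
  as part of the conclusion. Tags outside N are handled by the straddle estimate; intervals tagged
  in N are forced by the gauge into an open set of measure less than \<delta>, where absolute
  continuity makes the total increment of f small.\<close>

theorem ac_has_integral:
  fixes f :: "real \<Rightarrow> 'b::euclidean_space"
  assumes ac: "absolutely_continuous_fun_on s t f" and st: "s \<le> t" and N: "negligible N"
    and der: "\<And>x. x \<in> {s..t} - N \<Longrightarrow> (f has_vector_derivative g x) (at x within {s..t})"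
  shows "(g has_integral (f t - f s)) {s..t}"
proof -
  \<comment> \<open>With the value 0 on N the Riemann terms of exceptional tags vanish, and only the
    increments of f remain there.\<close>
  define g' where "g' x = (if x \<in> N then 0 else g x)" for x
  have "(g' has_integral (f t - f s)) {s..t}"
    unfolding has_integral_real
  proof (intro allI impI)
    fix e :: real assume e: "e > 0"
    obtain \<delta> where d: "\<delta> > 0" and D: "\<And>p. p tagged_partial_division_of {s..t} \<Longrightarrow> (\<Sum>(x,K)\<in>p. measure lborel K) < \<delta> \<Longrightarrow>
       (\<Sum>(x,K)\<in>p. norm (f (Sup K) - f (Inf K))) < e/2"
      by (rule abs_continuous_tagged_partial_division[OF ac half_gt_zero[OF e]]) (rule that, assumption+)
    obtain U where U: "open U" "N \<subseteq> U" and U': "U - N \<in> lmeasurable" "emeasure lebesgue (U - N) < ennreal \<delta>"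
      using sets_lebesgue_outer_open[OF negligible_imp_sets[OF N] d] by blast
    have "U \<in> lmeasurable" "measure lebesgue U = measure lebesgue (U - N)"
      using lmeasurable_negligible_symdiff[OF U'(1), of U] measure_negligible_symdiff[of "U - N" U] U U' N
      by (auto intro: negligible_subset)
    then have U: "open U" "N \<subseteq> U" "U \<in> lmeasurable" "measure lebesgue U < \<delta>"
      using U U' d by (auto simp: emeasure_eq_measure2 ennreal_less_iff)
    \<comment> \<open>The total length contributes e' (t - s) < e/2; the summand 1 keeps the
      denominator positive when s = t.\<close>
    define e' where "e' = e / (4 * (t - s + 1))"
    have e': "e' > 0" using e st by (simp add: e'_def)
    have "\<exists>r>0. \<forall>y\<in>{s..t}. \<bar>y - x\<bar> < r \<longrightarrow> norm (f y - f x - (y - x) *\<^sub>R g x) \<le> e' * \<bar>y - x\<bar>"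
      if "x \<in> {s..t} - N" for x
      using der[OF that] e' unfolding has_vector_derivative_def has_derivative_within_alt
      by (auto simp: norm_minus_commute)
    then obtain r where r: "\<And>x. x \<in> {s..t} - N \<Longrightarrow> r x > 0"
       "\<And>x y. x \<in> {s..t} - N \<Longrightarrow> y \<in> {s..t} \<Longrightarrow> \<bar>y - x\<bar> < r x \<Longrightarrow> norm (f y - f x - (y - x) *\<^sub>R g x) \<le> e' * \<bar>y - x\<bar>"
      by metis
    define \<gamma> where "\<gamma> x = (if x \<in> N then U else if x \<in> {s..t} then ball x (r x) else ball x 1)" for x
    have gauge: "gauge \<gamma>" using U r(1) by (auto simp: gauge_def \<gamma>_def)
    have main: "norm ((\<Sum>(x,k)\<in>p. measure lborel k *\<^sub>R g' x) - (f t - f s)) < e"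
      if pf: "p tagged_division_of {s..t} \<and> \<gamma> fine p" for p
    proof -
      have p: "p tagged_division_of {s..t}" and fine: "\<gamma> fine p" using pf by auto
      have fin: "finite p" using p by blast
      define F where "F = (\<lambda>(x::real,K::real set). measure lborel K *\<^sub>R g' x - (f (Sup K) - f (Inf K)))"
      have eq: "(\<Sum>(x,k)\<in>p. measure lborel k *\<^sub>R g' x) - (f t - f s) = sum F p"
        using additive_tagged_division_1[OF st p, of f] by (simp add: F_def case_prod_unfold sum_subtractf)
      define p1 where "p1 = {z\<in>p. fst z \<in> N}"
      define p2 where "p2 = {z\<in>p. fst z \<notin> N}"
      have p1: "p1 tagged_partial_division_of {s..t}"
        using p by (auto simp: p1_def tagged_division_of_def intro: tagged_partial_division_subset)
      have sp: "sum F p = sum F p1 + sum F p2"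
        using fin by (subst sum.union_disjoint[symmetric]) (auto simp: p1_def p2_def intro!: sum.cong)
      have "(\<Sum>(x,K)\<in>p1. measure lborel K) \<le> measure lebesgue U"
        using fineD[OF fine] by (intro tagged_partial_division_content_le[OF p1 U(3)]) (fastforce simp: p1_def \<gamma>_def)
      then have "(\<Sum>(x,K)\<in>p1. norm (f (Sup K) - f (Inf K))) < e/2" using D[OF p1] U by linarith
      moreover have "norm (sum F p1) \<le> (\<Sum>(x,K)\<in>p1. norm (f (Sup K) - f (Inf K)))"
        by (rule sum_norm_le) (auto simp: F_def p1_def g'_def norm_minus_commute)
      ultimately have b1: "norm (sum F p1) < e/2" by linarith
      have "norm (sum F p2) \<le> (\<Sum>(x,K)\<in>p2. e' * measure lborel K)"
      proof (rule sum_norm_le)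
        fix z assume z: "z \<in> p2"
        obtain x K where xK: "z = (x,K)" by (cases z)
        have zp: "(x,K) \<in> p" "x \<notin> N" using z xK by (auto simp: p2_def)
        obtain u v where uv: "K = {u..v}" "x \<in> K" "K \<subseteq> {s..t}"
          using tagged_division_ofD(2-4)[OF p zp(1)] by auto
        have uxv: "u \<le> x" "x \<le> v" "x \<in> {s..t} - N" using uv zp by auto
        have sub: "{u..v} \<subseteq> ball x (r x)" using fineD[OF fine zp(1)] zp uv uxv by (auto simp: \<gamma>_def)
        have "u \<in> {u..v}" "v \<in> {u..v}" using uxv by auto
        then have mem: "\<bar>u - x\<bar> < r x" "\<bar>v - x\<bar> < r x" using subsetD[OF sub, of u] subsetD[OF sub, of v] by (auto simp: dist_real_def abs_minus_commute)
        have 1: "norm (f v - f x - (v - x) *\<^sub>R g x) \<le> e' * \<bar>v - x\<bar>"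
          using mem uv uxv by (intro r(2) uxv) auto
        have 2: "norm (f u - f x - (u - x) *\<^sub>R g x) \<le> e' * \<bar>u - x\<bar>"
          using mem uv uxv by (intro r(2) uxv) auto
        \<comment> \<open>The errors from the tag to the two end points are subtracted, and the
          lengths of the two pieces add up to that of K.\<close>
        have "F z = - ((f v - f x - (v - x) *\<^sub>R g x) - (f u - f x - (u - x) *\<^sub>R g x))"
          using uxv zp uv xK by (simp add: F_def g'_def algebra_simps)
        then have "norm (F z) \<le> norm (f v - f x - (v - x) *\<^sub>R g x) + norm (f u - f x - (u - x) *\<^sub>R g x)"
          by (metis norm_minus_cancel norm_triangle_ineq4)
        also have "\<dots> \<le> e' * \<bar>v - x\<bar> + e' * \<bar>u - x\<bar>" using 1 2 by linarith
        also have "\<dots> = e' * measure lborel K" using uxv uv by (simp add: algebra_simps)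
        finally show "norm (F z) \<le> (case z of (x, K) \<Rightarrow> e' * measure lborel K)" by (simp add: xK)
      qed
      also have "\<dots> \<le> (\<Sum>(x,K)\<in>p. e' * measure lborel K)"
        using fin e' by (intro sum_mono2) (auto simp: p2_def)
      also have "\<dots> = e' * (t - s)"
        using additive_content_tagged_division[of p s t] p st by (simp add: case_prod_unfold flip: sum_distrib_left)
              also have "\<dots> < e' * (2 * (t - s + 1))" using e' st by (intro mult_strict_left_mono) auto
      also have "\<dots> = e/2" using st by (simp add: e'_def field_simps)
      finally have "norm (sum F p2) < e/2" .
      then show ?thesis using b1 eq sp norm_triangle_ineq[of "sum F p1" "sum F p2"] by simp
    qed
    show "\<exists>\<gamma>. gauge \<gamma> \<and> (\<forall>p. p tagged_division_of {s..t} \<and> \<gamma> fine p \<longrightarrow>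
        norm ((\<Sum>(x,k)\<in>p. measure lborel k *\<^sub>R g' x) - (f t - f s)) < e)"
      using gauge main by (intro exI[of _ \<gamma>]) auto
  qed
  then show ?thesis
    using has_integral_spike[OF N, of "{s..t}" g g'] by (auto simp: g'_def)
qed

lemma absolutely_continuous_fun_on_subset:
  assumes "absolutely_continuous_fun_on s t f" "s \<le> s'" "t' \<le> t"
  shows "absolutely_continuous_fun_on s' t' f"
  unfolding absolutely_continuous_fun_on_def
proof (intro allI impI)
  fix \<epsilon> :: real assume "\<epsilon> > 0"
  then obtain \<delta> where "\<delta> > 0" and D: "\<And>(n::nat) a b. (\<forall>i<n. s \<le> a i \<and> a i \<le> b i \<and> b i \<le> t) \<and>
        disjoint_family_on (\<lambda>i. {a i<..<b i}) {..<n} \<and>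
        (\<Sum>i<n. b i - a i) < \<delta> \<Longrightarrow> (\<Sum>i<n. norm (f (b i) - f (a i))) < \<epsilon>"
    using assms(1) unfolding absolutely_continuous_fun_on_def by meson
  have main: "(\<Sum>i<n. norm (f (b i) - f (a i))) < \<epsilon>" if *: "(\<forall>i<n. s' \<le> a i \<and> a i \<le> b i \<and> b i \<le> t') \<and>
      disjoint_family_on (\<lambda>i. {a i<..<b i}) {..<n} \<and> (\<Sum>i<n. b i - a i) < \<delta>" for n :: nat and a b
  proof -
    have "\<forall>i<n. s \<le> a i \<and> a i \<le> b i \<and> b i \<le> t" using * assms(2,3) by (smt (verit))
    then show ?thesis using D * by blast
  qed
  show "\<exists>\<delta>>0. \<forall>(n::nat) a b. (\<forall>i<n. s' \<le> a i \<and> a i \<le> b i \<and> b i \<le> t') \<and>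
        disjoint_family_on (\<lambda>i. {a i<..<b i}) {..<n} \<and>
        (\<Sum>i<n. b i - a i) < \<delta> \<longrightarrow> (\<Sum>i<n. norm (f (b i) - f (a i))) < \<epsilon>"
  proof (intro exI[of _ \<delta>] conjI allI impI)
    show "\<delta> > 0" by fact
  qed (rule main)
qed

lemma absolutely_continuous_fun_on_imp_continuous_on:
  assumes ac: "absolutely_continuous_fun_on s t f"
  shows "continuous_on {s..t} f"
  unfolding continuous_on_iff
proof (intro ballI allI impI)
  fix x \<epsilon> :: real assume x: "x \<in> {s..t}" and e: "\<epsilon> > 0"
  obtain \<delta> where d: "\<delta> > 0" and D: "\<And>(n::nat) a b. (\<forall>i<n. s \<le> a i \<and> a i \<le> b i \<and> b i \<le> t) \<and>
        disjoint_family_on (\<lambda>i. {a i<..<b i}) {..<n} \<and>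
        (\<Sum>i<n. b i - a i) < \<delta> \<Longrightarrow> (\<Sum>i<n. norm (f (b i) - f (a i))) < \<epsilon>"
    using ac e unfolding absolutely_continuous_fun_on_def by meson
  have "norm (f y - f x) < \<epsilon>" if y: "y \<in> {s..t}" "dist y x < \<delta>" for y
    using D[of 1 "\<lambda>_. min x y" "\<lambda>_. max x y"] x y
    by (cases "x \<le> y") (auto simp: dist_real_def disjoint_family_on_def lessThan_Suc norm_minus_commute max_def min_def)
  then show "\<exists>d>0. \<forall>x'\<in>{s..t}. dist x' x < d \<longrightarrow> dist (f x') (f x) < \<epsilon>"
    using d by (auto simp: dist_norm)
qed

text \<open>Domination of the increments of h by those of f and g carries a common \<delta> over to
  h; the results below on C1 functions, sums and products are instances.\<close>

lemma absolutely_continuous_fun_on_dominated: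
  assumes "absolutely_continuous_fun_on s t f" "absolutely_continuous_fun_on s t g" and "L \<ge> 0"
    and le: "\<And>x y. x \<in> {s..t} \<Longrightarrow> y \<in> {s..t} \<Longrightarrow> x \<le> y \<Longrightarrow>
      norm (h y - h x) \<le> L * (norm (f y - f x) + norm (g y - g x))"
  shows "absolutely_continuous_fun_on s t h"
  unfolding absolutely_continuous_fun_on_def
proof (intro allI impI)
  fix \<epsilon> :: real assume e: "\<epsilon> > 0"
  \<comment> \<open>Both sums are below e', so the total is below (L + 1) (e' + e') = \<epsilon>,
    also for L = 0.\<close>
  define e' where "e' = \<epsilon> / (2 * (L + 1))"
  have e': "e' > 0" using e \<open>L \<ge> 0\<close> by (simp add: e'_def)
  obtain \<delta>1 where d1: "\<delta>1 > 0" and D1: "\<And>(n::nat) a b. (\<forall>i<n. s \<le> a i \<and> a i \<le> b i \<and> b i \<le> t) \<and>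
        disjoint_family_on (\<lambda>i. {a i<..<b i}) {..<n} \<and>
        (\<Sum>i<n. b i - a i) < \<delta>1 \<Longrightarrow> (\<Sum>i<n. norm (f (b i) - f (a i))) < e'"
    using assms(1) e' unfolding absolutely_continuous_fun_on_def by meson
  obtain \<delta>2 where d2: "\<delta>2 > 0" and D2: "\<And>(n::nat) a b. (\<forall>i<n. s \<le> a i \<and> a i \<le> b i \<and> b i \<le> t) \<and>
        disjoint_family_on (\<lambda>i. {a i<..<b i}) {..<n} \<and>
        (\<Sum>i<n. b i - a i) < \<delta>2 \<Longrightarrow> (\<Sum>i<n. norm (g (b i) - g (a i))) < e'"
    using assms(2) e' unfolding absolutely_continuous_fun_on_def by meson
  have main: "(\<Sum>i<n. norm (h (b i) - h (a i))) < \<epsilon>"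
    if *: "(\<forall>i<n. s \<le> a i \<and> a i \<le> b i \<and> b i \<le> t) \<and>
        disjoint_family_on (\<lambda>i. {a i<..<b i}) {..<n} \<and> (\<Sum>i<n. b i - a i) < min \<delta>1 \<delta>2" for n :: nat and a b
  proof -
    have "(\<Sum>i<n. norm (h (b i) - h (a i))) \<le> (\<Sum>i<n. L * (norm (f (b i) - f (a i)) + norm (g (b i) - g (a i))))"
    proof (rule sum_mono)
      fix i assume "i \<in> {..<n}"
      then have "s \<le> a i" "a i \<le> b i" "b i \<le> t" using * by auto
      then show "norm (h (b i) - h (a i)) \<le> L * (norm (f (b i) - f (a i)) + norm (g (b i) - g (a i)))"
        by (intro le) auto
    qed
    also have "\<dots> = L * ((\<Sum>i<n. norm (f (b i) - f (a i))) + (\<Sum>i<n. norm (g (b i) - g (a i))))"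
      by (simp add: sum.distrib flip: sum_distrib_left)
    also have "\<dots> \<le> L * (e' + e')"
      using D1[of n a b] D2[of n a b] * \<open>L \<ge> 0\<close> by (intro mult_left_mono add_mono) auto
    also have "\<dots> < (L + 1) * (e' + e')" using e' by simp
    also have "\<dots> = \<epsilon>" using \<open>L \<ge> 0\<close> by (simp add: e'_def divide_simps)
    finally show ?thesis .
  qed
  show "\<exists>\<delta>>0. \<forall>(n::nat) a b. (\<forall>i<n. s \<le> a i \<and> a i \<le> b i \<and> b i \<le> t) \<and>
        disjoint_family_on (\<lambda>i. {a i<..<b i}) {..<n} \<and>
        (\<Sum>i<n. b i - a i) < \<delta> \<longrightarrow> (\<Sum>i<n. norm (h (b i) - h (a i))) < \<epsilon>"
  proof (intro exI[of _ "min \<delta>1 \<delta>2"] conjI allI impI)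
    show "min \<delta>1 \<delta>2 > 0" using d1 d2 by simp
  qed (rule main)
qed

lemma absolutely_continuous_fun_on_ident: "absolutely_continuous_fun_on s t (\<lambda>x::real. x)"
  unfolding absolutely_continuous_fun_on_def
proof (intro allI impI)
  fix \<epsilon> :: real assume e: "\<epsilon> > 0"
  have "(\<Sum>i<n. norm (b i - a i)) < \<epsilon>"
    if *: "(\<forall>i<n. s \<le> a i \<and> a i \<le> b i \<and> b i \<le> t)" "(\<Sum>i<n. b i - a i) < \<epsilon>" for n :: nat and a b :: "nat \<Rightarrow> real"
  proof -
    have "(\<Sum>i<n. norm (b i - a i)) = (\<Sum>i<n. b i - a i)" using * by (intro sum.cong) auto
    then show ?thesis using * by simp
  qed
  then show "\<exists>\<delta>>0. \<forall>(n::nat) a b. (\<forall>i<n. s \<le> a i \<and> a i \<le> b i \<and> b i \<le> t) \<and>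
        disjoint_family_on (\<lambda>i. {a i<..<b i}) {..<n} \<and>
        (\<Sum>i<n. b i - a i) < \<delta> \<longrightarrow> (\<Sum>i<n. norm (b i - a i)) < \<epsilon>"
    using e by (intro exI[of _ \<epsilon>]) auto
qed

lemma absolutely_continuous_fun_on_C1:
  assumes der: "\<And>x. x \<in> {s..t} \<Longrightarrow> (f has_vector_derivative f' x) (at x within {s..t})"
    and cont: "continuous_on {s..t} f'"
  shows "absolutely_continuous_fun_on s t f"
proof -
  have "bounded (f' ` {s..t})" using compact_continuous_image[OF cont] compact_imp_bounded by blast
  then obtain L where L: "L > 0" "\<And>x. x \<in> {s..t} \<Longrightarrow> norm (f' x) \<le> L"
    by (auto simp: bounded_pos)
  show ?thesis
  proof (rule absolutely_continuous_fun_on_dominated[OF absolutely_continuous_fun_on_ident absolutely_continuous_fun_on_ident])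
    show "0 \<le> L" using L by simp
    fix x y assume xy: "x \<in> {s..t}" "y \<in> {s..t}" "x \<le> y"
    have "norm (f y - f x) \<le> L * norm (y - x)"
      by (rule differentiable_bound[OF convex_real_interval(5) der[unfolded has_vector_derivative_def]])
         (use L xy in \<open>auto simp: onorm_scaleR_left[OF bounded_linear_ident] onorm_id[unfolded id_def]\<close>)
    also have "\<dots> \<le> L * (norm (y - x) + norm (y - x))" using L by (intro mult_left_mono) auto
    finally show "norm (f y - f x) \<le> L * (norm (y - x) + norm (y - x))" .
  qed
qed

lemma absolutely_continuous_fun_on_add:
  assumes "absolutely_continuous_fun_on s t f" "absolutely_continuous_fun_on s t g"
  shows "absolutely_continuous_fun_on s t (\<lambda>x. f x + g x)"
proof (rule absolutely_continuous_fun_on_dominated[OF assms, of 1])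
  fix x y
  show "norm (f y + g y - (f x + g x)) \<le> 1 * (norm (f y - f x) + norm (g y - g x))"
    using norm_triangle_ineq[of "f y - f x" "g y - g x"] by (simp add: algebra_simps)
qed simp

lemma absolutely_continuous_fun_on_mult:
  fixes f g :: "real \<Rightarrow> 'b::real_normed_algebra"
  assumes "absolutely_continuous_fun_on s t f" "absolutely_continuous_fun_on s t g"
  shows "absolutely_continuous_fun_on s t (\<lambda>x. f x * g x)"
proof -
  have "bounded (f ` {s..t})" "bounded (g ` {s..t})"
    using assms[THEN absolutely_continuous_fun_on_imp_continuous_on]
    by (auto intro: compact_imp_bounded compact_continuous_image)
  then obtain A B where A: "A > 0" "\<And>x. x \<in> {s..t} \<Longrightarrow> norm (f x) \<le> A"
    and B: "B > 0" "\<And>x. x \<in> {s..t} \<Longrightarrow> norm (g x) \<le> B"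
    by (auto simp: bounded_pos)
  show ?thesis
  proof (rule absolutely_continuous_fun_on_dominated[OF assms])
    show "0 \<le> A + B" using A B by simp
    fix x y assume xy: "x \<in> {s..t}" "y \<in> {s..t}"
    have "f y * g y - f x * g x = f y * (g y - g x) + (f y - f x) * g x" by (simp add: algebra_simps)
    then have "norm (f y * g y - f x * g x) \<le> norm (f y) * norm (g y - g x) + norm (f y - f x) * norm (g x)"
      by (metis norm_triangle_le add_mono norm_mult_ineq)
    also have "\<dots> \<le> (A + B) * norm (g y - g x) + norm (f y - f x) * (A + B)"
      using A(2)[OF xy(2)] B(2)[OF xy(1)] A B by (intro add_mono mult_right_mono mult_left_mono) auto
    finally show "norm (f y * g y - f x * g x) \<le> (A + B) * (norm (f y - f x) + norm (g y - g x))"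
      by (simp add: algebra_simps)
  qed
qed

text \<open>The integrand splits into a part bounded by M, which contributes at most M times the
  length, and the excess over M, whose integral over the whole interval is already small by
  dominated convergence.\<close>

lemma absolutely_continuous_fun_on_integral:
  fixes g :: "real \<Rightarrow> 'b::euclidean_space"
  assumes g: "g absolutely_integrable_on {s..t}"
  shows "absolutely_continuous_fun_on s t (\<lambda>x. c + integral {s..x} g)"
  unfolding absolutely_continuous_fun_on_def
proof (intro allI impI)
  fix \<epsilon> :: real assume e: "\<epsilon> > 0"
  have ng: "(\<lambda>x. norm (g x)) absolutely_integrable_on {s..t}"
    using g by (rule set_integrable_norm)
  define h where "h M x = max (norm (g x) - real M) 0" for M :: nat and x
  have h_int: "h M absolutely_integrable_on {s..t}" for M
  proof -
    have "(\<lambda>x. max (norm (g x) - real M) 0) absolutely_integrable_on {s..t}"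
      by (intro absolutely_integrable_max_1 set_integral_diff ng) auto
    moreover have "h M = (\<lambda>x. max (norm (g x) - real M) 0)" by (simp add: h_def fun_eq_iff)
    ultimately show ?thesis by simp
  qed
  have "(\<lambda>M. integral {s..t} (h M)) \<longlonglongrightarrow> integral {s..t} (\<lambda>x. 0)"
  proof (rule dominated_convergence(2))
    show "h M integrable_on {s..t}" for M using h_int set_lebesgue_integral_eq_integral(1) by blast
    show "(\<lambda>x. norm (g x)) integrable_on {s..t}" using ng set_lebesgue_integral_eq_integral(1) by blast
    show "norm (h M x) \<le> norm (g x)" if "x \<in> {s..t}" for M x by (simp add: h_def)
    show "(\<lambda>M. h M x) \<longlonglongrightarrow> 0" if "x \<in> {s..t}" for x
    proof (rule tendsto_eventually)
      obtain M0 :: nat where "norm (g x) \<le> M0" using real_arch_simple by blast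
      then show "\<forall>\<^sub>F M in sequentially. h M x = 0"
        by (auto simp: eventually_sequentially h_def intro!: exI[of _ M0])
    qed
  qed
  then have "\<forall>\<^sub>F M in sequentially. integral {s..t} (h M) < \<epsilon>/2"
    using e by (intro order_tendstoD(2)) auto
  then obtain M where M: "integral {s..t} (h M) < \<epsilon>/2" by (auto simp: eventually_sequentially)
  define \<delta> where "\<delta> = \<epsilon> / (2 * (real M + 1))"
  have "(\<Sum>i<n. norm ((c + integral {s..b i} g) - (c + integral {s..a i} g))) < \<epsilon>"
    if ab: "\<And>i. i < n \<Longrightarrow> s \<le> a i \<and> a i \<le> b i \<and> b i \<le> t"
      and dis: "disjoint_family_on (\<lambda>i. {a i<..<b i}) {..<n}" and len: "(\<Sum>i<n. b i - a i) < \<delta>" for n :: nat and a b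
  proof -
    have le1: "norm ((c + integral {s..b i} g) - (c + integral {s..a i} g)) \<le> integral {a i..b i} (h M) + M * (b i - a i)"
      if i: "i < n" for i
    proof -
      have sub: "{a i..b i} \<subseteq> {s..t}" "{s..b i} \<subseteq> {s..t}" using ab[OF i] by auto
      have gi: "g integrable_on {s..b i}"
        using absolutely_integrable_on_subinterval[OF g sub(2)] set_lebesgue_integral_eq_integral(1) by blast
      have hi: "h M integrable_on {a i..b i}"
        using absolutely_integrable_on_subinterval[OF h_int sub(1)] set_lebesgue_integral_eq_integral(1) by blast
      have gi2: "g integrable_on {a i..b i}" by (rule integrable_on_subinterval[OF gi]) (use ab[OF i] in auto)
      have "integral {s..a i} g + integral {a i..b i} g = integral {s..b i} g"
        by (rule Henstock_Kurzweil_Integration.integral_combine) (use ab[OF i] gi in auto)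
      then have "norm ((c + integral {s..b i} g) - (c + integral {s..a i} g)) = norm (integral {a i..b i} g)"
        by (metis add_diff_cancel_left add_diff_cancel_left')
      also have "\<dots> \<le> integral {a i..b i} (\<lambda>x. h M x + M)"
        by (rule integral_norm_bound_integral) (use integrable_add[OF hi integrable_const_ivl[of "real M"]] gi2 in \<open>auto simp: h_def\<close>)
      also have "\<dots> = integral {a i..b i} (h M) + M * (b i - a i)"
        using hi ab[OF i] by (subst integral_add) auto
      finally show ?thesis .
    qed
    have "(\<Sum>i<n. integral {a i..b i} (h M)) \<le> integral {s..t} (h M)"
    proof -
      have hI: "h M integrable_on {s..t}" using h_int set_lebesgue_integral_eq_integral(1) by blast
      \<comment> \<open>Open intervals, because closed ones may share end points; the integrals are
        the same.\<close>
      have ind: "(\<lambda>x. if x \<in> {a i<..<b i} then h M x else 0) integrable_on {s..t}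
          \<and> integral {a i..b i} (h M) = integral {s..t} (\<lambda>x. if x \<in> {a i<..<b i} then h M x else 0)"
        if i: "i < n" for i
      proof -
        have sub: "{a i..b i} \<subseteq> {s..t}" "{a i<..<b i} \<subseteq> {s..t}" using ab[OF i] by auto
        have "(h M has_integral integral {a i..b i} (h M)) {a i<..<b i}"
          using integrable_integral[OF integrable_on_subinterval[OF hI sub(1)]] by (simp add: has_integral_Icc_iff_Ioo)
        then have "((\<lambda>x. if x \<in> {a i<..<b i} then h M x else 0) has_integral integral {a i..b i} (h M)) {s..t}"
          using sub by (subst has_integral_restrict) auto
        then show ?thesis by (auto simp: has_integral_iff)
      qed
      have "(\<Sum>i<n. integral {a i..b i} (h M)) = (\<Sum>i<n. integral {s..t} (\<lambda>x. if x \<in> {a i<..<b i} then h M x else 0))"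
        using ind by (intro sum.cong) auto
      also have "\<dots> = integral {s..t} (\<lambda>x. \<Sum>i<n. if x \<in> {a i<..<b i} then h M x else 0)"
        using ind by (intro integral_sum[symmetric]) auto
      also have "\<dots> \<le> integral {s..t} (h M)"
      proof (rule integral_le)
        show "(\<lambda>x. \<Sum>i<n. if x \<in> {a i<..<b i} then h M x else 0) integrable_on {s..t}"
          using ind by (intro integrable_sum) auto
        fix x
        show "(\<Sum>i<n. if x \<in> {a i<..<b i} then h M x else 0) \<le> h M x"
        proof (cases "\<exists>j<n. x \<in> {a j<..<b j}")
          case True
          then obtain j where j: "j < n" "x \<in> {a j<..<b j}" by blast
          have "x \<notin> {a i<..<b i}" if "i < n" "i \<noteq> j" for i
            using dis j that unfolding disjoint_family_on_def by blast
          then have "(\<Sum>i<n. if x \<in> {a i<..<b i} then h M x else 0) = (\<Sum>i<n. if i = j then h M x else 0)"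
            using j by (intro sum.cong) auto
          then show ?thesis using j by simp
        next
          case False
          then have "(\<Sum>i<n. if x \<in> {a i<..<b i} then h M x else 0) = 0" by (intro sum.neutral) auto
          then show ?thesis by (simp add: h_def)
        qed
      qed (use hI in auto)
      finally show ?thesis .
    qed
    moreover have "(\<Sum>i<n. M * (b i - a i)) \<le> M * \<delta>"
      using len by (auto simp flip: sum_distrib_left intro!: mult_left_mono)
    moreover have "M * \<delta> \<le> \<epsilon>/2" using e by (simp add: \<delta>_def field_simps)
    moreover have "(\<Sum>i<n. norm ((c + integral {s..b i} g) - (c + integral {s..a i} g)))
        \<le> (\<Sum>i<n. integral {a i..b i} (h M)) + (\<Sum>i<n. M * (b i - a i))"
      using le1 by (auto simp flip: sum.distrib intro!: sum_mono)
    ultimately show ?thesis using M by linarith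
  qed
  moreover have "\<delta> > 0" using e by (simp add: \<delta>_def)
  ultimately show "\<exists>\<delta>>0. \<forall>(n::nat) a b. (\<forall>i<n. s \<le> a i \<and> a i \<le> b i \<and> b i \<le> t) \<and>
        disjoint_family_on (\<lambda>i. {a i<..<b i}) {..<n} \<and>
        (\<Sum>i<n. b i - a i) < \<delta> \<longrightarrow> (\<Sum>i<n. norm ((c + integral {s..b i} g) - (c + integral {s..a i} g))) < \<epsilon>"
    by blast
qed

lemma has_vector_derivative_right_left:
  fixes f :: "real \<Rightarrow> 'b::real_normed_vector"
  assumes "\<And>e. e > 0 \<Longrightarrow> \<exists>d>0. \<forall>h. 0 < h \<and> h < d \<longrightarrow> norm ((f (x + h) - f x) /\<^sub>R h - D) < e"
    and "\<And>e. e > 0 \<Longrightarrow> \<exists>d>0. \<forall>h. 0 < h \<and> h < d \<longrightarrow> norm ((f x - f (x - h)) /\<^sub>R h - D) < e"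
  shows "(f has_vector_derivative D) (at x)"
  unfolding has_vector_derivative_def has_derivative_at_alt
proof (intro conjI bounded_linear_scaleR_left allI impI)
  fix e :: real assume e: "e > 0"
  obtain d1 where d1: "d1 > 0" "\<And>h. 0 < h \<Longrightarrow> h < d1 \<Longrightarrow> norm ((f (x + h) - f x) /\<^sub>R h - D) < e"
    using assms(1)[OF e] by blast
  obtain d2 where d2: "d2 > 0" "\<And>h. 0 < h \<Longrightarrow> h < d2 \<Longrightarrow> norm ((f x - f (x - h)) /\<^sub>R h - D) < e"
    using assms(2)[OF e] by blast
  have "norm (f y - f x - (y - x) *\<^sub>R D) \<le> e * norm (y - x)" if y: "norm (y - x) < min d1 d2" for y
  proof (cases y x rule: linorder_cases)
    case less
    define h where "h = x - y"
    have h: "0 < h" "h < d2" using less y by (auto simp: h_def)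
    have "norm (f y - f x - (y - x) *\<^sub>R D) = norm (h *\<^sub>R ((f x - f (x - h)) /\<^sub>R h - D))"
    proof -
      have "h *\<^sub>R ((f x - f (x - h)) /\<^sub>R h - D) = f x - f (x - h) - h *\<^sub>R D"
        using h by (simp add: scaleR_diff_right)
      also have "\<dots> = - (f y - f x - (y - x) *\<^sub>R D)" by (simp add: h_def algebra_simps)
      finally show ?thesis by (metis norm_minus_cancel)
    qed
    also have "\<dots> = h * norm ((f x - f (x - h)) /\<^sub>R h - D)" using h by simp
    also have "\<dots> \<le> h * e" using d2(2)[OF h] h by (intro mult_left_mono) auto
    finally show ?thesis using less by (simp add: h_def mult.commute)
  next
    case greater
    define h where "h = y - x"
    have h: "0 < h" "h < d1" using greater y by (auto simp: h_def)
    have "norm (f y - f x - (y - x) *\<^sub>R D) = norm (h *\<^sub>R ((f (x + h) - f x) /\<^sub>R h - D))"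
    proof -
      have "h *\<^sub>R ((f (x + h) - f x) /\<^sub>R h - D) = f (x + h) - f x - h *\<^sub>R D"
        using h by (simp add: scaleR_diff_right)
      then show ?thesis by (simp add: h_def)
    qed
    also have "\<dots> = h * norm ((f (x + h) - f x) /\<^sub>R h - D)" using h by simp
    also have "\<dots> \<le> h * e" using d1(2)[OF h] h by (intro mult_left_mono) auto
    finally show ?thesis using greater by (simp add: h_def mult.commute)
  qed simp
  then show "\<exists>d>0. \<forall>y. norm (y - x) < d \<longrightarrow> norm (f y - f x - (y - x) *\<^sub>R D) \<le> e * norm (y - x)"
    using d1(1) d2(1) by (intro exI[of _ "min d1 d2"]) auto
qed

text \<open>The library's differentiation theorem for indefinite integrals is one-sided; the left
  derivative comes from applying it to the reflected function.\<close>

theorem lebesgue_differentiation: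
  fixes g :: "real \<Rightarrow> 'b::euclidean_space"
  assumes g: "g absolutely_integrable_on {s..t}"
  obtains N where "negligible N"
    "\<And>x. x \<in> {s<..<t} - N \<Longrightarrow> ((\<lambda>x. integral {s..x} g) has_vector_derivative g x) (at x)"
proof -
  \<comment> \<open>Extension by 0 makes the function integrable over every interval, so that the
    one-sided theorem applies to it and to its reflection.\<close>
  define G where "G u = (if u \<in> {s..t} then g u else 0)" for u
  have "(\<lambda>u. if u \<in> {s..t} then g u else 0) absolutely_integrable_on UNIV"
    using g by (rule absolutely_integrable_restrict_UNIV[THEN iffD2])
  then have G: "G absolutely_integrable_on UNIV" by (simp add: G_def[abs_def])
  then have Gi: "G integrable_on {u..v}" for u v
    using absolutely_integrable_on_subinterval set_lebesgue_integral_eq_integral(1) by (metis subset_UNIV)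
  obtain N1 where N1: "negligible N1" "\<And>x e. \<lbrakk>x \<notin> N1; 0 < e\<rbrakk> \<Longrightarrow>
               \<exists>d>0. \<forall>h. 0 < h \<and> h < d \<longrightarrow> norm(integral {x..x + h} G /\<^sub>R h - G x) < e"
    using integrable_ccontinuous_explicit[of G] Gi by auto
  have "(\<lambda>u. G (- u)) integrable_on {u..v}" for u v
    using Gi[of "-v" "-u"] Henstock_Kurzweil_Integration.integrable_reflect_real[where f = G and a = "-v" and b = "-u"] by simp
  then obtain N2 where N2: "negligible N2" "\<And>x e. \<lbrakk>x \<notin> N2; 0 < e\<rbrakk> \<Longrightarrow>
               \<exists>d>0. \<forall>h. 0 < h \<and> h < d \<longrightarrow> norm(integral {x..x + h} (\<lambda>u. G (- u)) /\<^sub>R h - G (- x)) < e"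
    using integrable_ccontinuous_explicit[of "\<lambda>u. G (- u)"] by auto
  have neg: "negligible (uminus ` N2)"
    using N2(1) by (intro negligible_differentiable_image_negligible) (auto intro!: derivative_intros)
  have diff: "integral {s..v} g - integral {s..u} g = integral {u..v} G" if "s \<le> u" "u \<le> v" "v \<le> t" for u v
  proof -
    have gi: "g integrable_on {s..v}"
      using absolutely_integrable_on_subinterval[OF g, of s v] that set_lebesgue_integral_eq_integral(1) by auto
    have "integral {s..u} g + integral {u..v} g = integral {s..v} g"
      by (rule Henstock_Kurzweil_Integration.integral_combine) (use that gi in auto)
    moreover have "integral {u..v} g = integral {u..v} G"
      by (rule integral_cong) (use that in \<open>auto simp: G_def\<close>)
    ultimately show ?thesis by (metis add_diff_cancel_left')
  qed
  show ?thesis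
  proof (rule that[of "N1 \<union> uminus ` N2"])
    show "negligible (N1 \<union> uminus ` N2)" using N1(1) neg by (rule negligible_Un)
    fix x assume x: "x \<in> {s<..<t} - (N1 \<union> uminus ` N2)"
    then have xn: "x \<notin> N1" "- x \<notin> N2" by (auto simp: image_iff)
    show "((\<lambda>x. integral {s..x} g) has_vector_derivative g x) (at x)"
    proof (rule has_vector_derivative_right_left)
      fix e :: real assume e: "e > 0"
      obtain d where d: "d > 0" "\<And>h. 0 < h \<Longrightarrow> h < d \<Longrightarrow> norm(integral {x..x + h} G /\<^sub>R h - G x) < e"
        using N1(2)[OF xn(1) e] by blast
      have "norm ((integral {s..x + h} g - integral {s..x} g) /\<^sub>R h - g x) < e" if "0 < h" "h < min d (t - x)" for h
        using d(2)[of h] that x diff[of x "x + h"] by (simp add: G_def)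
      moreover have "min d (t - x) > 0" using d x by simp
      ultimately show "\<exists>d>0. \<forall>h. 0 < h \<and> h < d \<longrightarrow> norm ((integral {s..x + h} g - integral {s..x} g) /\<^sub>R h - g x) < e"
        by blast
    next
      fix e :: real assume e: "e > 0"
      obtain d where d: "d > 0" "\<And>h. 0 < h \<Longrightarrow> h < d \<Longrightarrow> norm(integral {-x..-x + h} (\<lambda>u. G (- u)) /\<^sub>R h - G (- (-x))) < e"
        using N2(2)[OF xn(2) e] by blast
      have "norm ((integral {s..x} g - integral {s..x - h} g) /\<^sub>R h - g x) < e" if "0 < h" "h < min d (x - s)" for h
      proof -
        have "G x = g x" using x by (simp add: G_def)
        moreover have "integral {-x..-x + h} (\<lambda>u. G (- u)) = integral {x - h..x} G"
          using Henstock_Kurzweil_Integration.integral_reflect_real[where f = G and a = "x - h" and b = x] by simp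
        ultimately show ?thesis using d(2)[of h] that x diff[of "x - h" x] by simp
      qed
      moreover have "min d (x - s) > 0" using d x by simp
      ultimately show "\<exists>d>0. \<forall>h. 0 < h \<and> h < d \<longrightarrow> norm ((integral {s..x} g - integral {s..x - h} g) /\<^sub>R h - g x) < e"
        by blast
    qed
  qed
qed

section \<open>A calculus of absolutely continuous functions and their almost everywhere
  derivatives\<close>

lemma integrable_if_absolutely_integrable:
  fixes f :: "'a::euclidean_space \<Rightarrow> 'b::euclidean_space"
  shows "f absolutely_integrable_on S \<Longrightarrow> f integrable_on S"
  by (rule set_lebesgue_integral_eq_integral(1))

text \<open>The null set is hidden existentially, and derivatives at s and t are one-sided.
  Integration by parts thereby becomes algebra of such pairs (f, f') followed by
  \<open>ac_derivative_has_integral\<close>.\<close>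

definition ac_derivative :: "real \<Rightarrow> real \<Rightarrow> (real \<Rightarrow> 'b::euclidean_space) \<Rightarrow> (real \<Rightarrow> 'b) \<Rightarrow> bool" where
  "ac_derivative s t f f' \<longleftrightarrow> absolutely_continuous_fun_on s t f \<and>
     (\<exists>N. negligible N \<and> (\<forall>x\<in>{s..t} - N. (f has_vector_derivative f' x) (at x within {s..t})))"

lemma ac_derivative_has_integral:
  assumes "ac_derivative s t f f'" "s \<le> t"
  shows "(f' has_integral (f t - f s)) {s..t}"
  using assms ac_has_integral unfolding ac_derivative_def by blast

lemma ac_derivative_continuous_on: "ac_derivative s t f f' \<Longrightarrow> continuous_on {s..t} f"
  unfolding ac_derivative_def by (blast intro: absolutely_continuous_fun_on_imp_continuous_on)

lemma ac_derivative_subset: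
  assumes "ac_derivative s t f f'" "s \<le> s'" "t' \<le> t"
  shows "ac_derivative s' t' f f'"
proof -
  have "{s'..t'} \<subseteq> {s..t}" using assms by auto
  then show ?thesis
    using assms unfolding ac_derivative_def
    by (meson absolutely_continuous_fun_on_subset has_vector_derivative_within_subset DiffD1 DiffD2 DiffI subsetD)
qed

lemma ac_derivative_eq:
  assumes "ac_derivative s t f f'" "\<And>x. x \<in> {s..t} \<Longrightarrow> f' x = g' x"
  shows "ac_derivative s t f g'"
  using assms unfolding ac_derivative_def by (metis DiffD1)

lemma ac_derivative_C1:
  assumes "\<And>x. x \<in> {s..t} \<Longrightarrow> (f has_vector_derivative f' x) (at x within {s..t})"
    and "continuous_on {s..t} f'"
  shows "ac_derivative s t f f'"
  unfolding ac_derivative_def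
  using assms absolutely_continuous_fun_on_C1[OF assms] by (auto intro: exI[of _ "{}"])

lemma ac_derivative_add:
  assumes "ac_derivative s t f f'" "ac_derivative s t g g'"
  shows "ac_derivative s t (\<lambda>x. f x + g x) (\<lambda>x. f' x + g' x)"
proof -
  obtain N1 N2 where N: "negligible N1" "\<And>x. x\<in>{s..t} - N1 \<Longrightarrow> (f has_vector_derivative f' x) (at x within {s..t})"
    "negligible N2" "\<And>x. x\<in>{s..t} - N2 \<Longrightarrow> (g has_vector_derivative g' x) (at x within {s..t})"
    using assms unfolding ac_derivative_def by blast
  then have "negligible (N1 \<union> N2)"
    "\<forall>x\<in>{s..t} - (N1 \<union> N2). ((\<lambda>x. f x + g x) has_vector_derivative f' x + g' x) (at x within {s..t})"
    by (auto intro: has_vector_derivative_add)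
  then show ?thesis
    using assms absolutely_continuous_fun_on_add unfolding ac_derivative_def by blast
qed

lemma ac_derivative_mult:
  fixes f g :: "real \<Rightarrow> complex"
  assumes "ac_derivative s t f f'" "ac_derivative s t g g'"
  shows "ac_derivative s t (\<lambda>x. f x * g x) (\<lambda>x. f x * g' x + f' x * g x)"
proof -
  obtain N1 N2 where N: "negligible N1" "\<And>x. x\<in>{s..t} - N1 \<Longrightarrow> (f has_vector_derivative f' x) (at x within {s..t})"
    "negligible N2" "\<And>x. x\<in>{s..t} - N2 \<Longrightarrow> (g has_vector_derivative g' x) (at x within {s..t})"
    using assms unfolding ac_derivative_def by blast
  then have "negligible (N1 \<union> N2)"
    "\<forall>x\<in>{s..t} - (N1 \<union> N2). ((\<lambda>x. f x * g x) has_vector_derivative f x * g' x + f' x * g x) (at x within {s..t})"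
    by (auto intro: has_vector_derivative_mult)
  then show ?thesis
    using assms absolutely_continuous_fun_on_mult unfolding ac_derivative_def by blast
qed

lemma ac_derivative_const: "ac_derivative s t (\<lambda>x. c) (\<lambda>x. 0)"
  by (rule ac_derivative_C1) auto

lemma ac_derivative_cmult:
  fixes f :: "real \<Rightarrow> complex"
  assumes "ac_derivative s t f f'"
  shows "ac_derivative s t (\<lambda>x. c * f x) (\<lambda>x. c * f' x)"
  using ac_derivative_mult[OF ac_derivative_const assms] by simp

lemma ac_derivative_diff:
  fixes f :: "real \<Rightarrow> complex"
  assumes "ac_derivative s t f f'" "ac_derivative s t g g'"
  shows "ac_derivative s t (\<lambda>x. f x - g x) (\<lambda>x. f' x - g' x)"
  using ac_derivative_add[OF assms(1) ac_derivative_cmult[OF assms(2), of "-1"]] by simp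

lemma ac_derivative_integral:
  fixes g :: "real \<Rightarrow> 'b::euclidean_space"
  assumes g: "g absolutely_integrable_on {s..t}"
  shows "ac_derivative s t (\<lambda>x. c + integral {s..x} g) g"
proof -
  obtain N where N: "negligible N"
    "\<And>x. x \<in> {s<..<t} - N \<Longrightarrow> ((\<lambda>x. integral {s..x} g) has_vector_derivative g x) (at x)"
    using lebesgue_differentiation[OF g] by blast
  \<comment> \<open>Differentiability of the indefinite integral is known only inside the interval,
    hence the end points join the null set.\<close>
  have "negligible (N \<union> {s, t})" using N by (auto intro: negligible_finite)
  moreover have "((\<lambda>x. c + integral {s..x} g) has_vector_derivative g x) (at x within {s..t})"
    if x: "x \<in> {s..t} - (N \<union> {s, t})" for x
    using has_vector_derivative_add[OF has_vector_derivative_const[of c] N(2)[of x]] x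
    by (auto intro: has_vector_derivative_at_within)
  ultimately show ?thesis
    using absolutely_continuous_fun_on_integral[OF g] unfolding ac_derivative_def by blast
qed

lemma absolutely_integrable_mult_continuous:
  fixes p :: "real \<Rightarrow> complex"
  assumes "p absolutely_integrable_on {s..t}" "continuous_on {s..t} g"
  shows "(\<lambda>x. p x * g x) absolutely_integrable_on {s..t}"
proof -
  have "(\<lambda>x. g x * p x) absolutely_integrable_on {s..t}"
    using compact_imp_bounded[OF compact_continuous_image[OF assms(2)]] assms
    by (intro absolutely_integrable_bounded_measurable_product[of "(*)"])
      (auto intro: bilinear_times continuous_imp_measurable_on_sets_lebesgue)
  then show ?thesis by (simp add: mult.commute)
qed

subsection \<open>The equation y'' = p y with a summable coefficient\<close>

text \<open>A first order system: y' = z everywhere, z' = p y almost everywhere. The complex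
  coefficient p absorbs the spectral parameter, as p = q - \<mu>.\<close>

definition ode_solution :: "(real \<Rightarrow> complex) \<Rightarrow> (real \<Rightarrow> complex) \<Rightarrow> (real \<Rightarrow> complex) \<Rightarrow> bool" where
  "ode_solution p y z \<longleftrightarrow>
     (\<forall>x\<in>{0..pi}. (y has_vector_derivative z x) (at x within {0..pi})) \<and>
     ac_derivative 0 pi z (\<lambda>x. p x * y x)"

lemma ode_solution_ac:
  assumes "ode_solution p y z"
  shows "ac_derivative 0 pi y z" "ac_derivative 0 pi z (\<lambda>x. p x * y x)"
  using assms ac_derivative_continuous_on unfolding ode_solution_def
  by (blast intro: ac_derivative_C1)+

lemma ode_solution_continuous:
  assumes "ode_solution p y z"
  shows "continuous_on {0..pi} y" "continuous_on {0..pi} z"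
  using ode_solution_ac[OF assms] ac_derivative_continuous_on by blast+

text \<open>The two notions differ in bookkeeping only: absolute continuity of y is free because its
  derivative is continuous, and the end points are added to the null set to pass between derivatives
  at a point and within the interval.\<close>

lemma sl_solution_iff_ode_solution:
  "sl_solution q \<mu> y y' \<longleftrightarrow> ode_solution (\<lambda>x. of_real (q x) - \<mu>) y y'"
proof
  assume sl: "sl_solution q \<mu> y y'"
  then have AE: "AE x in lebesgue. x \<in> {0<..<pi} \<longrightarrow>
        (\<exists>d. (y' has_vector_derivative d) (at x) \<and> - d + of_real (q x) * y x = \<mu> * y x)"
    and ac: "absolutely_continuous_fun_on 0 pi y'"
    and d: "\<forall>x\<in>{0..pi}. (y has_vector_derivative y' x) (at x within {0..pi})"
    unfolding sl_solution_def by auto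
  obtain N where N: "negligible N" "\<And>x. x \<in> {0<..<pi} - N \<Longrightarrow>
        (\<exists>d. (y' has_vector_derivative d) (at x) \<and> - d + of_real (q x) * y x = \<mu> * y x)"
    using AE unfolding eventually_ae_filter_negligible by blast
  have "negligible (N \<union> {0, pi})" using N by (auto intro: negligible_finite)
  moreover have "(y' has_vector_derivative ((of_real (q x) - \<mu>) * y x)) (at x within {0..pi})"
    if x: "x \<in> {0..pi} - (N \<union> {0, pi})" for x
  proof -
    have "x \<in> {0<..<pi} - N" using x by auto
    then obtain d where d: "(y' has_vector_derivative d) (at x)" "- d + of_real (q x) * y x = \<mu> * y x"
      using N(2) by blast
    from d(2) have "d = (of_real (q x) - \<mu>) * y x" by (simp add: algebra_simps add_eq_0_iff)
    then show ?thesis using d(1) by (auto intro: has_vector_derivative_at_within)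
  qed
  ultimately have "ac_derivative 0 pi y' (\<lambda>x. (of_real (q x) - \<mu>) * y x)"
    using ac unfolding ac_derivative_def by blast
  then show "ode_solution (\<lambda>x. of_real (q x) - \<mu>) y y'" using d unfolding ode_solution_def by blast
next
  assume o: "ode_solution (\<lambda>x. of_real (q x) - \<mu>) y y'"
  then obtain N where N: "negligible N" "\<And>x. x \<in> {0..pi} - N \<Longrightarrow>
        (y' has_vector_derivative ((of_real (q x) - \<mu>) * y x)) (at x within {0..pi})"
    unfolding ode_solution_def ac_derivative_def by blast
  have "\<exists>d. (y' has_vector_derivative d) (at x) \<and> - d + of_real (q x) * y x = \<mu> * y x"
    if x: "x \<in> {0<..<pi} - N" for x
  proof (intro exI conjI)
    have "(y' has_vector_derivative ((of_real (q x) - \<mu>) * y x)) (at x within {0..pi})"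
      using N(2)[of x] x by auto
    moreover have "at x within {0..pi} = at x" using x by (intro at_within_Icc_at) auto
    ultimately show "(y' has_vector_derivative ((of_real (q x) - \<mu>) * y x)) (at x)" by simp
  qed (simp add: algebra_simps)
  then have "AE x in lebesgue. x \<in> {0<..<pi} \<longrightarrow>
        (\<exists>d. (y' has_vector_derivative d) (at x) \<and> - d + of_real (q x) * y x = \<mu> * y x)"
    unfolding eventually_ae_filter_negligible using N(1) by blast
  then show "sl_solution q \<mu> y y'"
    using o ode_solution_ac[OF o] unfolding sl_solution_def ode_solution_def ac_derivative_def by blast
qed

lemma ode_solution_lincomb:
  assumes "ode_solution p y z" "ode_solution p u v"
  shows "ode_solution p (\<lambda>x. c * y x + d * u x) (\<lambda>x. c * z x + d * v x)"
proof -
  have 1: "ac_derivative 0 pi (\<lambda>x. c * z x + d * v x) (\<lambda>x. p x * (c * y x + d * u x))"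
    using ac_derivative_add[OF ac_derivative_cmult[OF ode_solution_ac(2)[OF assms(1)]] ac_derivative_cmult[OF ode_solution_ac(2)[OF assms(2)]], of c d]
    by (simp add: algebra_simps)
  have "((\<lambda>x. c * y x + d * u x) has_vector_derivative c * z x + d * v x) (at x within {0..pi})"
    if "x \<in> {0..pi}" for x
    using assms that unfolding ode_solution_def
    by (intro has_vector_derivative_add has_vector_derivative_mult_right) auto
  then show ?thesis using 1 unfolding ode_solution_def by blast
qed

text \<open>The two terms z v in the derivative of y v - z u cancel, leaving (r - p) y u. Equal
  coefficients give a constant Wronskian; two spectral parameters give the derivative of the
  characteristic function.\<close>

lemma ode_lagrange:
  assumes "ode_solution p y z" "ode_solution r u v" "x \<in> {0..pi}"
  shows "((\<lambda>t. (r t - p t) * (y t * u t)) has_integral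
     ((y x * v x - z x * u x) - (y 0 * v 0 - z 0 * u 0))) {0..x}"
proof -
  note a = ode_solution_ac[OF assms(1)] ode_solution_ac[OF assms(2)]
  have "ac_derivative 0 pi (\<lambda>x. y x * v x - z x * u x) (\<lambda>t. (r t - p t) * (y t * u t))"
    by (rule ac_derivative_eq[OF ac_derivative_diff[OF ac_derivative_mult[OF a(1) a(4)] ac_derivative_mult[OF a(2) a(3)]]])
      (simp add: algebra_simps)
  then have "ac_derivative 0 x (\<lambda>x. y x * v x - z x * u x) (\<lambda>t. (r t - p t) * (y t * u t))"
    by (rule ac_derivative_subset) (use assms(3) in auto)
  from ac_derivative_has_integral[OF this] show ?thesis using assms(3) by simp
qed

section \<open>Volterra estimates, uniqueness and existence\<close>

lemma exp_weight_integral: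
  fixes M x :: real
  assumes "M > 0" "x \<ge> 0"
  shows "(\<lambda>s. exp (M * s)) integrable_on {0..x}" "integral {0..x} (\<lambda>s. exp (M * s)) \<le> exp (M * x) / M"
proof -
  have "((\<lambda>s. exp (M * s)) has_integral (exp (M * x) / M - exp (M * 0) / M)) {0..x}"
    by (rule fundamental_theorem_of_calculus[where f = "\<lambda>s. exp (M * s) / M"])
      (use assms in \<open>auto intro!: derivative_eq_intros simp: has_real_derivative_iff_has_vector_derivative[symmetric]\<close>)
  then show "(\<lambda>s. exp (M * s)) integrable_on {0..x}" "integral {0..x} (\<lambda>s. exp (M * s)) \<le> exp (M * x) / M"
    using assms by (auto simp: has_integral_iff)
qed

text \<open>The weight exp (M x) with M = 2 P makes the Volterra operator of the equation a contraction.\<close>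

lemma weighted_double_integral_bound:
  fixes p g :: "real \<Rightarrow> complex"
  assumes p: "p absolutely_integrable_on {0..pi}" and P: "integral {0..pi} (\<lambda>x. norm (p x)) \<le> P" "P > 0"
    and g: "continuous_on {0..pi} g" and U: "\<And>x. x \<in> {0..pi} \<Longrightarrow> norm (g x) \<le> U * exp (2 * P * x)"
    and x: "x \<in> {0..pi}"
  shows "norm (integral {0..x} (\<lambda>s. integral {0..s} (\<lambda>t. p t * g t))) \<le> U / 2 * exp (2 * P * x)"
proof -
  have pg: "(\<lambda>t. p t * g t) absolutely_integrable_on {0..pi}"
    by (rule absolutely_integrable_mult_continuous[OF p g])
  have np: "(\<lambda>t. norm (p t)) absolutely_integrable_on {0..pi}" using p by (rule set_integrable_norm)
  have U0: "U \<ge> 0" using order_trans[OF norm_ge_zero U[of 0]] by simp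
  have inner: "norm (integral {0..s} (\<lambda>t. p t * g t)) \<le> P * U * exp (2 * P * s)" if s: "s \<in> {0..pi}" for s
  proof -
    have sub: "{0..s} \<subseteq> {0..pi}" using s by auto
    have ints: "(\<lambda>t. p t * g t) integrable_on {0..s}" "(\<lambda>t. norm (p t)) integrable_on {0..s}"
      using absolutely_integrable_on_subinterval[OF pg sub] absolutely_integrable_on_subinterval[OF np sub]
      by (auto intro: integrable_if_absolutely_integrable)
    have "norm (integral {0..s} (\<lambda>t. p t * g t)) \<le> integral {0..s} (\<lambda>t. norm (p t) * (U * exp (2 * P * s)))"
    proof (rule integral_norm_bound_integral)
      show "(\<lambda>t. norm (p t) * (U * exp (2 * P * s))) integrable_on {0..s}"
        using ints(2) by (rule integrable_on_mult_left)
      fix t assume t: "t \<in> {0..s}"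
      have "norm (g t) \<le> U * exp (2 * P * t)" using U[of t] t s by auto
      also have "\<dots> \<le> U * exp (2 * P * s)" using t P U0 by (intro mult_left_mono) auto
      finally show "norm (p t * g t) \<le> norm (p t) * (U * exp (2 * P * s))"
        by (simp add: norm_mult mult_left_mono)
    qed (rule ints)
    also have "\<dots> = integral {0..s} (\<lambda>t. norm (p t)) * (U * exp (2 * P * s))" by simp
    also have "\<dots> \<le> P * (U * exp (2 * P * s))"
    proof (rule mult_right_mono)
      have "integral {0..s} (\<lambda>t. norm (p t)) \<le> integral {0..pi} (\<lambda>t. norm (p t))"
        using ints(2) integrable_if_absolutely_integrable[OF np] sub by (intro integral_subset_le) auto
      then show "integral {0..s} (\<lambda>t. norm (p t)) \<le> P" using P by linarith
    qed (use U0 in auto)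
    finally show ?thesis by (simp add: mult.assoc)
  qed
  have cont: "continuous_on {0..pi} (\<lambda>s. integral {0..s} (\<lambda>t. p t * g t))"
    using pg by (intro indefinite_integral_continuous_1 integrable_if_absolutely_integrable)
  have "norm (integral {0..x} (\<lambda>s. integral {0..s} (\<lambda>t. p t * g t))) \<le> integral {0..x} (\<lambda>s. P * U * exp (2 * P * s))"
    using x P exp_weight_integral(1)[of "2 * P" x] inner
    by (intro integral_norm_bound_integral integrable_on_mult_right integrable_continuous_interval
        continuous_on_subset[OF cont]) (auto intro!: continuous_intros)
  also have "\<dots> = P * U * integral {0..x} (\<lambda>s. exp (2 * P * s))" by simp
  \<comment> \<open>Integrating exp (2 P s) gains 1 / (2 P), which turns the factor P U into U /
    2.\<close>
  also have "\<dots> \<le> P * U * (exp (2 * P * x) / (2 * P))"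
    using exp_weight_integral(2)[of "2 * P" x] P U0 x by (intro mult_left_mono) auto
  finally show ?thesis using P by simp
qed

text \<open>The second derivative r is arbitrary, so that the formula also applies to the difference
  of two solutions with different coefficients.\<close>

lemma second_derivative_integral_eq:
  fixes y z r :: "real \<Rightarrow> complex"
  assumes "ac_derivative 0 pi y z" "ac_derivative 0 pi z r" "x \<in> {0..pi}"
  shows "z x = z 0 + integral {0..x} r"
    "y x = y 0 + z 0 * of_real x + integral {0..x} (\<lambda>s. integral {0..s} r)"
proof -
  have z: "z s = z 0 + integral {0..s} r" and zc: "(r has_integral (z s - z 0)) {0..s}" if "s \<in> {0..pi}" for s
    using ac_derivative_has_integral[OF ac_derivative_subset[OF assms(2), of 0 s]] that
    by (auto simp: has_integral_iff)
  then show "z x = z 0 + integral {0..x} r" using assms(3) by blast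
  have "(z has_integral (y x - y 0)) {0..x}"
    using ac_derivative_has_integral[OF ac_derivative_subset[OF assms(1), of 0 x]] assms by auto
  then have "((\<lambda>s. z s - z 0) has_integral (y x - y 0 - x *\<^sub>R z 0)) {0..x}"
    using has_integral_const_real[of "z 0" 0 x] assms(3) by (intro has_integral_diff) auto
  then have "((\<lambda>s. integral {0..s} r) has_integral (y x - y 0 - x *\<^sub>R z 0)) {0..x}"
    by (rule has_integral_eq[rotated]) (use integral_unique[OF zc] assms(3) in auto)
  then show "y x = y 0 + z 0 * of_real x + integral {0..x} (\<lambda>s. integral {0..s} r)"
    by (simp add: has_integral_iff scaleR_conv_of_real)
qed

lemma ode_solution_integral_eq:
  assumes "ode_solution p y z" "x \<in> {0..pi}"
  shows "z x = z 0 + integral {0..x} (\<lambda>t. p t * y t)"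
    "y x = y 0 + z 0 * of_real x + integral {0..x} (\<lambda>s. integral {0..s} (\<lambda>t. p t * y t))"
  using second_derivative_integral_eq[OF ode_solution_ac[OF assms(1)] assms(2)] by blast+

text \<open>Let U be the maximum of |g x| exp (- 2 P x). The Volterra term is at most U / 2 in the
  weighted norm, so evaluation at the maximising point gives U <= A + U / 2, hence U <= 2 A at
  once.\<close>

lemma ode_gronwall:
  fixes p g :: "real \<Rightarrow> complex"
  assumes p: "p absolutely_integrable_on {0..pi}" and P: "integral {0..pi} (\<lambda>x. norm (p x)) \<le> P" "P > 0"
    and g: "continuous_on {0..pi} g"
    and le: "\<And>x. x \<in> {0..pi} \<Longrightarrow> norm (g x - integral {0..x} (\<lambda>s. integral {0..s} (\<lambda>t. p t * g t))) \<le> A"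
    and x: "x \<in> {0..pi}"
  shows "norm (g x) \<le> 2 * A * exp (2 * P * x)"
proof -
  have "continuous_on {0..pi} (\<lambda>x. norm (g x) * exp (- 2 * P * x))" using g by (intro continuous_intros)
  then obtain x0 where x0: "x0 \<in> {0..pi}"
      and mx: "\<And>x. x \<in> {0..pi} \<Longrightarrow> norm (g x) * exp (- 2 * P * x) \<le> norm (g x0) * exp (- 2 * P * x0)"
    using continuous_attains_sup[of "{0..pi}" "\<lambda>x. norm (g x) * exp (- 2 * P * x)"] by auto
  define U where "U = norm (g x0) * exp (- 2 * P * x0)"
  have U: "norm (g x) \<le> U * exp (2 * P * x)" if "x \<in> {0..pi}" for x
    using mx[OF that] by (simp add: U_def exp_minus field_simps)
  have "norm (g x0) \<le> A + U / 2 * exp (2 * P * x0)"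
    using weighted_double_integral_bound[OF p P g U x0] le[OF x0]
      norm_triangle_sub[of "g x0" "integral {0..x0} (\<lambda>s. integral {0..s} (\<lambda>t. p t * g t))"] by linarith
  then have "U \<le> (A + U / 2 * exp (2 * P * x0)) * exp (- 2 * P * x0)"
    unfolding U_def by (intro mult_right_mono) auto
  also have "\<dots> = A * exp (- 2 * P * x0) + U / 2" by (simp add: distrib_right exp_minus)
  also have "\<dots> \<le> A + U / 2"
  proof -
    have "A \<ge> 0" using le[OF x0] norm_ge_zero order_trans by blast
    then have "A * exp (- 2 * P * x0) \<le> A * 1" using x0 P by (intro mult_left_mono) auto
    then show ?thesis by simp
  qed
  finally have "U \<le> 2 * A" by simp
  then show ?thesis using U[OF x] by (smt (verit) exp_gt_zero mult_right_mono)
qed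

lemma ode_unique:
  assumes p: "p absolutely_integrable_on {0..pi}"
    and o: "ode_solution p y z" "ode_solution p u v" and "y 0 = u 0" "z 0 = v 0" and x: "x \<in> {0..pi}"
  shows "y x = u x" "z x = v x"
proof -
  define g where "g x = y x - u x" for x
  define h where "h x = z x - v x" for x
  have o: "ode_solution p g h" using ode_solution_lincomb[OF o, of 1 "-1"] by (simp add: g_def[abs_def] h_def[abs_def])
  have g0: "g 0 = 0" "h 0 = 0" using assms by (auto simp: g_def h_def)
  \<comment> \<open>The summand 1 keeps P positive when p vanishes.\<close>
  define P where "P = integral {0..pi} (\<lambda>x. norm (p x)) + 1"
  have "integral {0..pi} (\<lambda>x. norm (p x)) \<ge> 0"
    by (rule integral_nonneg[OF integrable_if_absolutely_integrable[OF set_integrable_norm[OF p]]]) auto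
  then have P: "integral {0..pi} (\<lambda>x. norm (p x)) \<le> P" "P > 0" by (auto simp: P_def)
  have g: "g x = 0" if "x \<in> {0..pi}" for x
  proof -
    have "norm (g x - integral {0..x} (\<lambda>s. integral {0..s} (\<lambda>t. p t * g t))) \<le> 0" if "x \<in> {0..pi}" for x
      using ode_solution_integral_eq(2)[OF o that] g0 by simp
    from ode_gronwall[OF p P ode_solution_continuous(1)[OF o] this that] show ?thesis by simp
  qed
  then show "y x = u x" using x by (simp add: g_def)
  have "integral {0..x} (\<lambda>t. p t * g t) = 0" using x g by (subst integral_cong[of _ _ "\<lambda>_. 0"]) auto
  then show "z x = v x" using ode_solution_integral_eq(1)[OF o x] g0 by (simp add: h_def)
qed

lemma double_integral_diff:
  fixes g h :: "real \<Rightarrow> complex"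
  assumes g: "g integrable_on {0..pi}" and h: "h integrable_on {0..pi}" and x: "x \<in> {0..pi}"
  shows "integral {0..x} (\<lambda>s. integral {0..s} g) - integral {0..x} (\<lambda>s. integral {0..s} h) =
    integral {0..x} (\<lambda>s. integral {0..s} (\<lambda>t. g t - h t))"
proof -
  have c: "(\<lambda>s. integral {0..s} f) integrable_on {0..x}" if "f integrable_on {0..pi}" for f :: "real \<Rightarrow> complex"
    by (rule integrable_continuous_interval[OF continuous_on_subset[OF indefinite_integral_continuous_1[OF that]]])
      (use x in auto)
  have "integral {0..x} (\<lambda>s. integral {0..s} g) - integral {0..x} (\<lambda>s. integral {0..s} h) =
     integral {0..x} (\<lambda>s. integral {0..s} g - integral {0..s} h)"
    using c assms by (intro integral_diff[symmetric]) auto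
  also have "\<dots> = integral {0..x} (\<lambda>s. integral {0..s} (\<lambda>t. g t - h t))"
  proof (rule integral_cong)
    fix s assume "s \<in> {0..x}"
    then have "{0..s} \<subseteq> {0..pi}" using x by auto
    then show "integral {0..s} g - integral {0..s} h = integral {0..s} (\<lambda>t. g t - h t)"
      using integrable_on_subinterval[OF g] integrable_on_subinterval[OF h] by (subst integral_diff[symmetric]) auto
  qed
  finally show ?thesis .
qed

text \<open>Banach's fixed point theorem for the unknown u = y / w with the weight w = exp (2 P x):
  the plain supremum norm of u is the weighted norm of y, in which the Volterra operator contracts
  by 1/2.\<close>

lemma ode_exists:
  assumes p: "p absolutely_integrable_on {0..pi}"
  shows "\<exists>y z. ode_solution p y z \<and> y 0 = a \<and> z 0 = b"
proof -
  define P where "P = integral {0..pi} (\<lambda>x. norm (p x)) + 1"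
  have "integral {0..pi} (\<lambda>x. norm (p x)) \<ge> 0"
    by (rule integral_nonneg[OF integrable_if_absolutely_integrable[OF set_integrable_norm[OF p]]]) auto
  then have P: "integral {0..pi} (\<lambda>x. norm (p x)) \<le> P" "P > 0" by (auto simp: P_def)
  define Q where "Q g x = integral {0..x} (\<lambda>s. integral {0..s} (\<lambda>t. p t * g t))" for g x
  define w :: "real \<Rightarrow> complex" where "w x = of_real (exp (2 * P * x))" for x
  have wc: "continuous_on A w" for A unfolding w_def[abs_def] by (intro continuous_intros)
  have pgi: "(\<lambda>t. p t * g t) absolutely_integrable_on {0..pi}" if "continuous_on {0..pi} g" for g
    by (rule absolutely_integrable_mult_continuous[OF p that])
  have Qd: "(Q g has_vector_derivative integral {0..x} (\<lambda>t. p t * g t)) (at x within {0..pi})"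
    if "continuous_on {0..pi} g" "x \<in> {0..pi}" for g x
    unfolding Q_def[abs_def] using that
    by (intro integral_has_vector_derivative indefinite_integral_continuous_1 integrable_if_absolutely_integrable pgi) auto
  have Qc: "continuous_on {0..pi} (Q g)" if "continuous_on {0..pi} g" for g
    using Qd[OF that] has_vector_derivative_continuous unfolding continuous_on_eq_continuous_within by blast
  \<comment> \<open>The type of bounded continuous functions has the whole real line as domain;
    composing with the retraction onto [0, pi] carries the problem there.\<close>
  define cl :: "real \<Rightarrow> real" where "cl x = max 0 (min x pi)" for x
  have cl: "cl x \<in> {0..pi}" for x by (auto simp: cl_def)
  have clc: "continuous_on UNIV cl" unfolding cl_def[abs_def] by (intro continuous_intros)
  define H where "H u x = (a + b * of_real x + Q (\<lambda>t. w t * u t) x) / w x" for u x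
  have w0: "w x \<noteq> 0" "norm (w x) = exp (2 * P * x)" for x by (auto simp: w_def)
  have Hc: "continuous_on {0..pi} (H u)" if "continuous_on UNIV u" for u
    unfolding H_def[abs_def] using w0
    by (intro continuous_intros Qc wc continuous_on_subset[OF that]) auto
  have Hb: "(\<lambda>x. H u (cl x)) \<in> bcontfun" if uc: "continuous_on UNIV u" for u
  proof -
    obtain B where "\<forall>x\<in>{0..pi}. norm (H u x) \<le> B"
      using compact_imp_bounded[OF compact_continuous_image[OF Hc[OF uc] compact_Icc]] unfolding bounded_iff by auto
    then show ?thesis using cl
      by (intro bcontfun_normI continuous_on_compose2[OF Hc[OF uc] clc]) auto
  qed
  define T where "T u = Bcontfun (\<lambda>x. H (apply_bcontfun u) (cl x))" for u
  have T: "apply_bcontfun (T u) x = H (apply_bcontfun u) (cl x)" for u x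
    unfolding T_def using Hb[of "apply_bcontfun u"] by (simp add: Bcontfun_inverse)
  have "\<exists>!u. T u = u"
  proof (rule banach_fix_type[of "1/2"])
    show "\<forall>u v. dist (T u) (T v) \<le> 1 / 2 * dist u v"
    proof (intro allI dist_bound)
      fix u v x
      have d: "T u x - T v x = Q (\<lambda>t. w t * u t - w t * v t) (cl x) / w (cl x)"
      proof -
        have "T u x - T v x = (Q (\<lambda>t. w t * u t) (cl x) - Q (\<lambda>t. w t * v t) (cl x)) / w (cl x)"
          by (simp add: T H_def diff_divide_distrib add_divide_distrib)
        also have "Q (\<lambda>t. w t * u t) (cl x) - Q (\<lambda>t. w t * v t) (cl x) = Q (\<lambda>t. w t * u t - w t * v t) (cl x)"
          unfolding Q_def right_diff_distrib
          by (intro double_integral_diff cl integrable_if_absolutely_integrable pgi continuous_intros wc) (rule continuous_on_apply_bcontfun)+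
        finally show ?thesis .
      qed
      have "norm (Q (\<lambda>t. w t * u t - w t * v t) (cl x)) \<le> dist u v / 2 * exp (2 * P * cl x)"
        unfolding Q_def
      proof (rule weighted_double_integral_bound[OF p P _ _ cl])
        show "continuous_on {0..pi} (\<lambda>x. w x * u x - w x * v x)" by (intro continuous_intros wc) (rule continuous_on_apply_bcontfun)+
        fix t
        have "norm (w t * u t - w t * v t) = exp (2 * P * t) * dist (u t) (v t)"
          by (simp add: w0 dist_norm norm_mult flip: right_diff_distrib)
        also have "\<dots> \<le> exp (2 * P * t) * dist u v" by (intro mult_left_mono dist_bounded) auto
        finally show "norm (w t * u t - w t * v t) \<le> dist u v * exp (2 * P * t)" by (simp add: mult.commute)
      qed
      then show "dist (T u x) (T v x) \<le> 1 / 2 * dist u v"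
        by (simp add: dist_norm[of "T u x"] d norm_divide w0 field_simps)
    qed
  qed auto
  then obtain u where u: "T u = u" by blast
  define y where "y x = w x * u x" for x
  define z where "z x = b + integral {0..x} (\<lambda>t. p t * y t)" for x
  have yc: "continuous_on A y" for A unfolding y_def[abs_def] by (intro continuous_intros wc continuous_on_apply_bcontfun)
  \<comment> \<open>On [0, pi] the retraction is the identity, so the fixed point equation is the
    integral form of the initial value problem.\<close>
  have y: "y x = a + b * of_real x + Q y x" if "x \<in> {0..pi}" for x
  proof -
    have "cl x = x" using that by (auto simp: cl_def)
    then have "u x = H u x" using T[of u x] u by simp
    then show ?thesis using w0(1)[of x] by (simp add: y_def[abs_def] H_def)
  qed
  have "(y has_vector_derivative z x) (at x within {0..pi})" if x: "x \<in> {0..pi}" for x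
  proof -
    have "((\<lambda>x. a + b * of_real x) has_vector_derivative b) (at x within {0..pi})"
      by (auto intro!: derivative_eq_intros)
    from has_vector_derivative_add[OF this Qd[OF yc x]]
    have "((\<lambda>x. a + b * of_real x + Q y x) has_vector_derivative z x) (at x within {0..pi})"
      by (simp add: z_def)
    then show ?thesis
      by (rule has_vector_derivative_transform[OF x y, rotated])
  qed
  moreover have "ac_derivative 0 pi z (\<lambda>x. p x * y x)"
    unfolding z_def[abs_def] by (intro ac_derivative_integral pgi yc)
  moreover have "y 0 = a" using y[of 0] by (simp add: Q_def)
  moreover have "z 0 = b" by (simp add: z_def)
  ultimately show ?thesis unfolding ode_solution_def by blast
qed

subsection \<open>The characteristic function\<close>

text \<open>The solutions of y'' = - \<omega> y with Cauchy data (1, 0) and, for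
  \<open>sin_sol\<close>, (0, 1). Both are even in the square root, so the branch chosen by
  \<open>csqrt\<close> leaves no trace; x is the limit of \<open>sin_sol\<close> as \<omega> tends
  to 0.\<close>

definition cos_sol :: "complex \<Rightarrow> real \<Rightarrow> complex" where
  "cos_sol \<omega> x = cos (csqrt \<omega> * of_real x)"

definition sin_sol :: "complex \<Rightarrow> real \<Rightarrow> complex" where
  "sin_sol \<omega> x = (if \<omega> = 0 then of_real x else sin (csqrt \<omega> * of_real x) / csqrt \<omega>)"

lemma csqrt_mult_self: "csqrt z * csqrt z = z"
  using power2_csqrt[of z] by (simp add: power2_eq_square)

lemma cos_sol_has_field_derivative:
  "((\<lambda>z. cos (csqrt \<omega> * z)) has_field_derivative (- \<omega> * sin_sol \<omega> x)) (at (of_real x))"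
  by (rule derivative_eq_intros refl | simp)+
     (auto simp: sin_sol_def field_simps csqrt_mult_self power2_eq_square mult.assoc[symmetric])

lemma cos_sol_derivative:
  "(cos_sol \<omega> has_vector_derivative (- \<omega> * sin_sol \<omega> x)) (at x within S)"
  unfolding cos_sol_def[abs_def]
  by (rule has_vector_derivative_real_field[OF cos_sol_has_field_derivative])

lemma sin_sol_derivative:
  "(sin_sol \<omega> has_vector_derivative cos_sol \<omega> x) (at x within S)"
proof (cases "\<omega> = 0")
  case True
  then show ?thesis
    by (auto simp: sin_sol_def[abs_def] cos_sol_def intro!: derivative_eq_intros)
next
  case False
  then have "((\<lambda>z. sin (csqrt \<omega> * z) / csqrt \<omega>) has_field_derivative cos_sol \<omega> x) (at (of_real x))"
    by (auto intro!: derivative_eq_intros simp: cos_sol_def)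
  from has_vector_derivative_real_field[OF this] show ?thesis using False by (simp add: sin_sol_def[abs_def])
qed

lemma cos_sin_sol_0 [simp]: "cos_sol \<omega> 0 = 1" "sin_sol \<omega> 0 = 0"
  by (simp_all add: cos_sol_def sin_sol_def)

lemma continuous_on_sol: "continuous_on S (cos_sol \<omega>)" "continuous_on S (sin_sol \<omega>)"
  using cos_sol_derivative sin_sol_derivative has_vector_derivative_continuous
  unfolding continuous_on_eq_continuous_within by blast+

lemma has_vector_derivative_reflect:
  assumes "\<And>x. (f has_vector_derivative f' x) (at x)"
  shows "((\<lambda>t. f (c - t)) has_vector_derivative - f' (c - t)) (at t within S)"
proof -
  have "((\<lambda>t. c - t) has_vector_derivative - 1) (at t within S)"
    by (auto intro!: derivative_eq_intros)
  from vector_diff_chain_within[OF this has_vector_derivative_at_within[OF assms]] show ?thesis by (simp add: o_def)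
qed

lemma ac_derivative_sol_reflect:
  "ac_derivative s t (\<lambda>t. cos_sol \<omega> (x - t)) (\<lambda>t. \<omega> * sin_sol \<omega> (x - t))"
  "ac_derivative s t (\<lambda>t. sin_sol \<omega> (x - t)) (\<lambda>t. - cos_sol \<omega> (x - t))"
  using has_vector_derivative_reflect[of "cos_sol \<omega>" "\<lambda>x. - \<omega> * sin_sol \<omega> x" x, OF cos_sol_derivative]
    has_vector_derivative_reflect[of "sin_sol \<omega>" "cos_sol \<omega>" x, OF sin_sol_derivative]
  by (auto intro!: ac_derivative_C1 continuous_intros continuous_on_compose2[OF continuous_on_sol(1)[of UNIV]]
     continuous_on_compose2[OF continuous_on_sol(2)[of UNIV]])

text \<open>Variation of constants, comparing with the solutions of y'' = - \<omega> y.\<close>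

lemma ode_volterra:
  assumes o: "ode_solution p y z" and x: "x \<in> {0..pi}"
  shows "((\<lambda>t. sin_sol \<omega> (x - t) * ((p t + \<omega>) * y t)) has_integral
           (y x - y 0 * cos_sol \<omega> x - z 0 * sin_sol \<omega> x)) {0..x}" (is ?A)
    and "((\<lambda>t. cos_sol \<omega> (x - t) * ((p t + \<omega>) * y t)) has_integral
           (z x + \<omega> * y 0 * sin_sol \<omega> x - z 0 * cos_sol \<omega> x)) {0..x}" (is ?B)
proof -
  have ac: "ac_derivative 0 x y z" "ac_derivative 0 x z (\<lambda>x. p x * y x)"
    using ode_solution_ac[OF o] x by (auto intro: ac_derivative_subset)
  note m = ac_derivative_mult[OF ac_derivative_sol_reflect(1)[of 0 x \<omega> x] ac(1)]
    ac_derivative_mult[OF ac_derivative_sol_reflect(2)[of 0 x \<omega> x] ac(2)]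
    ac_derivative_mult[OF ac_derivative_sol_reflect(1)[of 0 x \<omega> x] ac(2)]
    ac_derivative_mult[OF ac_derivative_cmult[OF ac_derivative_sol_reflect(2)[of 0 x \<omega> x], of "- \<omega>"] ac(1)]
  \<comment> \<open>The terms with z cancel in the derivative; at t = x the expression is y x, at t
    = 0 it is the free solution with the same Cauchy data.\<close>
  have "ac_derivative 0 x (\<lambda>t. cos_sol \<omega> (x - t) * y t + sin_sol \<omega> (x - t) * z t)
     (\<lambda>t. sin_sol \<omega> (x - t) * ((p t + \<omega>) * y t))"
    by (rule ac_derivative_eq[OF ac_derivative_add[OF m(1,2)]]) (simp add: algebra_simps)
  from ac_derivative_has_integral[OF this] show ?A using x by (simp add: algebra_simps)
  have "ac_derivative 0 x (\<lambda>t. cos_sol \<omega> (x - t) * z t + - \<omega> * sin_sol \<omega> (x - t) * y t)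
     (\<lambda>t. cos_sol \<omega> (x - t) * ((p t + \<omega>) * y t))"
    by (rule ac_derivative_eq[OF ac_derivative_add[OF m(3,4)]]) (simp add: algebra_simps)
  from ac_derivative_has_integral[OF this] show ?B using x by (simp add: algebra_simps)
qed

section \<open>Growth of solutions in the complex spectral parameter\<close>

lemma norm_cos_le_exp: "norm (cos z) \<le> exp \<bar>Im z\<bar>" and norm_sin_le_exp: "norm (sin z) \<le> exp \<bar>Im z\<bar>"
proof -
  have e: "norm (exp (\<i> * w)) \<le> exp \<bar>Im w\<bar>" "norm (exp (- (\<i> * w))) \<le> exp \<bar>Im w\<bar>" for w by auto
  have "norm (cos z) \<le> (norm (exp (\<i> * z)) + norm (exp (- (\<i> * z)))) / 2"
    unfolding cos_exp_eq using norm_triangle_ineq[of "exp (\<i> * z)" "exp (- (\<i> * z))"] by (simp add: norm_divide)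
  also have "\<dots> \<le> (exp \<bar>Im z\<bar> + exp \<bar>Im z\<bar>) / 2" by (intro divide_right_mono add_mono e) simp
  finally show "norm (cos z) \<le> exp \<bar>Im z\<bar>" by simp
  have "norm (sin z) \<le> (norm (exp (\<i> * z)) + norm (exp (- (\<i> * z)))) / 2"
    unfolding sin_exp_eq using norm_triangle_ineq4[of "exp (\<i> * z)" "exp (- (\<i> * z))"] by (simp add: norm_divide norm_mult)
  also have "\<dots> \<le> (exp \<bar>Im z\<bar> + exp \<bar>Im z\<bar>) / 2" by (intro divide_right_mono add_mono e) simp
  finally show "norm (sin z) \<le> exp \<bar>Im z\<bar>" by simp
qed

lemma norm_cos_sol_le:
  assumes "x \<ge> 0" shows "norm (cos_sol \<omega> x) \<le> exp (\<bar>Im (csqrt \<omega>)\<bar> * x)"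
  using norm_cos_le_exp[of "csqrt \<omega> * of_real x"] assms by (simp add: cos_sol_def abs_mult)

lemma norm_sin_sol_le:
  assumes "x \<ge> 0" "\<omega> \<noteq> 0" shows "norm (sin_sol \<omega> x) \<le> exp (\<bar>Im (csqrt \<omega>)\<bar> * x) / norm (csqrt \<omega>)"
  using norm_sin_le_exp[of "csqrt \<omega> * of_real x"] assms
  by (simp add: sin_sol_def abs_mult norm_divide divide_right_mono)

text \<open>The kernels grow like exp (\<tau> (x - t)), so y is measured against exp (\<tau> x).
  With k = |csqrt \<omega>| the weighted maximum V satisfies V <= |y 0| + |z 0| / k + I V / k, and
  \<open>big\<close> makes the last term at most V / 2. Putting the resulting bound for y back into
  the Volterra equations gives both claims.\<close>

lemma ode_growth_bound:
  assumes o: "ode_solution p y z" and h: "h absolutely_integrable_on {0..pi}"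
    and hp: "\<And>t. p t + \<omega> = h t"
    and big: "2 * integral {0..pi} (\<lambda>t. norm (h t)) + 1 \<le> norm (csqrt \<omega>)"
  defines "\<tau> \<equiv> \<bar>Im (csqrt \<omega>)\<bar>" and "I \<equiv> integral {0..pi} (\<lambda>t. norm (h t))"
    and "U \<equiv> 2 * (norm (y 0) + norm (z 0) / norm (csqrt \<omega>))"
  shows "norm (y pi - y 0 * cos_sol \<omega> pi - z 0 * sin_sol \<omega> pi) \<le> I * U / norm (csqrt \<omega>) * exp (\<tau> * pi)"
    and "norm (z pi + \<omega> * y 0 * sin_sol \<omega> pi - z 0 * cos_sol \<omega> pi) \<le> I * U * exp (\<tau> * pi)"
proof -
  have nh: "(\<lambda>t. norm (h t)) absolutely_integrable_on {0..pi}" using h by (rule set_integrable_norm)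
  have nhi: "(\<lambda>t. norm (h t)) integrable_on {0..s}" if "s \<in> {0..pi}" for s
    using absolutely_integrable_on_subinterval[OF nh, of 0 s] that by (intro integrable_if_absolutely_integrable) auto
  have I0: "I \<ge> 0" unfolding I_def by (rule integral_nonneg[OF nhi]) auto
  have Is: "integral {0..s} (\<lambda>t. norm (h t)) \<le> I" if "s \<in> {0..pi}" for s
    unfolding I_def using nhi[OF that] nhi[of pi] that by (intro integral_subset_le) auto
  define k where "k = norm (csqrt \<omega>)"
  \<comment> \<open>The summand 1 in \<open>big\<close> keeps \<omega> away from 0.\<close>
  have k: "k \<ge> 1" "2 * I \<le> k" using big I0 unfolding k_def I_def by linarith+
  then have w0: "\<omega> \<noteq> 0" by (auto simp: k_def)
  have kern: "norm (sin_sol \<omega> (x - t) * ((p t + \<omega>) * y t)) \<le> norm (h t) * (V * exp (\<tau> * x) / k)"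
             "norm (cos_sol \<omega> (x - t) * ((p t + \<omega>) * y t)) \<le> norm (h t) * (V * exp (\<tau> * x))"
    if V: "\<And>t. t \<in> {0..pi} \<Longrightarrow> norm (y t) \<le> V * exp (\<tau> * t)" and x: "x \<in> {0..pi}" and t: "t \<in> {0..x}" for V x t
  proof -
    have yt: "norm (y t) \<le> V * exp (\<tau> * t)" using V x t by auto
    have ee: "exp (\<tau> * (x - t)) * exp (\<tau> * t) = exp (\<tau> * x)" by (simp flip: exp_add add: algebra_simps)
    have "norm (sin_sol \<omega> (x - t)) * norm (y t) \<le> (exp (\<tau> * (x - t)) / k) * (V * exp (\<tau> * t))"
      using norm_sin_sol_le[of "x - t" \<omega>] w0 t yt k by (intro mult_mono) (auto simp: \<tau>_def k_def)
    also have "\<dots> = V * exp (\<tau> * x) / k" using ee by (simp add: field_simps)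
    finally have "norm (sin_sol \<omega> (x - t)) * norm (y t) \<le> V * exp (\<tau> * x) / k" .
    from mult_left_mono[OF this norm_ge_zero[of "h t"]]
    show "norm (sin_sol \<omega> (x - t) * ((p t + \<omega>) * y t)) \<le> norm (h t) * (V * exp (\<tau> * x) / k)"
      by (simp add: norm_mult hp mult.left_commute)
    have "norm (cos_sol \<omega> (x - t)) * norm (y t) \<le> exp (\<tau> * (x - t)) * (V * exp (\<tau> * t))"
      using norm_cos_sol_le[of "x - t" \<omega>] t yt by (intro mult_mono) (auto simp: \<tau>_def)
    also have "\<dots> = V * exp (\<tau> * x)" using ee by (simp add: field_simps)
    finally have "norm (cos_sol \<omega> (x - t)) * norm (y t) \<le> V * exp (\<tau> * x)" .
    from mult_left_mono[OF this norm_ge_zero[of "h t"]]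
    show "norm (cos_sol \<omega> (x - t) * ((p t + \<omega>) * y t)) \<le> norm (h t) * (V * exp (\<tau> * x))"
      by (simp add: norm_mult hp mult.left_commute)
  qed
  have int: "norm (y x - y 0 * cos_sol \<omega> x - z 0 * sin_sol \<omega> x) \<le> I * V / k * exp (\<tau> * x)"
            "norm (z x + \<omega> * y 0 * sin_sol \<omega> x - z 0 * cos_sol \<omega> x) \<le> I * V * exp (\<tau> * x)"
    if V: "\<And>t. t \<in> {0..pi} \<Longrightarrow> norm (y t) \<le> V * exp (\<tau> * t)" and x: "x \<in> {0..pi}" for V x
  proof -
    have V0: "V \<ge> 0" using order_trans[OF norm_ge_zero V[of 0]] by simp
    have aux: "norm J \<le> I * W" if J: "(f has_integral J) {0..x}" and le: "\<And>t. t \<in> {0..x} \<Longrightarrow> norm (f t) \<le> norm (h t) * W" and "W \<ge> 0"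
      for f :: "real \<Rightarrow> complex" and J W
    proof -
      have "norm (integral {0..x} f) \<le> integral {0..x} (\<lambda>t. norm (h t) * W)"
        using J le nhi[OF x] by (intro integral_norm_bound_integral integrable_on_mult_left) (auto simp: has_integral_iff)
      also have "\<dots> = integral {0..x} (\<lambda>t. norm (h t)) * W" by simp
      also have "\<dots> \<le> I * W" using Is[OF x] \<open>W \<ge> 0\<close> by (intro mult_right_mono)
      finally show ?thesis using J by (simp add: has_integral_iff)
    qed
    show "norm (y x - y 0 * cos_sol \<omega> x - z 0 * sin_sol \<omega> x) \<le> I * V / k * exp (\<tau> * x)"
      using aux[OF ode_volterra(1)[OF o x] kern(1)[OF V x]] V0 k by simp
    show "norm (z x + \<omega> * y 0 * sin_sol \<omega> x - z 0 * cos_sol \<omega> x) \<le> I * V * exp (\<tau> * x)"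
      using aux[OF ode_volterra(2)[OF o x] kern(2)[OF V x]] V0 k by (simp add: mult.assoc)
  qed
  have "continuous_on {0..pi} (\<lambda>x. norm (y x) * exp (- \<tau> * x))"
    using ode_solution_continuous[OF o] by (intro continuous_intros)
  then have "\<exists>x0\<in>{0..pi}. \<forall>x\<in>{0..pi}. norm (y x) * exp (- \<tau> * x) \<le> norm (y x0) * exp (- \<tau> * x0)"
    by (intro continuous_attains_sup) auto
  then obtain x0 where x0: "x0 \<in> {0..pi}"
      and mx: "\<And>x. x \<in> {0..pi} \<Longrightarrow> norm (y x) * exp (- \<tau> * x) \<le> norm (y x0) * exp (- \<tau> * x0)" by blast
  define V where "V = norm (y x0) * exp (- \<tau> * x0)"
  have V: "norm (y x) \<le> V * exp (\<tau> * x)" if "x \<in> {0..pi}" for x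
    using mx[OF that] by (simp add: V_def exp_minus field_simps)
  have V0: "V \<ge> 0" by (simp add: V_def)
  have "norm (y x0) \<le> norm (y 0 * cos_sol \<omega> x0 + z 0 * sin_sol \<omega> x0) + norm (y x0 - y 0 * cos_sol \<omega> x0 - z 0 * sin_sol \<omega> x0)"
    by (metis norm_triangle_sub add.commute diff_diff_eq)
  also have "\<dots> \<le> (norm (y 0) * exp (\<tau> * x0) + norm (z 0) * (exp (\<tau> * x0) / k)) + I * V / k * exp (\<tau> * x0)"
  proof (intro add_mono int V x0)
    have "norm (y 0 * cos_sol \<omega> x0 + z 0 * sin_sol \<omega> x0) \<le> norm (y 0) * norm (cos_sol \<omega> x0) + norm (z 0) * norm (sin_sol \<omega> x0)"
      by (metis norm_triangle_ineq norm_mult)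
    also have "\<dots> \<le> norm (y 0) * exp (\<tau> * x0) + norm (z 0) * (exp (\<tau> * x0) / k)"
      using norm_cos_sol_le[of x0 \<omega>] norm_sin_sol_le[of x0 \<omega>] x0 w0
      by (intro add_mono mult_left_mono) (auto simp: \<tau>_def k_def)
    finally show "norm (y 0 * cos_sol \<omega> x0 + z 0 * sin_sol \<omega> x0) \<le> \<dots>" .
  qed
  also have "\<dots> = (norm (y 0) + norm (z 0) / k + I * V / k) * exp (\<tau> * x0)" by (simp add: field_simps)
  finally have "V \<le> (norm (y 0) + norm (z 0) / k + I * V / k) * exp (\<tau> * x0) * exp (- \<tau> * x0)"
    unfolding V_def by (intro mult_right_mono) auto
  moreover have "exp (\<tau> * x0) * exp (- \<tau> * x0) = 1" by (simp flip: exp_add)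
  ultimately have "V \<le> norm (y 0) + norm (z 0) / k + I * V / k" by (simp add: mult.assoc)
  also have "I * V / k \<le> V / 2"
  proof -
    have "2 * I * V \<le> k * V" using k V0 by (intro mult_right_mono) auto
    then show ?thesis using k by (simp add: field_simps)
  qed
  finally have VU: "V \<le> U" by (simp add: U_def k_def)
  have U: "norm (y x) \<le> U * exp (\<tau> * x)" if "x \<in> {0..pi}" for x
    using V[OF that] VU by (meson exp_ge_zero mult_right_mono order_trans)
  show "norm (y pi - y 0 * cos_sol \<omega> pi - z 0 * sin_sol \<omega> pi) \<le> I * U / norm (csqrt \<omega>) * exp (\<tau> * pi)"
    "norm (z pi + \<omega> * y 0 * sin_sol \<omega> pi - z 0 * cos_sol \<omega> pi) \<le> I * U * exp (\<tau> * pi)"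
    using int[OF U, of pi] by (auto simp: k_def)
qed

section \<open>The characteristic function and the eigenvalues\<close>

definition ode_ivp :: "(real \<Rightarrow> complex) \<Rightarrow> complex \<Rightarrow> complex \<Rightarrow> (real \<Rightarrow> complex) \<times> (real \<Rightarrow> complex)" where
  "ode_ivp p a b = (SOME w. ode_solution p (fst w) (snd w) \<and> fst w 0 = a \<and> snd w 0 = b)"

lemma ode_ivp:
  assumes "p absolutely_integrable_on {0..pi}"
  shows "ode_solution p (fst (ode_ivp p a b)) (snd (ode_ivp p a b))"
    "fst (ode_ivp p a b) 0 = a" "snd (ode_ivp p a b) 0 = b"
proof -
  have "\<exists>w. ode_solution p (fst w) (snd w) \<and> fst w 0 = a \<and> snd w 0 = b"
    using ode_exists[OF assms, of a b] by auto
  from someI_ex[OF this] show "ode_solution p (fst (ode_ivp p a b)) (snd (ode_ivp p a b))"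
    "fst (ode_ivp p a b) 0 = a" "snd (ode_ivp p a b) 0 = b" unfolding ode_ivp_def by auto
qed

definition sl_coeff :: "(real \<Rightarrow> real) \<Rightarrow> complex \<Rightarrow> real \<Rightarrow> complex" where
  "sl_coeff q \<mu> x = of_real (q x) - \<mu>"

text \<open>The initial data (sin \<alpha>, - cos \<alpha>) satisfy the boundary condition at 0 for
  every \<mu>, and never vanish together.\<close>

definition sl_left :: "(real \<Rightarrow> real) \<Rightarrow> real \<Rightarrow> complex \<Rightarrow> real \<Rightarrow> complex" where
  "sl_left q \<alpha> \<mu> = fst (ode_ivp (sl_coeff q \<mu>) (of_real (sin \<alpha>)) (- of_real (cos \<alpha>)))"

definition sl_left' :: "(real \<Rightarrow> real) \<Rightarrow> real \<Rightarrow> complex \<Rightarrow> real \<Rightarrow> complex" where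
  "sl_left' q \<alpha> \<mu> = snd (ode_ivp (sl_coeff q \<mu>) (of_real (sin \<alpha>)) (- of_real (cos \<alpha>)))"

definition sl_char :: "(real \<Rightarrow> real) \<Rightarrow> real \<Rightarrow> real \<Rightarrow> complex \<Rightarrow> complex" where
  "sl_char q \<alpha> \<beta> \<mu> = of_real (cos \<beta>) * sl_left q \<alpha> \<mu> pi + of_real (sin \<beta>) * sl_left' q \<alpha> \<mu> pi"

lemma of_real_absolutely_integrable:
  assumes "q absolutely_integrable_on {0..pi}"
  shows "(\<lambda>x. complex_of_real (q x)) absolutely_integrable_on {0..pi}"
  using absolutely_integrable_linear[OF assms bounded_linear_of_real] by (simp add: o_def)

lemma sl_coeff_absolutely_integrable:
  assumes "q absolutely_integrable_on {0..pi}"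
  shows "sl_coeff q \<mu> absolutely_integrable_on {0..pi}"
  unfolding sl_coeff_def[abs_def]
  by (intro set_integral_diff of_real_absolutely_integrable assms) auto

lemma sl_left:
  assumes "q absolutely_integrable_on {0..pi}"
  shows "ode_solution (sl_coeff q \<mu>) (sl_left q \<alpha> \<mu>) (sl_left' q \<alpha> \<mu>)"
    "sl_left q \<alpha> \<mu> 0 = of_real (sin \<alpha>)" "sl_left' q \<alpha> \<mu> 0 = - of_real (cos \<alpha>)"
  unfolding sl_left_def sl_left'_def
  using ode_ivp[OF sl_coeff_absolutely_integrable[OF assms]] by auto

lemma sl_sin_cos_nonzero: "sin \<alpha> \<noteq> 0 \<or> cos \<alpha> \<noteq> (0::real)"
  using sin_zero_abs_cos_one[of \<alpha>] by auto

lemma ode_solution_zero_derivative: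
  assumes "ode_solution p y z" "\<And>x. x \<in> {0..pi} \<Longrightarrow> y x = 0" "x \<in> {0..pi}"
  shows "z x = 0"
proof -
  have "(y has_vector_derivative z x) (at x within {0..pi})" using assms unfolding ode_solution_def by blast
  then have "((\<lambda>_. 0) has_vector_derivative z x) (at x within {0..pi})"
    using assms by (intro has_vector_derivative_transform[of x "{0..pi}" "\<lambda>_. 0" y]) auto
  then show ?thesis
    using assms(3) by (intro vector_derivative_unique_within_closed_interval[of 0 pi x "\<lambda>_. 0"]) auto
qed

text \<open>The condition says that (y, z) is orthogonal to the unit vector (cos \<alpha>, sin
  \<alpha>), so it is a multiple of (sin \<alpha>, - cos \<alpha>), and k is its component along
  that vector.\<close>

lemma boundary_condition_solve:
  fixes y z :: complex
  assumes "y * of_real (cos \<alpha>) + z * of_real (sin \<alpha>) = 0"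
  defines "k \<equiv> y * of_real (sin \<alpha>) - z * of_real (cos \<alpha>)"
  shows "y = k * of_real (sin \<alpha>)" "z = k * (- of_real (cos \<alpha>))"
proof -
  define s c where "s = complex_of_real (sin \<alpha>)" and "c = complex_of_real (cos \<alpha>)"
  have sc: "s * s + c * c = 1"
    using sin_cos_squared_add[of \<alpha>] unfolding s_def c_def by (metis of_real_1 of_real_add of_real_mult power2_eq_square)
  have b: "y * c + z * s = 0" using assms(1) by (simp add: s_def c_def)
  have "k * s = y * (s * s + c * c) - c * (y * c + z * s)" "k * (- c) = z * (s * s + c * c) - s * (y * c + z * s)"
    by (simp_all add: k_def s_def[symmetric] c_def[symmetric] algebra_simps)
  then show "y = k * of_real (sin \<alpha>)" "z = k * (- of_real (cos \<alpha>))"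
    using sc b by (simp_all add: s_def[symmetric] c_def[symmetric])
qed

text \<open>By uniqueness an eigenfunction is a nonzero multiple of the left solution; conversely
  the left solution is nontrivial because its Cauchy data at 0 are.\<close>

theorem sl_eigenvalue_iff_char:
  assumes q: "q absolutely_integrable_on {0..pi}"
  shows "sl_eigenvalue q \<alpha> \<beta> \<mu> \<longleftrightarrow> sl_char q \<alpha> \<beta> \<mu> = 0"
proof
  assume "sl_eigenvalue q \<alpha> \<beta> \<mu>"
  then obtain y z where o: "ode_solution (sl_coeff q \<mu>) y z" and nz: "\<exists>x\<in>{0..pi}. y x \<noteq> 0"
    and bc: "y 0 * of_real (cos \<alpha>) + z 0 * of_real (sin \<alpha>) = 0"
      "y pi * of_real (cos \<beta>) + z pi * of_real (sin \<beta>) = 0"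
    unfolding sl_eigenvalue_def sl_solution_iff_ode_solution sl_coeff_def by blast
  obtain k where k: "y 0 = k * of_real (sin \<alpha>)" "z 0 = k * (- of_real (cos \<alpha>))"
    using boundary_condition_solve[OF bc(1)] by blast
  have eq: "y x = k * sl_left q \<alpha> \<mu> x" "z x = k * sl_left' q \<alpha> \<mu> x" if "x \<in> {0..pi}" for x
    using ode_unique[OF sl_coeff_absolutely_integrable[OF q] o ode_solution_lincomb[OF sl_left(1)[OF q, where \<mu> = \<mu> and \<alpha> = \<alpha>] sl_left(1)[OF q, where \<mu> = \<mu> and \<alpha> = \<alpha>], where c = k and d = 0] _ _ that] k
    by (auto simp: sl_left[OF q])
  have "k \<noteq> 0" using nz eq by auto
  moreover have "k * sl_char q \<alpha> \<beta> \<mu> = 0"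
    using bc(2) eq[of pi] by (simp add: sl_char_def algebra_simps)
  ultimately show "sl_char q \<alpha> \<beta> \<mu> = 0" by simp
next
  assume c: "sl_char q \<alpha> \<beta> \<mu> = 0"
  note l = sl_left[OF q, where \<mu> = \<mu> and \<alpha> = \<alpha>]
  have "\<exists>x\<in>{0..pi}. sl_left q \<alpha> \<mu> x \<noteq> 0"
  proof (rule ccontr)
    assume "\<not> ?thesis"
    then have "sl_left q \<alpha> \<mu> 0 = 0" "sl_left' q \<alpha> \<mu> 0 = 0" using ode_solution_zero_derivative[OF l(1)] by auto
    then show False using l sl_sin_cos_nonzero[of \<alpha>] by simp
  qed
  then show "sl_eigenvalue q \<alpha> \<beta> \<mu>"
    using l c unfolding sl_eigenvalue_def sl_solution_iff_ode_solution
    by (intro exI[of _ "sl_left q \<alpha> \<mu>"] exI[of _ "sl_left' q \<alpha> \<mu>"])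
      (auto simp: sl_char_def sl_coeff_def[abs_def] algebra_simps)
qed

text \<open>The difference g of the two left solutions has zero data and solves the equation for
  \<mu> with forcing (\<mu>0 - \<mu>) y0, whose size is proportional to |\<mu> - \<mu>0|;
  \<open>ode_gronwall\<close> passes this on to g.\<close>

lemma sl_left_lipschitz:
  assumes q: "q absolutely_integrable_on {0..pi}"
  obtains C where "C \<ge> 0" "\<And>\<mu> x. norm (\<mu> - \<mu>0) \<le> 1 \<Longrightarrow> x \<in> {0..pi} \<Longrightarrow>
    norm (sl_left q \<alpha> \<mu> x - sl_left q \<alpha> \<mu>0 x) \<le> C * norm (\<mu> - \<mu>0)"
proof -
  \<comment> \<open>P bounds the integrals of all coefficients with |\<mu> - \<mu>0| <= 1, which
    makes the constant C uniform there.\<close>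
  define P where "P = integral {0..pi} (\<lambda>x. \<bar>q x\<bar>) + (norm \<mu>0 + 1) * pi + 1"
  have qa: "(\<lambda>x. \<bar>q x\<bar>) integrable_on {0..pi}"
    using set_integrable_norm[OF q] by (auto dest: integrable_if_absolutely_integrable)
  have "integral {0..pi} (\<lambda>x. \<bar>q x\<bar>) \<ge> 0" by (rule integral_nonneg[OF qa]) auto
  then have P0: "P > 0" by (simp add: P_def add_pos_nonneg add_nonneg_pos)
  have Pb: "integral {0..pi} (\<lambda>x. norm (sl_coeff q \<mu> x)) \<le> P" if "norm (\<mu> - \<mu>0) \<le> 1" for \<mu>
  proof -
    have "norm \<mu> \<le> norm \<mu>0 + 1" using that norm_triangle_sub[of \<mu> \<mu>0] by linarith
    have "integral {0..pi} (\<lambda>x. norm (sl_coeff q \<mu> x)) \<le> integral {0..pi} (\<lambda>x. \<bar>q x\<bar> + (norm \<mu>0 + 1))"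
    proof (rule integral_le)
      show "(\<lambda>x. norm (sl_coeff q \<mu> x)) integrable_on {0..pi}"
        by (rule integrable_if_absolutely_integrable[OF set_integrable_norm[OF sl_coeff_absolutely_integrable[OF q]]])
      show "(\<lambda>x. \<bar>q x\<bar> + (norm \<mu>0 + 1)) integrable_on {0..pi}" using qa by (intro integrable_add) auto
      show "norm (sl_coeff q \<mu> x) \<le> \<bar>q x\<bar> + (norm \<mu>0 + 1)" for x
        using norm_triangle_ineq4[of "of_real (q x)" \<mu>] \<open>norm \<mu> \<le> norm \<mu>0 + 1\<close> by (simp add: sl_coeff_def)
    qed
    also have "\<dots> = integral {0..pi} (\<lambda>x. \<bar>q x\<bar>) + (norm \<mu>0 + 1) * pi"
      using qa by (subst integral_add) auto
    finally show ?thesis by (simp add: P_def)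
  qed
  note l0 = sl_left[OF q, where \<mu> = \<mu>0 and \<alpha> = \<alpha>]
  obtain B where B: "\<And>x. x \<in> {0..pi} \<Longrightarrow> norm (sl_left q \<alpha> \<mu>0 x) \<le> B"
    using compact_imp_bounded[OF compact_continuous_image[OF ode_solution_continuous(1)[OF l0(1)] compact_Icc]]
    unfolding bounded_iff by blast
  have B0: "B \<ge> 0" using order_trans[OF norm_ge_zero B[of 0]] by simp
  have main: "norm (sl_left q \<alpha> \<mu> x - sl_left q \<alpha> \<mu>0 x) \<le> (B * exp (2 * pi * pi) * exp (2 * P * pi)) * norm (\<mu> - \<mu>0)"
    if m: "norm (\<mu> - \<mu>0) \<le> 1" and x: "x \<in> {0..pi}" for \<mu> x
  proof -
    note l = sl_left[OF q, where \<mu> = \<mu> and \<alpha> = \<alpha>]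
    define p p0 where "p = sl_coeff q \<mu>" and "p0 = sl_coeff q \<mu>0"
    define y y0 where "y = sl_left q \<alpha> \<mu>" and "y0 = sl_left q \<alpha> \<mu>0"
    define z z0 where "z = sl_left' q \<alpha> \<mu>" and "z0 = sl_left' q \<alpha> \<mu>0"
    have o: "ode_solution p y z" and o0: "ode_solution p0 y0 z0" using l(1) l0(1) by (simp_all add: p_def p0_def y_def y0_def z_def z0_def)
    have p: "p absolutely_integrable_on {0..pi}" unfolding p_def by (rule sl_coeff_absolutely_integrable[OF q])
    have p0: "p0 absolutely_integrable_on {0..pi}" unfolding p0_def by (rule sl_coeff_absolutely_integrable[OF q])
    define g where "g x = y x - y0 x" for x
    have yc: "continuous_on {0..pi} y" "continuous_on {0..pi} y0" using o o0 by (auto intro: ode_solution_continuous)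
    have gc: "continuous_on {0..pi} g" unfolding g_def[abs_def] by (intro continuous_intros yc)
    have "g x = integral {0..x} (\<lambda>s. integral {0..s} (\<lambda>t. p t * y t - p0 t * y0 t))" if "x \<in> {0..pi}" for x
      using second_derivative_integral_eq(2)[OF ac_derivative_diff[OF ode_solution_ac(1)[OF o] ode_solution_ac(1)[OF o0]]
          ac_derivative_diff[OF ode_solution_ac(2)[OF o] ode_solution_ac(2)[OF o0]] that] l(2,3) l0(2,3)
      by (simp add: g_def y_def y0_def z_def z0_def)
    then have eq: "g x - integral {0..x} (\<lambda>s. integral {0..s} (\<lambda>t. p t * g t)) =
       integral {0..x} (\<lambda>s. integral {0..s} (\<lambda>t. 1 * ((\<mu>0 - \<mu>) * y0 t)))" if "x \<in> {0..pi}" for x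
    proof -
      have "integral {0..x} (\<lambda>s. integral {0..s} (\<lambda>t. p t * y t - p0 t * y0 t)) -
          integral {0..x} (\<lambda>s. integral {0..s} (\<lambda>t. p t * g t)) =
          integral {0..x} (\<lambda>s. integral {0..s} (\<lambda>t. (p t * y t - p0 t * y0 t) - p t * g t))"
        by (intro double_integral_diff integrable_diff integrable_if_absolutely_integrable
            absolutely_integrable_mult_continuous p p0 yc gc that)
      also have "(\<lambda>t. (p t * y t - p0 t * y0 t) - p t * g t) = (\<lambda>t. 1 * ((\<mu>0 - \<mu>) * y0 t))"
        by (simp add: fun_eq_iff g_def p_def p0_def sl_coeff_def algebra_simps)
      finally show ?thesis using \<open>x \<in> {0..pi} \<Longrightarrow> g x = _\<close> that by simp
    qed
    have "norm (g x - integral {0..x} (\<lambda>s. integral {0..s} (\<lambda>t. p t * g t))) \<le> norm (\<mu> - \<mu>0) * B / 2 * exp (2 * pi * pi)"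
      if xx: "x \<in> {0..pi}" for x
    proof -
      have "norm (integral {0..x} (\<lambda>s. integral {0..s} (\<lambda>t. 1 * ((\<mu>0 - \<mu>) * y0 t)))) \<le> norm (\<mu> - \<mu>0) * B / 2 * exp (2 * pi * x)"
      \<comment> \<open>The forcing is read as the coefficient 1 times a function; this coefficient
        has integral pi, so pi takes the place of P in the weight.\<close>
      proof (rule weighted_double_integral_bound[OF _ _ pi_gt_zero _ _ xx])
        show "continuous_on {0..pi} (\<lambda>t. (\<mu>0 - \<mu>) * y0 t)" by (intro continuous_intros yc)
        fix t assume t: "t \<in> {0..pi}"
        have "norm ((\<mu>0 - \<mu>) * y0 t) \<le> norm (\<mu> - \<mu>0) * B * 1"
          using B[OF t] by (simp add: norm_mult norm_minus_commute y0_def mult_left_mono)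
        also have "\<dots> \<le> norm (\<mu> - \<mu>0) * B * exp (2 * pi * t)" using B0 t by (intro mult_left_mono) auto
        finally show "norm ((\<mu>0 - \<mu>) * y0 t) \<le> norm (\<mu> - \<mu>0) * B * exp (2 * pi * t)" .
      qed auto
      also have "\<dots> \<le> norm (\<mu> - \<mu>0) * B / 2 * exp (2 * pi * pi)" using B0 xx by (intro mult_left_mono) auto
      finally show ?thesis using eq[OF xx] by simp
    qed
    from ode_gronwall[OF p Pb[OF m, folded p_def] P0 gc this x]
    have "norm (g x) \<le> 2 * (norm (\<mu> - \<mu>0) * B / 2 * exp (2 * pi * pi)) * exp (2 * P * x)" .
    also have "\<dots> \<le> 2 * (norm (\<mu> - \<mu>0) * B / 2 * exp (2 * pi * pi)) * exp (2 * P * pi)"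
      using B0 x P0 by (intro mult_left_mono) auto
    finally show ?thesis by (simp add: g_def y_def y0_def algebra_simps)
  qed
  show ?thesis by (rule that[OF _ main]) (use B0 in auto)
qed

section \<open>Holomorphy and simple zeros of the characteristic function\<close>

lemma wronskian_constant:
  assumes "ode_solution p y z" "ode_solution p u v" "x \<in> {0..pi}"
  shows "y x * v x - z x * u x = y 0 * v 0 - z 0 * u 0"
  using has_integral_unique[OF ode_lagrange[OF assms]] has_integral_0 by fastforce

lemma ode_exists_terminal:
  assumes p: "p absolutely_integrable_on {0..pi}"
  obtains y z where "ode_solution p y z" "y pi = a" "z pi = b"
proof -
  obtain C C' where C: "ode_solution p C C'" "C 0 = 1" "C' 0 = 0" using ode_exists[OF p] by blast
  obtain S S' where S: "ode_solution p S S'" "S 0 = 0" "S' 0 = 1" using ode_exists[OF p] by blast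
  have w: "C pi * S' pi - C' pi * S pi = 1" using wronskian_constant[OF C(1) S(1), of pi] C S by simp
  \<comment> \<open>Cramer's rule; the determinant is the Wronskian 1.\<close>
  define A where "A = a * S' pi - b * S pi"
  define B where "B = b * C pi - a * C' pi"
  have "A * C pi + B * S pi = a * (C pi * S' pi - C' pi * S pi)" "A * C' pi + B * S' pi = b * (C pi * S' pi - C' pi * S pi)"
    by (simp_all add: A_def B_def algebra_simps)
  then show ?thesis using w by (intro that[OF ode_solution_lincomb[OF C(1) S(1), of A B]]) auto
qed

lemma ode_terminal_zero:
  assumes p: "p absolutely_integrable_on {0..pi}" and o: "ode_solution p y z" and "y pi = 0" "z pi = 0"
  shows "y 0 = 0" "z 0 = 0"
proof -
  obtain C C' where C: "ode_solution p C C'" "C 0 = 1" "C' 0 = 0" using ode_exists[OF p] by blast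
  obtain S S' where S: "ode_solution p S S'" "S 0 = 0" "S' 0 = 1" using ode_exists[OF p] by blast
  \<comment> \<open>The constant Wronskians of y with C and with S are - z 0 and y 0, and they
    vanish at pi.\<close>
  show "y 0 = 0" "z 0 = 0"
    using wronskian_constant[OF o C(1), of pi] wronskian_constant[OF o S(1), of pi] assms C S by auto
qed

text \<open>\<xi> satisfies the boundary condition at pi for the parameter \<mu>0. Lagrange's
  identity with the left solution for \<mu> gives that \<open>sl_char\<close> is k - (\<mu> -
  \<mu>0) J \<mu> with k independent of \<mu>. So the difference quotient at \<mu>0 is exactly - J
  \<mu>, and only continuity of J at \<mu>0 remains to be shown.\<close>

lemma sl_char_has_field_derivative:
  assumes q: "q absolutely_integrable_on {0..pi}"
    and \<xi>: "ode_solution (sl_coeff q \<mu>0) \<xi> \<xi>'" "\<xi> pi = of_real (sin \<beta>)" "\<xi>' pi = - of_real (cos \<beta>)"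
  shows "(sl_char q \<alpha> \<beta> has_field_derivative - integral {0..pi} (\<lambda>t. sl_left q \<alpha> \<mu>0 t * \<xi> t)) (at \<mu>0)"
proof -
  define J where "J \<mu> = integral {0..pi} (\<lambda>t. sl_left q \<alpha> \<mu> t * \<xi> t)" for \<mu>
  define k where "k = - (of_real (sin \<alpha>) * \<xi>' 0 + of_real (cos \<alpha>) * \<xi> 0)"
  note l = sl_left[OF q, where \<alpha> = \<alpha>]
  have \<xi>c: "continuous_on {0..pi} \<xi>" using \<xi>(1) by (rule ode_solution_continuous)
  have int: "(\<lambda>t. sl_left q \<alpha> \<mu> t * \<xi> t) integrable_on {0..pi}" for \<mu>
    by (intro integrable_continuous_interval continuous_intros \<xi>c ode_solution_continuous(1)[OF l(1)])
  have lag: "sl_char q \<alpha> \<beta> \<mu> = k - (\<mu> - \<mu>0) * J \<mu>" for \<mu>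
  proof -
    have "((\<lambda>t. (\<mu> - \<mu>0) * (sl_left q \<alpha> \<mu> t * \<xi> t)) has_integral (- sl_char q \<alpha> \<beta> \<mu> + k)) {0..pi}"
      by (rule has_integral_eq_rhs[OF has_integral_eq[OF _ ode_lagrange[OF l(1)[of \<mu>] \<xi>(1), of pi]]])
        (use l(2,3)[of \<mu>] \<xi>(2,3) in \<open>simp_all add: sl_coeff_def sl_char_def k_def algebra_simps\<close>)
    moreover have "((\<lambda>t. (\<mu> - \<mu>0) * (sl_left q \<alpha> \<mu> t * \<xi> t)) has_integral (\<mu> - \<mu>0) * J \<mu>) {0..pi}"
      unfolding J_def by (intro has_integral_mult_right integrable_integral int)
    ultimately have "- sl_char q \<alpha> \<beta> \<mu> + k = (\<mu> - \<mu>0) * J \<mu>" by (rule has_integral_unique)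
    then show ?thesis by (simp add: algebra_simps)
  qed
  obtain C where C: "C \<ge> 0" "\<And>\<mu> x. norm (\<mu> - \<mu>0) \<le> 1 \<Longrightarrow> x \<in> {0..pi} \<Longrightarrow>
    norm (sl_left q \<alpha> \<mu> x - sl_left q \<alpha> \<mu>0 x) \<le> C * norm (\<mu> - \<mu>0)"
    using sl_left_lipschitz[OF q] by blast
  obtain B where B: "\<And>x. x \<in> {0..pi} \<Longrightarrow> norm (\<xi> x) \<le> B"
    using compact_imp_bounded[OF compact_continuous_image[OF \<xi>c compact_Icc]]
    unfolding bounded_iff by blast
  have Jb: "norm (J \<mu> - J \<mu>0) \<le> C * B * pi * norm (\<mu> - \<mu>0)" if m: "norm (\<mu> - \<mu>0) \<le> 1" for \<mu>
  proof -
    have "J \<mu> - J \<mu>0 = integral {0..pi} (\<lambda>t. (sl_left q \<alpha> \<mu> t - sl_left q \<alpha> \<mu>0 t) * \<xi> t)"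
      unfolding J_def using int by (simp add: left_diff_distrib integral_diff)
    also have "norm \<dots> \<le> integral {0..pi} (\<lambda>t. C * norm (\<mu> - \<mu>0) * B)"
    proof (rule integral_norm_bound_integral)
      show "(\<lambda>t. (sl_left q \<alpha> \<mu> t - sl_left q \<alpha> \<mu>0 t) * \<xi> t) integrable_on {0..pi}"
        using integrable_diff[OF int[of \<mu>] int[of \<mu>0]] by (simp add: left_diff_distrib)
      fix t assume t: "t \<in> {0..pi}"
      show "norm ((sl_left q \<alpha> \<mu> t - sl_left q \<alpha> \<mu>0 t) * \<xi> t) \<le> C * norm (\<mu> - \<mu>0) * B"
        unfolding norm_mult using C B t m by (intro mult_mono) auto
    qed auto
    finally show ?thesis by (simp add: algebra_simps)
  qed
  have "(J \<longlongrightarrow> J \<mu>0) (at \<mu>0)"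
  proof (rule Lim_transform_bound[of "\<lambda>\<mu>. J \<mu> - J \<mu>0" "\<lambda>\<mu>. C * B * pi * norm (\<mu> - \<mu>0)", THEN LIM_zero_cancel])
    show "\<forall>\<^sub>F \<mu> in at \<mu>0. norm (J \<mu> - J \<mu>0) \<le> norm (C * B * pi * norm (\<mu> - \<mu>0))"
    proof -
      have "norm (J \<mu> - J \<mu>0) \<le> norm (C * B * pi * norm (\<mu> - \<mu>0))" if "dist \<mu> \<mu>0 < 1" for \<mu>
        using Jb[of \<mu>] that abs_ge_self[of "C * B * pi * norm (\<mu> - \<mu>0)"]
        unfolding dist_norm real_norm_def by linarith
      then show ?thesis unfolding eventually_at by (intro exI[of _ 1]) simp
    qed
    show "((\<lambda>\<mu>. C * B * pi * norm (\<mu> - \<mu>0)) \<longlongrightarrow> 0) (at \<mu>0)"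
      by (auto intro!: tendsto_eq_intros)
  qed
  then have "((\<lambda>\<mu>. - J \<mu>) \<longlongrightarrow> - J \<mu>0) (at \<mu>0)" by (rule tendsto_minus)
  moreover have "\<forall>\<^sub>F \<mu> in at \<mu>0. - J \<mu> = (sl_char q \<alpha> \<beta> \<mu> - sl_char q \<alpha> \<beta> \<mu>0) / (\<mu> - \<mu>0)"
    using lag by (auto simp: eventually_at intro!: exI[of _ 1])
  ultimately show ?thesis
    unfolding has_field_derivative_iff J_def[symmetric] by (rule Lim_transform_eventually)
qed

lemma sl_char_holomorphic:
  assumes q: "q absolutely_integrable_on {0..pi}"
  shows "sl_char q \<alpha> \<beta> holomorphic_on S"
proof -
  have "\<exists>D. (sl_char q \<alpha> \<beta> has_field_derivative D) (at \<mu>)" for \<mu>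
    using ode_exists_terminal[OF sl_coeff_absolutely_integrable[OF q]] sl_char_has_field_derivative[OF q] by metis
  then show ?thesis
    by (metis field_differentiable_at_within field_differentiable_def holomorphic_on_def)
qed

lemma ode_solution_cnj:
  assumes o: "ode_solution p y z"
  shows "ode_solution (\<lambda>x. cnj (p x)) (\<lambda>x. cnj (y x)) (\<lambda>x. cnj (z x))"
proof -
  have "absolutely_continuous_fun_on 0 pi z" using ode_solution_ac(2)[OF o] by (simp add: ac_derivative_def)
  then have "absolutely_continuous_fun_on 0 pi (\<lambda>x. cnj (z x))"
    by (simp add: absolutely_continuous_fun_on_def flip: complex_cnj_diff)
  moreover obtain N where "negligible N"
    and N: "\<And>x. x \<in> {0..pi} - N \<Longrightarrow> (z has_vector_derivative p x * y x) (at x within {0..pi})"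
    using ode_solution_ac(2)[OF o] unfolding ac_derivative_def by blast
  moreover have "((\<lambda>x. cnj (z x)) has_vector_derivative cnj (p x) * cnj (y x)) (at x within {0..pi})"
    if "x \<in> {0..pi} - N" for x
    using has_vector_derivative_cnj[OF N[OF that]] by simp
  moreover have "((\<lambda>x. cnj (y x)) has_vector_derivative cnj (z x)) (at x within {0..pi})" if "x \<in> {0..pi}" for x
    using o that unfolding ode_solution_def by (intro has_vector_derivative_cnj) auto
  ultimately show ?thesis unfolding ode_solution_def ac_derivative_def by blast
qed

text \<open>At a real zero the conjugate of the left solution solves the same equation and satisfies
  the condition at pi. Rescaled, it can serve as \<xi>, so the derivative is a nonzero multiple of
  the integral of |y|^2.\<close>

lemma sl_char_simple_zero:
  assumes q: "q absolutely_integrable_on {0..pi}" and z: "sl_char q \<alpha> \<beta> (of_real \<mu>) = 0"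
  shows "deriv (sl_char q \<alpha> \<beta>) (of_real \<mu>) \<noteq> 0"
proof -
  define y z where "y = sl_left q \<alpha> (of_real \<mu>)" and "z = sl_left' q \<alpha> (of_real \<mu>)"
  note l = sl_left[OF q, where \<mu> = "of_real \<mu>" and \<alpha> = \<alpha>, folded y_def z_def]
  have bc: "y pi * of_real (cos \<beta>) + z pi * of_real (sin \<beta>) = 0"
    using assms(2) by (simp add: sl_char_def y_def z_def algebra_simps)
  obtain k where k: "y pi = k * of_real (sin \<beta>)" "z pi = k * (- of_real (cos \<beta>))"
    using boundary_condition_solve[OF bc] by blast
  have nz: "\<not> (y 0 = 0 \<and> z 0 = 0)" using l(2,3) sl_sin_cos_nonzero[of \<alpha>] by auto
  then have k0: "k \<noteq> 0" using ode_terminal_zero[OF sl_coeff_absolutely_integrable[OF q] l(1)] k by auto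
  have oc: "ode_solution (sl_coeff q (of_real \<mu>)) (\<lambda>x. cnj (y x)) (\<lambda>x. cnj (z x))"
    using ode_solution_cnj[OF l(1)] by (simp add: sl_coeff_def[abs_def])
  have t: "cnj (y pi) / cnj k = of_real (sin \<beta>)" "cnj (z pi) / cnj k = - of_real (cos \<beta>)"
    using k k0 by simp_all
  have o': "ode_solution (sl_coeff q (of_real \<mu>)) (\<lambda>x. cnj (y x) / cnj k) (\<lambda>x. cnj (z x) / cnj k)"
    using ode_solution_lincomb[OF oc oc, of "1 / cnj k" 0] by simp
  have "(sl_char q \<alpha> \<beta> has_field_derivative - integral {0..pi} (\<lambda>t. y t * (cnj (y t) / cnj k))) (at (of_real \<mu>))"
    unfolding y_def by (rule sl_char_has_field_derivative[OF q o' t, unfolded y_def])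
  then have d: "deriv (sl_char q \<alpha> \<beta>) (of_real \<mu>) = - integral {0..pi} (\<lambda>t. y t * (cnj (y t) / cnj k))"
    by (rule DERIV_imp_deriv)
  have yc: "continuous_on {0..pi} y" using l(1) by (rule ode_solution_continuous)
  have "(\<lambda>t. y t * (cnj (y t) / cnj k)) = (\<lambda>t. (1 / cnj k) * of_real ((norm (y t))\<^sup>2))"
    by (simp add: fun_eq_iff complex_norm_square[symmetric] field_simps)
  then have "integral {0..pi} (\<lambda>t. y t * (cnj (y t) / cnj k)) = (1 / cnj k) * of_real (integral {0..pi} (\<lambda>t. (norm (y t))\<^sup>2))"
    using integral_linear[OF integrable_continuous_interval bounded_linear_of_real[where 'a=complex], of 0 pi "\<lambda>t. (norm (y t))\<^sup>2"]
    by (simp add: o_def continuous_on_norm continuous_on_power yc)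
  moreover have "integral {0..pi} (\<lambda>t. (norm (y t))\<^sup>2) \<noteq> 0"
  proof
    assume "integral {0..pi} (\<lambda>t. (norm (y t))\<^sup>2) = 0"
    then have "\<forall>x\<in>{0..pi}. (norm (y x))\<^sup>2 = 0"
      by (subst (asm) integral_eq_0_iff) (auto intro!: continuous_intros yc)
    then have "\<And>x. x \<in> {0..pi} \<Longrightarrow> y x = 0" by auto
    then show False using ode_solution_zero_derivative[OF l(1)] nz by auto
  qed
  ultimately show ?thesis using d k0 by simp
qed

text \<open>With \<lambda>^2 = \<mu>, the leading term is \<lambda>^(1 - 2 \<kappa>) sin (\<pi> (\<lambda> - \<kappa>)) up to sign.\<close>

definition sl_kappa :: "real \<Rightarrow> real \<Rightarrow> real" where
  "sl_kappa \<alpha> \<beta> = (if \<alpha> = pi \<and> \<beta> = 0 then 1 else if \<alpha> = pi \<or> \<beta> = 0 then 1/2 else 0)"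

definition sl_main :: "real \<Rightarrow> complex \<Rightarrow> complex" where
  "sl_main \<kappa> \<mu> = (if \<kappa> = 0 then \<mu> * sin_sol \<mu> pi else if \<kappa> = 1 then sin_sol \<mu> pi else cos_sol \<mu> pi)"

section \<open>The leading term of the characteristic function and its error\<close>

lemma sl_char_free:
  "sl_char (\<lambda>_. 0) \<alpha> \<beta> \<mu> =
     of_real (cos \<beta>) * (of_real (sin \<alpha>) * cos_sol \<mu> pi - of_real (cos \<alpha>) * sin_sol \<mu> pi)
     - of_real (sin \<beta>) * (\<mu> * of_real (sin \<alpha>) * sin_sol \<mu> pi + of_real (cos \<alpha>) * cos_sol \<mu> pi)"
proof -
  have q: "(\<lambda>_. 0::real) absolutely_integrable_on {0..pi}" by simp
  note l = sl_left[OF q, where \<mu> = \<mu> and \<alpha> = \<alpha>]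
  note v = ode_volterra[OF l(1), of pi \<mu>]
  \<comment> \<open>For q = 0 and \<omega> = \<mu> the perturbation p + \<omega> in
    \<open>ode_volterra\<close> is 0, so the comparison with the free solutions is exact.\<close>
  have "sl_left (\<lambda>_. 0) \<alpha> \<mu> pi - sl_left (\<lambda>_. 0) \<alpha> \<mu> 0 * cos_sol \<mu> pi - sl_left' (\<lambda>_. 0) \<alpha> \<mu> 0 * sin_sol \<mu> pi = 0"
    using v(1) by (intro has_integral_unique[OF _ has_integral_0]) (simp_all add: sl_coeff_def)
  moreover have "sl_left' (\<lambda>_. 0) \<alpha> \<mu> pi + \<mu> * sl_left (\<lambda>_. 0) \<alpha> \<mu> 0 * sin_sol \<mu> pi - sl_left' (\<lambda>_. 0) \<alpha> \<mu> 0 * cos_sol \<mu> pi = 0"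
    using v(2) by (intro has_integral_unique[OF _ has_integral_0]) (simp_all add: sl_coeff_def)
  ultimately have eq: "sl_left (\<lambda>_. 0) \<alpha> \<mu> pi = of_real (sin \<alpha>) * cos_sol \<mu> pi - of_real (cos \<alpha>) * sin_sol \<mu> pi"
    "sl_left' (\<lambda>_. 0) \<alpha> \<mu> pi = - (\<mu> * of_real (sin \<alpha>) * sin_sol \<mu> pi + of_real (cos \<alpha>) * cos_sol \<mu> pi)"
    using l(2,3) by (simp_all add: algebra_simps add_eq_0_iff)
  show ?thesis unfolding sl_char_def eq by (simp add: algebra_simps)
qed

text \<open>The three leading terms are, up to sign, characteristic functions of the free problem:
  with Neumann conditions, with a Dirichlet condition at 0 and a Neumann condition at pi, and with
  Dirichlet conditions. They inherit holomorphy and simplicity of zeros from there.\<close>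

lemma sl_main_eq_char:
  obtains \<sigma> \<alpha> \<beta> where "\<sigma> \<noteq> 0" "\<And>\<mu>. sl_main \<kappa> \<mu> = \<sigma> * sl_char (\<lambda>_. 0) \<alpha> \<beta> \<mu>"
proof -
  consider "\<kappa> = 0" | "\<kappa> = 1" | "\<kappa> \<noteq> 0" "\<kappa> \<noteq> 1" by blast
  then show ?thesis
  proof cases
    case 1
    then show ?thesis by (intro that[of "-1" "pi/2" "pi/2"]) (auto simp: sl_main_def sl_char_free)
  next
    case 2
    then show ?thesis by (intro that[of 1 pi 0]) (auto simp: sl_main_def sl_char_free)
  next
    case 3
    then show ?thesis by (intro that[of 1 pi "pi/2"]) (auto simp: sl_main_def sl_char_free)
  qed
qed

text \<open>The error is one power of |csqrt \<mu>| smaller than the leading term, whose size away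
  from its zeros is |csqrt \<mu>|^(1 - 2 \<kappa>) exp (pi |Im (csqrt \<mu>)|). Up to sign, c is the
  product of sin \<alpha> and sin \<beta>, with the factor for \<alpha> = pi or \<beta> = 0 left
  out, so it is nonzero.\<close>

lemma sl_char_asymptotics:
  assumes q: "q absolutely_integrable_on {0..pi}" and \<alpha>: "\<alpha> \<in> {0<..pi}" and \<beta>: "\<beta> \<in> {0..<pi}"
  defines "\<kappa> \<equiv> sl_kappa \<alpha> \<beta>"
  obtains c C K where "c \<noteq> 0" "C > 0" "K \<ge> 1"
    "\<And>\<mu>. norm (csqrt \<mu>) \<ge> K \<Longrightarrow> norm (sl_char q \<alpha> \<beta> \<mu> - c * sl_main \<kappa> \<mu>) \<le>
        C * norm (csqrt \<mu>) powr (- 2 * \<kappa>) * exp (\<bar>Im (csqrt \<mu>)\<bar> * pi)"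
proof -
  define I where "I = integral {0..pi} (\<lambda>t. norm (complex_of_real (q t)))"
  have qc: "(\<lambda>t. complex_of_real (q t)) absolutely_integrable_on {0..pi}" by (rule of_real_absolutely_integrable[OF q])
  have I0: "I \<ge> 0" unfolding I_def
    by (rule integral_nonneg[OF integrable_if_absolutely_integrable[OF set_integrable_norm[OF qc]]]) auto
  have main: "norm (sl_left q \<alpha> \<mu> pi - (of_real (sin \<alpha>) * cos_sol \<mu> pi - of_real (cos \<alpha>) * sin_sol \<mu> pi))
       \<le> I * (2 * (\<bar>sin \<alpha>\<bar> + \<bar>cos \<alpha>\<bar> / norm (csqrt \<mu>))) / norm (csqrt \<mu>) * exp (\<bar>Im (csqrt \<mu>)\<bar> * pi)"
     "norm (sl_left' q \<alpha> \<mu> pi - (- \<mu> * of_real (sin \<alpha>) * sin_sol \<mu> pi - of_real (cos \<alpha>) * cos_sol \<mu> pi))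
       \<le> I * (2 * (\<bar>sin \<alpha>\<bar> + \<bar>cos \<alpha>\<bar> / norm (csqrt \<mu>))) * exp (\<bar>Im (csqrt \<mu>)\<bar> * pi)"
    if "norm (csqrt \<mu>) \<ge> 2 * I + 1" for \<mu>
  proof -
    note l = sl_left[OF q, where \<mu> = \<mu> and \<alpha> = \<alpha>]
    have eq: "sl_coeff q \<mu> t + \<mu> = complex_of_real (q t)" for t by (simp add: sl_coeff_def)
    note g = ode_growth_bound[OF l(1) qc eq that[unfolded I_def], folded I_def]
    show "norm (sl_left q \<alpha> \<mu> pi - (of_real (sin \<alpha>) * cos_sol \<mu> pi - of_real (cos \<alpha>) * sin_sol \<mu> pi))
       \<le> I * (2 * (\<bar>sin \<alpha>\<bar> + \<bar>cos \<alpha>\<bar> / norm (csqrt \<mu>))) / norm (csqrt \<mu>) * exp (\<bar>Im (csqrt \<mu>)\<bar> * pi)"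
      using g(1) unfolding l(2,3) by (simp add: algebra_simps)
    show "norm (sl_left' q \<alpha> \<mu> pi - (- \<mu> * of_real (sin \<alpha>) * sin_sol \<mu> pi - of_real (cos \<alpha>) * cos_sol \<mu> pi))
       \<le> I * (2 * (\<bar>sin \<alpha>\<bar> + \<bar>cos \<alpha>\<bar> / norm (csqrt \<mu>))) * exp (\<bar>Im (csqrt \<mu>)\<bar> * pi)"
      using g(2) unfolding l(2,3) by (simp add: algebra_simps)
  qed
  have cs: "norm (cos_sol \<mu> pi) \<le> exp (\<bar>Im (csqrt \<mu>)\<bar> * pi)"
    "norm (sin_sol \<mu> pi) \<le> exp (\<bar>Im (csqrt \<mu>)\<bar> * pi) / norm (csqrt \<mu>)" if "norm (csqrt \<mu>) \<ge> 1" for \<mu>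
  proof -
    have "\<mu> \<noteq> 0" using that by auto
    then show "norm (cos_sol \<mu> pi) \<le> exp (\<bar>Im (csqrt \<mu>)\<bar> * pi)"
      "norm (sin_sol \<mu> pi) \<le> exp (\<bar>Im (csqrt \<mu>)\<bar> * pi) / norm (csqrt \<mu>)"
      using norm_cos_sol_le[of pi \<mu>] norm_sin_sol_le[of pi \<mu>] by simp_all
  qed
  have small: "norm (of_real r * X) \<le> B" if "\<bar>r\<bar> \<le> 1" "norm X \<le> B" for r :: real and X :: complex and B
    using mult_right_mono[OF that(1) norm_ge_zero[of X]] that(2) by (simp add: norm_mult)
  show ?thesis
  proof (cases "\<alpha> = pi")
    case True
    show ?thesis
    proof (cases "\<beta> = 0")
      case b: True
      show ?thesis
      proof (rule that[of 1 "2 * I + 1" "2 * I + 1"])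
        fix \<mu> assume k: "norm (csqrt \<mu>) \<ge> 2 * I + 1"
        define k E where "k = norm (csqrt \<mu>)" and "E = exp (\<bar>Im (csqrt \<mu>)\<bar> * pi)"
        have k1: "k \<ge> 1" using k I0 unfolding k_def by linarith
        have "norm (sl_char q \<alpha> \<beta> \<mu> - 1 * sl_main \<kappa> \<mu>) \<le> I * (2 * (1 / k)) / k * E"
          using main(1)[OF k] True b unfolding k_def E_def by (simp add: sl_char_def sl_main_def \<kappa>_def sl_kappa_def)
        also have "\<dots> = (2 * I) * (1 / k\<^sup>2) * E" using k1 by (simp add: power2_eq_square field_simps)
        also have "\<dots> \<le> (2 * I + 1) * (1 / k\<^sup>2) * E" by (intro mult_right_mono) (auto simp: E_def)
        also have "1 / k\<^sup>2 = k powr (- 2 * \<kappa>)"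
          using True b k1 by (simp add: \<kappa>_def sl_kappa_def powr_minus_divide powr_numeral)
        finally show "norm (sl_char q \<alpha> \<beta> \<mu> - 1 * sl_main \<kappa> \<mu>) \<le>
           (2 * I + 1) * norm (csqrt \<mu>) powr (- 2 * \<kappa>) * exp (\<bar>Im (csqrt \<mu>)\<bar> * pi)" by (simp add: k_def E_def)
      qed (use I0 in auto)
    next
      case b: False
      then have "sin \<beta> \<noteq> 0" using sin_gt_zero[of \<beta>] \<beta> by auto
      show ?thesis
      proof (rule that[of "of_real (sin \<beta>)" "4 * I + 1" "2 * I + 1"])
        fix \<mu> assume k: "norm (csqrt \<mu>) \<ge> 2 * I + 1"
        define k E where "k = norm (csqrt \<mu>)" and "E = exp (\<bar>Im (csqrt \<mu>)\<bar> * pi)"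
        have k1: "k \<ge> 1" using k I0 unfolding k_def by linarith
        have A: "norm (sl_left q \<alpha> \<mu> pi - sin_sol \<mu> pi) \<le> I * (2 * (1 / k)) / k * E"
          and B: "norm (sl_left' q \<alpha> \<mu> pi - cos_sol \<mu> pi) \<le> I * (2 * (1 / k)) * E"
          using main[OF k] True by (simp_all add: k_def E_def)
        \<comment> \<open>The value at pi is known one order better than the derivative; the surplus
          is given up so that both errors have the same form.\<close>
        have "I * (2 * (1 / k)) / k * E \<le> I * (2 * (1 / k)) / 1 * E"
          using k1 I0 by (intro mult_right_mono divide_left_mono) (auto simp: E_def)
        then have A: "norm (sl_left q \<alpha> \<mu> pi - sin_sol \<mu> pi) \<le> I * (2 * (1 / k)) * E" using A by simp
        have "sl_char q \<alpha> \<beta> \<mu> - of_real (sin \<beta>) * sl_main \<kappa> \<mu> =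
          of_real (cos \<beta>) * (sl_left q \<alpha> \<mu> pi - sin_sol \<mu> pi) + of_real (sin \<beta>) * (sl_left' q \<alpha> \<mu> pi - cos_sol \<mu> pi)
            + of_real (cos \<beta>) * sin_sol \<mu> pi"
          using True b by (simp add: sl_char_def sl_main_def \<kappa>_def sl_kappa_def algebra_simps)
        also have "norm \<dots> \<le> I * (2 * (1 / k)) * E + I * (2 * (1 / k)) * E + E / k"
          using cs(2)[of \<mu>] k1 by (intro norm_triangle_mono small A B) (auto simp: k_def E_def)
        also have "\<dots> = (4 * I + 1) * (1 / k) * E" using k1 by (simp add: field_simps)
        also have "1 / k = k powr (- 2 * \<kappa>)"
          using True b k1 by (simp add: \<kappa>_def sl_kappa_def powr_minus_divide)
        finally show "norm (sl_char q \<alpha> \<beta> \<mu> - of_real (sin \<beta>) * sl_main \<kappa> \<mu>) \<le>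
           (4 * I + 1) * norm (csqrt \<mu>) powr (- 2 * \<kappa>) * exp (\<bar>Im (csqrt \<mu>)\<bar> * pi)" by (simp add: k_def E_def)
      qed (use I0 \<open>sin \<beta> \<noteq> 0\<close> in auto)
    qed
  next
    case False
    then have s\<alpha>: "sin \<alpha> \<noteq> 0" using sin_gt_zero[of \<alpha>] \<alpha> by auto
    have rough: "I * (2 * (\<bar>sin \<alpha>\<bar> + \<bar>cos \<alpha>\<bar> / k)) \<le> 4 * I" if "k \<ge> 1" for k
    proof -
      have "\<bar>cos \<alpha>\<bar> / k \<le> 1 / 1" using that by (intro frac_le) auto
      then have "\<bar>sin \<alpha>\<bar> + \<bar>cos \<alpha>\<bar> / k \<le> 1 + 1" by (intro add_mono) auto
      then have "2 * (\<bar>sin \<alpha>\<bar> + \<bar>cos \<alpha>\<bar> / k) \<le> 4" by simp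
      from mult_left_mono[OF this I0] show ?thesis by simp
    qed
    show ?thesis
    proof (cases "\<beta> = 0")
      case b: True
      show ?thesis
      proof (rule that[of "of_real (sin \<alpha>)" "4 * I + 1" "2 * I + 1"])
        fix \<mu> assume k: "norm (csqrt \<mu>) \<ge> 2 * I + 1"
        define k E where "k = norm (csqrt \<mu>)" and "E = exp (\<bar>Im (csqrt \<mu>)\<bar> * pi)"
        have k1: "k \<ge> 1" using k I0 unfolding k_def by linarith
        define A where "A = sl_left q \<alpha> \<mu> pi - (of_real (sin \<alpha>) * cos_sol \<mu> pi - of_real (cos \<alpha>) * sin_sol \<mu> pi)"
        have "norm A \<le> I * (2 * (\<bar>sin \<alpha>\<bar> + \<bar>cos \<alpha>\<bar> / k)) / k * E"
          using main(1)[OF k] by (simp add: k_def E_def A_def)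
        also have "\<dots> \<le> 4 * I / k * E" using k1 rough[OF k1] by (intro mult_right_mono divide_right_mono) (auto simp: E_def)
        finally have A: "norm A \<le> 4 * I / k * E" .
        have "sl_char q \<alpha> \<beta> \<mu> - of_real (sin \<alpha>) * sl_main \<kappa> \<mu> = A + of_real (- cos \<alpha>) * sin_sol \<mu> pi"
          using False b by (simp add: sl_char_def sl_main_def \<kappa>_def sl_kappa_def A_def algebra_simps)
        also have "norm \<dots> \<le> 4 * I / k * E + E / k"
          using cs(2)[of \<mu>] k1 by (intro norm_triangle_mono small A) (auto simp: k_def E_def)
        also have "\<dots> = (4 * I + 1) * (1 / k) * E" using k1 by (simp add: field_simps)
        also have "1 / k = k powr (- 2 * \<kappa>)"
          using False b k1 by (simp add: \<kappa>_def sl_kappa_def powr_minus_divide)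
        finally show "norm (sl_char q \<alpha> \<beta> \<mu> - of_real (sin \<alpha>) * sl_main \<kappa> \<mu>) \<le>
           (4 * I + 1) * norm (csqrt \<mu>) powr (- 2 * \<kappa>) * exp (\<bar>Im (csqrt \<mu>)\<bar> * pi)" by (simp add: k_def E_def)
      qed (use I0 s\<alpha> in auto)
    next
      case b: False
      then have s\<beta>: "sin \<beta> \<noteq> 0" using sin_gt_zero[of \<beta>] \<beta> by auto
      show ?thesis
      proof (rule that[of "- of_real (sin \<alpha> * sin \<beta>)" "8 * I + 3" "2 * I + 1"])
        fix \<mu> assume k: "norm (csqrt \<mu>) \<ge> 2 * I + 1"
        define k E where "k = norm (csqrt \<mu>)" and "E = exp (\<bar>Im (csqrt \<mu>)\<bar> * pi)"
        have k1: "k \<ge> 1" using k I0 unfolding k_def by linarith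
        have E0: "E \<ge> 0" by (simp add: E_def)
        define A where "A = sl_left q \<alpha> \<mu> pi - (of_real (sin \<alpha>) * cos_sol \<mu> pi - of_real (cos \<alpha>) * sin_sol \<mu> pi)"
        define B where "B = sl_left' q \<alpha> \<mu> pi - (- \<mu> * of_real (sin \<alpha>) * sin_sol \<mu> pi - of_real (cos \<alpha>) * cos_sol \<mu> pi)"
        have "norm A \<le> I * (2 * (\<bar>sin \<alpha>\<bar> + \<bar>cos \<alpha>\<bar> / k)) / k * E"
          using main(1)[OF k] by (simp add: k_def E_def A_def)
        also have "\<dots> \<le> 4 * I / 1 * E" using k1 I0 rough[OF k1] by (intro mult_right_mono frac_le) (auto simp: E_def)
        finally have A: "norm A \<le> 4 * I * E" by simp
        have "norm B \<le> I * (2 * (\<bar>sin \<alpha>\<bar> + \<bar>cos \<alpha>\<bar> / k)) * E"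
          using main(2)[OF k] by (simp add: k_def E_def B_def)
        also have "\<dots> \<le> 4 * I * E" using k1 rough[OF k1] by (intro mult_right_mono) (auto simp: E_def)
        finally have B: "norm B \<le> 4 * I * E" .
        have c: "norm (cos_sol \<mu> pi) \<le> E" "norm (sin_sol \<mu> pi) \<le> E"
        proof -
          show "norm (cos_sol \<mu> pi) \<le> E" using cs(1)[of \<mu>] k1 by (simp add: k_def E_def)
          have "norm (sin_sol \<mu> pi) \<le> E / k" using cs(2)[of \<mu>] k1 by (simp add: k_def E_def)
          also have "\<dots> \<le> E / 1" using k1 E0 by (intro divide_left_mono) auto
          finally show "norm (sin_sol \<mu> pi) \<le> E" by simp
        qed
        have prods: "\<bar>cos \<beta> * sin \<alpha>\<bar> \<le> 1" "\<bar>- (cos \<beta> * cos \<alpha>)\<bar> \<le> 1" "\<bar>- (sin \<beta> * cos \<alpha>)\<bar> \<le> 1"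
          by (simp_all add: abs_mult mult_le_one)
        have "sl_char q \<alpha> \<beta> \<mu> - (- of_real (sin \<alpha> * sin \<beta>)) * sl_main \<kappa> \<mu> =
          of_real (cos \<beta>) * A + of_real (sin \<beta>) * B + of_real (cos \<beta> * sin \<alpha>) * cos_sol \<mu> pi
             + of_real (- (cos \<beta> * cos \<alpha>)) * sin_sol \<mu> pi + of_real (- (sin \<beta> * cos \<alpha>)) * cos_sol \<mu> pi"
          using False b by (simp add: sl_char_def sl_main_def \<kappa>_def sl_kappa_def A_def B_def algebra_simps)
        also have "norm \<dots> \<le> 4 * I * E + 4 * I * E + E + E + E"
          by (intro norm_triangle_mono small A B c prods abs_sin_le_one abs_cos_le_one)
        also have "\<dots> = (8 * I + 3) * k powr (- 2 * \<kappa>) * E"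
          using False b k1 by (simp add: \<kappa>_def sl_kappa_def algebra_simps)
        finally show "norm (sl_char q \<alpha> \<beta> \<mu> - (- of_real (sin \<alpha> * sin \<beta>)) * sl_main \<kappa> \<mu>) \<le>
           (8 * I + 3) * norm (csqrt \<mu>) powr (- 2 * \<kappa>) * exp (\<bar>Im (csqrt \<mu>)\<bar> * pi)" by (simp only: k_def E_def)
      qed (use I0 s\<alpha> s\<beta> in auto)
    qed
  qed
qed

subsection \<open>Counting eigenvalues by Rouche's theorem\<close>

lemma finite_zeros_entire:
  assumes f: "f holomorphic_on UNIV" and "f w \<noteq> 0"
  shows "finite {z \<in> cball 0 r. f z = (0::complex)}"
proof (cases "f constant_on UNIV")
  case True
  then obtain c where "\<And>z. f z = c" by (auto simp: constant_on_def)
  then show ?thesis using assms(2) by simp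
qed (use holomorphic_compact_finite_zeros[OF f, of "cball 0 r"] in auto)

text \<open>\<open>Rouche_theorem\<close> counts zeros weighted by winding number and order. For a
  circle the winding numbers are 1 inside and 0 outside, and simplicity makes every order 1, so both
  sums are cardinalities.\<close>

lemma rouche_card_simple_zeros:
  fixes f g :: "complex \<Rightarrow> complex"
  assumes f: "f holomorphic_on UNIV" and g: "g holomorphic_on UNIV" and r: "r > 0"
    and less: "\<And>z. norm z = r \<Longrightarrow> norm (g z - f z) < norm (f z)"
    and sf: "\<And>z. f z = 0 \<Longrightarrow> deriv f z \<noteq> 0" and sg: "\<And>z. g z = 0 \<Longrightarrow> deriv g z \<noteq> 0"
  shows "card {z. norm z < r \<and> f z = 0} = card {z. norm z < r \<and> g z = 0}"
proof -
  \<comment> \<open>The domain must contain the circle, hence the larger radius; zeros between the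
    two radii have winding number 0.\<close>
  define S where "S = ball (0::complex) (r + 1)"
  define \<gamma> where "\<gamma> = circlepath (0::complex) r"
  have fw: "f (of_real r) \<noteq> 0" "g (of_real r) \<noteq> 0" using less[of "of_real r"] r by auto
  have fin: "finite {z \<in> S. h z = 0}" if "h holomorphic_on UNIV" "h (of_real r) \<noteq> 0" for h
    using finite_zeros_entire[OF that, of "r + 1"] by (rule rev_finite_subset) (auto simp: S_def)
  have zo: "zorder h z = 1" if "h holomorphic_on UNIV" "h z = 0" "deriv h z \<noteq> 0" for h z
    by (rule zorder_zero_eqI[OF that(1)]) (use that in auto)
  have sum: "(\<Sum>p\<in>{z \<in> S. h z = 0}. winding_number \<gamma> p * zorder h p) = of_nat (card {z. norm z < r \<and> h z = 0})"
    if h: "h holomorphic_on UNIV" "\<And>z. h z = 0 \<Longrightarrow> deriv h z \<noteq> 0" "\<And>z. norm z = r \<Longrightarrow> h z \<noteq> 0" for h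
  proof -
    have "h (of_real r) \<noteq> 0" using h(3) r by simp
    then have fin': "finite {z \<in> S. h z = 0}" using fin h by blast
    have "winding_number \<gamma> p * zorder h p = (if norm p < r then 1 else 0)" if "p \<in> {z \<in> S. h z = 0}" for p
    proof (cases "norm p < r")
      case True
      then show ?thesis using winding_number_circlepath[of p 0 r] zo[of h p] h that by (simp add: \<gamma>_def)
    next
      case False
      then have "norm p > r" using h(3)[of p] that by fastforce
      then have "winding_number \<gamma> p = 0"
        unfolding \<gamma>_def using r by (intro winding_number_zero_outside[of _ "cball 0 r"]) (auto simp: path_image_circlepath)
      then show ?thesis using False by simp
    qed
    then have "(\<Sum>p\<in>{z \<in> S. h z = 0}. winding_number \<gamma> p * zorder h p) = (\<Sum>p\<in>{z \<in> S. h z = 0}. if norm p < r then 1 else 0)"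
      by (intro sum.cong) auto
    also have "\<dots> = (\<Sum>p\<in>{z \<in> {z \<in> S. h z = 0}. norm z < r}. 1)"
      using fin' by (subst sum.inter_filter) auto
    also have "{z \<in> {z \<in> S. h z = 0}. norm z < r} = {z. norm z < r \<and> h z = 0}" by (auto simp: S_def)
    finally show ?thesis by simp
  qed
  have hs: "h holomorphic_on S" if "h holomorphic_on UNIV" for h using that by (rule holomorphic_on_subset) simp
  have "(\<Sum>p\<in>{p \<in> S. f p + (g p - f p) = 0}. winding_number \<gamma> p * zorder (\<lambda>p. f p + (g p - f p)) p)
          = (\<Sum>p\<in>{p \<in> S. f p = 0}. winding_number \<gamma> p * zorder f p)"
  proof (rule Rouche_theorem)
    show "\<forall>z. z \<notin> S \<longrightarrow> winding_number \<gamma> z = 0"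
      unfolding \<gamma>_def S_def using r
      by (intro allI impI winding_number_zero_outside[of _ "cball 0 r"]) (auto simp: path_image_circlepath)
    show "\<forall>z\<in>path_image \<gamma>. norm (g z - f z) < norm (f z)"
      using less r by (auto simp: \<gamma>_def path_image_circlepath)
  qed (use fin[OF f fw(1)] fin[OF g fw(2)] r hs f g in
       \<open>auto simp: S_def \<gamma>_def path_image_circlepath intro!: holomorphic_intros\<close>)
  then have "complex_of_nat (card {z. norm z < r \<and> g z = 0}) = of_nat (card {z. norm z < r \<and> f z = 0})"
    using sum[OF f sf] sum[OF g sg] less by force
  then show ?thesis by (simp only: of_nat_eq_iff)
qed

text \<open>Shifting the argument of the sine by pi \<kappa> produces sin, - cos and - sin in the
  three cases, so one estimate of the sine serves all of them.\<close>

lemma norm_sl_main: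
  assumes \<kappa>: "\<kappa> \<in> {0, 1/2, 1}" and "\<mu> \<noteq> 0"
  shows "norm (sl_main \<kappa> \<mu>) = norm (csqrt \<mu>) powr (1 - 2 * \<kappa>) * norm (sin (of_real pi * (csqrt \<mu> - of_real \<kappa>)))"
proof -
  define l where "l = csqrt \<mu>"
  have l: "l \<noteq> 0" "\<mu> = l * l" using assms(2) by (simp_all add: l_def csqrt_mult_self)
  consider "\<kappa> = 0" | "\<kappa> = 1/2" | "\<kappa> = 1" using \<kappa> by blast
  then show ?thesis
  proof cases
    case 1
    have "sl_main \<kappa> \<mu> = \<mu> * (sin (of_real pi * l) / l)"
      unfolding sl_main_def sin_sol_def l_def using 1 assms(2) by (simp only: if_True if_False refl mult.commute)
    then have "sl_main \<kappa> \<mu> = (l * l) * (sin (of_real pi * l) / l)" using l(2) by metis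
    then have "sl_main \<kappa> \<mu> = l * sin (of_real pi * l)" using l(1) by simp
    then show ?thesis using 1 l(1) by (simp add: norm_mult l_def)
  next
    case 2
    have "sin (of_real pi * (l - of_real \<kappa>)) = - cos (of_real pi * l)"
    proof -
      have "of_real pi * (l - of_real \<kappa>) = of_real pi * l - of_real (pi / 2)" unfolding 2 by (simp add: algebra_simps)
      then show ?thesis by (simp add: sin_diff sin_of_real cos_of_real del: of_real_divide)
    qed
    moreover have "sl_main \<kappa> \<mu> = cos (of_real pi * l)"
      using 2 by (simp add: sl_main_def cos_sol_def l_def[symmetric] mult.commute)
    ultimately show ?thesis unfolding l_def 2 using l(1) by (simp add: l_def)
  next
    case 3
    have "sin (of_real pi * (l - of_real \<kappa>)) = - sin (of_real pi * l)"
      using 3 by (simp add: right_diff_distrib sin_diff sin_of_real cos_of_real)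
    moreover have "sl_main \<kappa> \<mu> = sin (of_real pi * l) / l"
      using 3 assms(2) by (simp add: sl_main_def sin_sol_def l_def[symmetric] mult.commute)
    ultimately show ?thesis using 3 l(1) by (simp add: l_def norm_divide powr_minus_divide)
  qed
qed

text \<open>The circle meets the positive real axis at \<kappa> plus a half-integer, where the sine
  has modulus 1. If |Im l| < 1/4, then Re l is so close to that point that cos (2 x) <= 0 in
  \<open>sq\<close>; otherwise the exponential dominates the cosine.\<close>

lemma norm_sin_lower_bound:
  fixes l :: complex
  assumes l: "norm l = real N + \<kappa> - 1/2" "Re l \<ge> 0" and R: "real N + \<kappa> - 1/2 \<ge> 1/4"
  shows "norm (sin (of_real pi * (l - of_real \<kappa>))) \<ge> exp (\<bar>Im l\<bar> * pi) / 4"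
proof -
  define R where "R = real N + \<kappa> - 1/2"
  define y where "y = \<bar>Im l\<bar> * pi"
  define x where "x = pi * (Re l - \<kappa>)"
  have y0: "y \<ge> 0" by (simp add: y_def)
  have sq: "(norm (sin (of_real pi * (l - of_real \<kappa>))))\<^sup>2 = (exp (2 * y) + exp (- (2 * y)) - 2 * cos (2 * x)) / 4"
    unfolding norm_sin_squared
    by (cases "Im l \<ge> 0") (simp_all add: y_def x_def exp_minus abs_if mult_ac)
  have "exp (2 * y) / 16 \<le> (exp (2 * y) + exp (- (2 * y)) - 2 * cos (2 * x)) / 4"
  proof (cases "\<bar>Im l\<bar> \<ge> 1/4")
    case True
    have "3/4 \<le> \<bar>Im l\<bar> * pi" using mult_mono[OF True, of 3 pi] pi_gt3 by simp
    then have "3/2 \<le> 2 * y" by (simp add: y_def)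
    then have "exp (2 * y) \<ge> exp (3/2)" by simp
    moreover have "exp (3/2) = exp (1/2 :: real) ^ 3" by (simp flip: exp_of_nat_mult)
    moreover have "exp (1/2 :: real) ^ 3 \<ge> (3/2) ^ 3"
      using exp_ge_add_one_self[of "1/2::real"] by (intro power_mono) auto
    \<comment> \<open>8/3 is the least X with X / 16 <= (X - 2) / 4, and (3/2)^3 = 27/8 exceeds
      it.\<close>
    ultimately have "exp (2 * y) \<ge> 8/3" by (simp add: power3_eq_cube)
    moreover have "X / 16 \<le> (X + Y - 2 * c) / 4" if "8/3 \<le> X" "0 \<le> Y" "c \<le> 1" for X Y c :: real
      using that by (simp add: field_simps)
    ultimately show ?thesis using cos_le_one exp_ge_zero by blast
  next
    case False
    have n2: "(Re l)\<^sup>2 + (Im l)\<^sup>2 = R\<^sup>2" using l(1) by (metis R_def cmod_power2)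
    have "\<bar>Im l\<bar>\<^sup>2 \<le> (1/4)\<^sup>2" using False by (intro power_mono) auto
    then have im: "(Im l)\<^sup>2 \<le> 1/16" by (simp add: power2_eq_square)
    \<comment> \<open>(R - 1/4)^2 = R^2 - R/2 + 1/16 is at most R^2 - 1/16 precisely when R >=
      1/4.\<close>
    have "(R - 1/4)\<^sup>2 \<le> (Re l)\<^sup>2" using n2 im R by (simp add: R_def power2_eq_square algebra_simps)
    then have "R - 1/4 \<le> Re l" using l(2) by (rule power2_le_imp_le)
    moreover have "Re l \<le> R" using complex_Re_le_cmod[of l] l(1) by (simp add: R_def)
    ultimately have d: "0 \<le> R - Re l" "R - Re l \<le> 1/4" by auto
    have "2 * x = 2 * pi * real N - (pi + 2 * pi * (R - Re l))"
      by (simp add: x_def R_def algebra_simps)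
    moreover have "cos (2 * pi * real N) = 1" "sin (2 * pi * real N) = 0"
      using cos_2npi[of N] sin_2npi[of N] by (simp_all add: mult_ac)
    ultimately have "cos (2 * x) = cos (pi + 2 * pi * (R - Re l))"
      by (simp only: cos_diff)
    also have "\<dots> = - cos (2 * pi * (R - Re l))" by simp
    also have "\<dots> \<le> 0"
    proof -
      have "2 * pi * (R - Re l) \<le> 2 * pi * (1/4)" using d by (intro mult_left_mono) auto
      then have "cos (2 * pi * (R - Re l)) \<ge> 0" using d by (intro cos_ge_zero) (auto intro: order_trans[of _ 0])
      then show ?thesis by simp
    qed
    finally have "cos (2 * x) \<le> 0" .
    moreover have "X / 16 \<le> (X + Y - 2 * c) / 4" if "0 \<le> X" "0 \<le> Y" "c \<le> 0" for X Y c :: real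
      using that by (simp add: field_simps)
    ultimately show ?thesis using exp_ge_zero by blast
  qed
  then have "(exp y / 4)\<^sup>2 \<le> (norm (sin (of_real pi * (l - of_real \<kappa>))))\<^sup>2"
    unfolding sq by (simp add: power_divide exp_double)
  then show ?thesis unfolding y_def by (rule power2_le_imp_le) simp
qed

text \<open>\<open>csqrt\<close> has nonnegative real part, so of the solutions csqrt \<mu> = m +
  \<kappa> with integer m only those with a nonnegative right side remain. The point \<mu> = 0,
  outside the scope of \<open>norm_sl_main\<close>, is checked directly.\<close>

lemma sl_main_zeros:
  assumes \<kappa>: "\<kappa> \<in> {0, 1/2, 1}"
  shows "sl_main \<kappa> \<mu> = 0 \<longleftrightarrow> (\<exists>n::nat. \<mu> = of_real ((real n + \<kappa>)\<^sup>2))"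
proof (cases "\<mu> = 0")
  case True
  have "sl_main \<kappa> \<mu> = 0 \<longleftrightarrow> \<kappa> = 0" using True \<kappa> by (auto simp: sl_main_def sin_sol_def cos_sol_def)
  also have "\<dots> \<longleftrightarrow> (\<exists>n::nat. \<mu> = of_real ((real n + \<kappa>)\<^sup>2))"
  proof
    assume "\<exists>n::nat. \<mu> = of_real ((real n + \<kappa>)\<^sup>2)"
    then obtain n :: nat where "complex_of_real ((real n + \<kappa>)\<^sup>2) = 0" using True by metis
    then have "real n + \<kappa> = 0" unfolding of_real_eq_0_iff by simp
    then show "\<kappa> = 0" using \<kappa> by auto
  qed (use True in \<open>auto intro: exI[of _ 0]\<close>)
  finally show ?thesis .
next
  case False
  have "norm (csqrt \<mu>) > 0" using False by simp
  then have "sl_main \<kappa> \<mu> = 0 \<longleftrightarrow> sin (of_real pi * (csqrt \<mu> - of_real \<kappa>)) = 0"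
    using norm_sl_main[OF \<kappa> False] by (metis mult_eq_0_iff norm_eq_zero powr_eq_0_iff less_numeral_extra(3))
  also have "\<dots> \<longleftrightarrow> (\<exists>m::int. csqrt \<mu> = of_real (real_of_int m + \<kappa>))"
  proof -
    have "(of_real pi * (w - of_real \<kappa>) = complex_of_real (real_of_int m * pi)) \<longleftrightarrow> w = of_real (real_of_int m + \<kappa>)" for w m
    proof -
      have "(of_real pi * (w - of_real \<kappa>) = complex_of_real (real_of_int m * pi)) \<longleftrightarrow>
          of_real pi * (w - of_real \<kappa>) = of_real pi * complex_of_real (real_of_int m)"
        by (simp add: mult.commute)
      also have "\<dots> \<longleftrightarrow> w - of_real \<kappa> = complex_of_real (real_of_int m)"
        by (simp only: mult_cancel_left) simp
      also have "\<dots> \<longleftrightarrow> w = of_real (real_of_int m + \<kappa>)" by (simp add: diff_eq_eq)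
      finally show ?thesis .
    qed
    then show ?thesis by (simp add: sin_eq_0)
  qed
  also have "\<dots> \<longleftrightarrow> (\<exists>n::nat. \<mu> = of_real ((real n + \<kappa>)\<^sup>2))"
  proof
    assume "\<exists>m::int. csqrt \<mu> = of_real (real_of_int m + \<kappa>)"
    then obtain m :: int where m: "csqrt \<mu> = of_real (real_of_int m + \<kappa>)" by blast
    have "Re (csqrt \<mu>) \<ge> 0" using csqrt_principal[of \<mu>] by auto
    then have "real_of_int m + \<kappa> \<ge> 0" using m by simp
    moreover have "real_of_int m + \<kappa> \<noteq> 0"
    proof
      assume "real_of_int m + \<kappa> = 0"
      then have "csqrt \<mu> = 0" using m by (metis of_real_0)
      then show False using False by simp
    qed
    \<comment> \<open>Strictness of m + \<kappa> > 0 matters for \<kappa> = 1: it excludes m =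
      -1.\<close>
    ultimately have "real_of_int m > -1" using \<kappa> by auto
    then have "m \<ge> 0" by linarith
    then have "real (nat m) = real_of_int m" by simp
    moreover have "\<mu> = of_real ((real_of_int m + \<kappa>)\<^sup>2)"
      using csqrt_mult_self[of \<mu>] unfolding m by (metis of_real_mult power2_eq_square)
    ultimately show "\<exists>n::nat. \<mu> = of_real ((real n + \<kappa>)\<^sup>2)" by metis
  next
    assume "\<exists>n::nat. \<mu> = of_real ((real n + \<kappa>)\<^sup>2)"
    then obtain n :: nat where n: "\<mu> = of_real ((real n + \<kappa>)\<^sup>2)" by blast
    have "csqrt \<mu> = of_real (real n + \<kappa>)"
      unfolding n using \<kappa> by (subst of_real_power, intro csqrt_square) auto
    then show "\<exists>m::int. csqrt \<mu> = of_real (real_of_int m + \<kappa>)" by (intro exI[of _ "int n"]) simp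
  qed
  finally show ?thesis .
qed

text \<open>The square root of the radius lies midway between N - 1 + \<kappa> and N + \<kappa>, so
  exactly the zeros with n < N are enclosed.\<close>

lemma card_sl_main_zeros:
  assumes \<kappa>: "\<kappa> \<in> {0, 1/2, 1}" and N: "N \<ge> 1"
  shows "card {z. norm z < (real N + \<kappa> - 1/2)\<^sup>2 \<and> sl_main \<kappa> z = 0} = N"
proof -
  have \<kappa>0: "\<kappa> \<ge> 0" using \<kappa> by auto
  have iff: "(real n + \<kappa>)\<^sup>2 < (real N + \<kappa> - 1/2)\<^sup>2 \<longleftrightarrow> n < N" for n
  proof -
    have "(real n + \<kappa>)\<^sup>2 < (real N + \<kappa> - 1/2)\<^sup>2 \<longleftrightarrow> real n + \<kappa> < real N + \<kappa> - 1/2"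
      using \<kappa>0 N by (intro iffI power_strict_mono) (auto dest!: power_less_imp_less_base)
    also have "\<dots> \<longleftrightarrow> n < N" by linarith
    finally show ?thesis .
  qed
  have "{z. norm z < (real N + \<kappa> - 1/2)\<^sup>2 \<and> sl_main \<kappa> z = 0} = (\<lambda>n. complex_of_real ((real n + \<kappa>)\<^sup>2)) ` {..<N}"
  proof (intro subset_antisym subsetI)
    have nrm: "norm (complex_of_real ((real n + \<kappa>)\<^sup>2)) = (real n + \<kappa>)\<^sup>2" for n
      by (simp only: norm_of_real abs_power2)
    show "z \<in> (\<lambda>n. complex_of_real ((real n + \<kappa>)\<^sup>2)) ` {..<N}"
      if z: "z \<in> {z. norm z < (real N + \<kappa> - 1/2)\<^sup>2 \<and> sl_main \<kappa> z = 0}" for z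
    proof -
      obtain n :: nat where n: "z = of_real ((real n + \<kappa>)\<^sup>2)" using z sl_main_zeros[OF \<kappa>, of z] by blast
      then have "(real n + \<kappa>)\<^sup>2 < (real N + \<kappa> - 1/2)\<^sup>2" using z nrm[of n] by simp
      then show ?thesis using iff n by blast
    qed
    show "z \<in> {z. norm z < (real N + \<kappa> - 1/2)\<^sup>2 \<and> sl_main \<kappa> z = 0}"
      if z: "z \<in> (\<lambda>n. complex_of_real ((real n + \<kappa>)\<^sup>2)) ` {..<N}" for z
      using z sl_main_zeros[OF \<kappa>, of z] iff nrm by force
  qed
  moreover have "inj_on (\<lambda>n. complex_of_real ((real n + \<kappa>)\<^sup>2)) {..<N}"
    using \<kappa>0 by (intro inj_onI) (simp del: of_real_power of_real_add add: power2_eq_iff_nonneg)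
  ultimately show ?thesis by (simp add: card_image)
qed

lemma sl_main_holomorphic: "sl_main \<kappa> holomorphic_on S"
  and sl_main_simple: "sl_main \<kappa> (of_real t) = 0 \<Longrightarrow> deriv (sl_main \<kappa>) (of_real t) \<noteq> 0"
proof -
  have q: "(\<lambda>_. 0::real) absolutely_integrable_on {0..pi}" by simp
  obtain \<sigma> \<alpha> \<beta> where s: "\<sigma> \<noteq> 0" "\<And>\<mu>. sl_main \<kappa> \<mu> = \<sigma> * sl_char (\<lambda>_. 0) \<alpha> \<beta> \<mu>"
    using sl_main_eq_char by metis
  then have eq: "sl_main \<kappa> = (\<lambda>\<mu>. \<sigma> * sl_char (\<lambda>_. 0) \<alpha> \<beta> \<mu>)" by auto
  have h: "sl_char (\<lambda>_. 0) \<alpha> \<beta> holomorphic_on S" for S by (rule sl_char_holomorphic[OF q])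
  show "sl_main \<kappa> holomorphic_on S" unfolding eq by (intro holomorphic_intros h)
  show "deriv (sl_main \<kappa>) (of_real t) \<noteq> 0" if "sl_main \<kappa> (of_real t) = 0"
    using that sl_char_simple_zero[OF q, of \<alpha> \<beta> t] s h[of UNIV]
    unfolding eq by (subst deriv_cmult) (auto simp: holomorphic_on_def field_differentiable_at_within)
qed

text \<open>With |\<mu>| = R^2 the ratio of error to leading term is at most 4 C / (|c| R), which is
  below 1 for large R. Reality of the zeros enters through \<open>sl_char_simple_zero\<close>, which
  speaks of real points.\<close>

theorem sl_eigenvalue_count:
  assumes q: "q absolutely_integrable_on {0..pi}" and \<alpha>: "\<alpha> \<in> {0<..pi}" and \<beta>: "\<beta> \<in> {0..<pi}"
    and real: "\<And>z. sl_char q \<alpha> \<beta> z = 0 \<Longrightarrow> z \<in> \<real>"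
  defines "\<kappa> \<equiv> sl_kappa \<alpha> \<beta>"
  obtains N0 where "\<And>N. N \<ge> N0 \<Longrightarrow> card {z. norm z < (real N + \<kappa> - 1/2)\<^sup>2 \<and> sl_char q \<alpha> \<beta> z = 0} = N"
proof -
  have \<kappa>: "\<kappa> \<in> {0, 1/2, 1}" by (auto simp: \<kappa>_def sl_kappa_def)
  obtain c C K where c: "c \<noteq> 0" "C > 0" "K \<ge> 1"
    and as: "\<And>\<mu>. norm (csqrt \<mu>) \<ge> K \<Longrightarrow> norm (sl_char q \<alpha> \<beta> \<mu> - c * sl_main \<kappa> \<mu>) \<le>
        C * norm (csqrt \<mu>) powr (- 2 * \<kappa>) * exp (\<bar>Im (csqrt \<mu>)\<bar> * pi)"
    using sl_char_asymptotics[OF q \<alpha> \<beta>] unfolding \<kappa>_def by metis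
  \<comment> \<open>The 4 is the constant of \<open>norm_sin_lower_bound\<close>; the margin 2
    absorbs the - 1/2 in R.\<close>
  obtain N0 :: nat where N0: "real N0 \<ge> max K (4 * C / norm c) + 2" using real_arch_simple by blast
  have "card {z. norm z < (real N + \<kappa> - 1/2)\<^sup>2 \<and> sl_char q \<alpha> \<beta> z = 0} = N" if N: "N \<ge> N0" for N
  proof -
    define R where "R = real N + \<kappa> - 1/2"
    have R: "R \<ge> K" "R > 4 * C / norm c" "R \<ge> 1/4" "R > 0" using N N0 c \<kappa> by (auto simp: R_def)
    have N1: "N \<ge> 1" using N N0 c by linarith
    have "card {z. norm z < R\<^sup>2 \<and> c * sl_main \<kappa> z = 0} = card {z. norm z < R\<^sup>2 \<and> sl_char q \<alpha> \<beta> z = 0}"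
    proof (rule rouche_card_simple_zeros)
      show "(\<lambda>z. c * sl_main \<kappa> z) holomorphic_on UNIV" by (intro holomorphic_intros sl_main_holomorphic)
      show "sl_char q \<alpha> \<beta> holomorphic_on UNIV" by (rule sl_char_holomorphic[OF q])
      show "R\<^sup>2 > 0" using R by simp
      show "deriv (sl_char q \<alpha> \<beta>) z \<noteq> 0" if "sl_char q \<alpha> \<beta> z = 0" for z
        using real[OF that] that sl_char_simple_zero[OF q] by (auto elim!: Reals_cases)
      show "deriv (\<lambda>z. c * sl_main \<kappa> z) z \<noteq> 0" if "c * sl_main \<kappa> z = 0" for z
      proof -
        have z: "sl_main \<kappa> z = 0" using that c by simp
        then obtain t where "z = complex_of_real t" using sl_main_zeros[OF \<kappa>] by blast
        then show ?thesis using sl_main_simple[of \<kappa> t] z c sl_main_holomorphic[of \<kappa> UNIV]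
          by (subst deriv_cmult) (auto simp: holomorphic_on_def field_differentiable_at_within)
      qed
      fix z :: complex assume z: "norm z = R\<^sup>2"
      define l where "l = csqrt z"
      have nl: "norm l = R" using z R by (simp add: l_def)
      have z0: "z \<noteq> 0" using z R by auto
      have lRe: "Re l \<ge> 0" unfolding l_def using csqrt_principal[of z] by auto
      define E where "E = exp (\<bar>Im l\<bar> * pi)"
      have "norm (sl_char q \<alpha> \<beta> z - c * sl_main \<kappa> z) \<le> C * R powr (- 2 * \<kappa>) * E"
        using as[of z] nl R by (simp add: l_def E_def)
      also have "\<dots> < norm c * R / 4 * R powr (- 2 * \<kappa>) * E"
        using R c by (intro mult_strict_right_mono) (auto simp: E_def field_simps)
      also have "\<dots> = norm c * (R powr (1 - 2 * \<kappa>) * (E / 4))"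
        using R by (simp add: powr_diff powr_minus field_simps)
      also have "\<dots> \<le> norm c * (R powr (1 - 2 * \<kappa>) * norm (sin (of_real pi * (l - of_real \<kappa>))))"
        using norm_sin_lower_bound[of l N \<kappa>] nl lRe R by (intro mult_left_mono) (auto simp: R_def E_def)
      also have "\<dots> = norm (c * sl_main \<kappa> z)"
        using norm_sl_main[OF \<kappa> z0] nl by (simp add: norm_mult l_def)
      finally show "norm (sl_char q \<alpha> \<beta> z - c * sl_main \<kappa> z) < norm (c * sl_main \<kappa> z)" .
    qed
    then show ?thesis using card_sl_main_zeros[OF \<kappa> N1] c by (simp add: R_def)
  qed
  then show ?thesis by (rule that)
qed

section \<open>Eigenvalue asymptotics\<close>

lemma abs_sin_ge_half:
  fixes x :: real
  assumes "\<bar>x\<bar> \<le> pi / 2"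
  shows "\<bar>x\<bar> / 2 \<le> \<bar>sin x\<bar>"
proof -
  have "\<bar>sin x - (\<Sum>m<3. sin_coeff m * x ^ m)\<bar> \<le> inverse (fact 3) * \<bar>x\<bar> ^ 3"
    by (rule Maclaurin_sin_bound)
  then have "\<bar>sin x - x\<bar> \<le> \<bar>x\<bar> ^ 3 / 6"
    by (simp add: eval_nat_numeral sin_coeff_def lessThan_Suc)
  moreover have "\<bar>x\<bar> ^ 3 / 6 \<le> \<bar>x\<bar> / 2"
  proof -
    \<comment> \<open>Half of 3.2 is 1.6, and 1.6^2 = 2.56 < 3 is what the cubic Taylor remainder
      requires.\<close>
    have "pi \<le> 3.2" by (rule order_trans[OF pi_approx(2)]) simp
    then have "\<bar>x\<bar> \<le> 1.6" using assms by simp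
    then have "\<bar>x\<bar>\<^sup>2 \<le> 1.6\<^sup>2" by (intro power_mono) auto
    then have "\<bar>x\<bar> * \<bar>x\<bar>\<^sup>2 \<le> \<bar>x\<bar> * 3" by (intro mult_left_mono) (auto simp: power2_eq_square)
    then show ?thesis by (simp add: power3_eq_cube power2_eq_square)
  qed
  ultimately show ?thesis by linarith
qed

text \<open>Counting fixes the index: exactly N terms of the increasing sequence lie in the disc, so
  \<mu> n is below the N-th radius iff n < N, and sqrt (\<mu> n) is within 1/2 of n + \<kappa>. As
  the characteristic function vanishes at \<mu> n, the leading term there is no larger than the
  error; near its zero the sine is bounded below by a linear function, which turns this into a bound
  for the deviation.\<close>

theorem sl_eigenvalue_asymptotics:
  assumes q: "q absolutely_integrable_on {0..pi}" and \<alpha>: "\<alpha> \<in> {0<..pi}" and \<beta>: "\<beta> \<in> {0..<pi}"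
    and \<mu>: "sl_eigenvalue_enumeration q \<alpha> \<beta> \<mu>"
  defines "\<kappa> \<equiv> sl_kappa \<alpha> \<beta>"
  obtains N B where "\<And>n. n \<ge> N \<Longrightarrow> \<mu> n > 0 \<and> \<bar>sqrt (\<mu> n) - (real n + \<kappa>)\<bar> \<le> B / (real n + 1)"
proof -
  have \<kappa>: "\<kappa> \<in> {0, 1/2, 1}" by (auto simp: \<kappa>_def sl_kappa_def)
  have mono: "strict_mono \<mu>" and rng: "{z. sl_char q \<alpha> \<beta> z = 0} = range (\<lambda>n. complex_of_real (\<mu> n))"
    using \<mu> unfolding sl_eigenvalue_enumeration_def sl_eigenvalue_iff_char[OF q] by auto
  have real: "z \<in> \<real>" if "sl_char q \<alpha> \<beta> z = 0" for z
  proof -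
    have "z \<in> {z. sl_char q \<alpha> \<beta> z = 0}" using that by simp
    then show ?thesis unfolding rng by auto
  qed
  obtain N0 where N0: "\<And>N. N \<ge> N0 \<Longrightarrow> card {z. norm z < (real N + \<kappa> - 1/2)\<^sup>2 \<and> sl_char q \<alpha> \<beta> z = 0} = N"
    using sl_eigenvalue_count[OF q \<alpha> \<beta> real] unfolding \<kappa>_def by metis
  obtain c C K where c: "c \<noteq> 0" "C > 0" "K \<ge> 1"
    and as: "\<And>\<mu>. norm (csqrt \<mu>) \<ge> K \<Longrightarrow> norm (sl_char q \<alpha> \<beta> \<mu> - c * sl_main \<kappa> \<mu>) \<le>
        C * norm (csqrt \<mu>) powr (- 2 * \<kappa>) * exp (\<bar>Im (csqrt \<mu>)\<bar> * pi)"
    using sl_char_asymptotics[OF q \<alpha> \<beta>] unfolding \<kappa>_def by metis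
  \<comment> \<open>|\<mu> 0| is included so that the disc reaches below the least eigenvalue; lying
    in the disc is then a one-sided condition.\<close>
  obtain N1 :: nat where N1: "real N1 \<ge> real N0 + K + \<bar>\<mu> 0\<bar> + 2" using real_arch_simple by blast
  have iff: "\<mu> n < (real N + \<kappa> - 1/2)\<^sup>2 \<longleftrightarrow> n < N" if N: "N \<ge> N1" for n N
  proof -
    define R where "R = real N + \<kappa> - 1/2"
    have "R \<ge> 1" "R > \<bar>\<mu> 0\<bar>" using N N1 c \<kappa> by (auto simp: R_def)
    then have R: "R\<^sup>2 > \<bar>\<mu> 0\<bar>" using self_le_power[of R 2] by auto
    have abs: "\<bar>\<mu> n\<bar> < R\<^sup>2 \<longleftrightarrow> \<mu> n < R\<^sup>2" for n
    proof -
      have "\<mu> 0 \<le> \<mu> n" using mono by (simp add: strict_mono_less_eq)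
      then show ?thesis using R by auto
    qed
    have "{z. norm z < R\<^sup>2 \<and> sl_char q \<alpha> \<beta> z = 0} = {z \<in> range (\<lambda>n. complex_of_real (\<mu> n)). norm z < R\<^sup>2}"
      using rng by auto
    also have "\<dots> = (\<lambda>n. complex_of_real (\<mu> n)) ` {n. \<mu> n < R\<^sup>2}" using abs by auto
    finally have "card ((\<lambda>n. complex_of_real (\<mu> n)) ` {n. \<mu> n < R\<^sup>2}) = N"
      using N0[of N] N N1 c by (simp add: R_def)
    moreover have "inj_on (\<lambda>n. complex_of_real (\<mu> n)) {n. \<mu> n < R\<^sup>2}"
      using strict_mono_eq[OF mono] by (auto intro!: inj_onI)
    ultimately have card: "card {n. \<mu> n < R\<^sup>2} = N" by (simp add: card_image)
    have "{n. \<mu> n < R\<^sup>2} = {..<N}"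
    proof -
      have fin: "finite {n. \<mu> n < R\<^sup>2}" using card N N1 c by (intro card_ge_0_finite) linarith
      have "{..n} \<subseteq> {n. \<mu> n < R\<^sup>2}" if "\<mu> n < R\<^sup>2" for n
        using that strict_mono_less_eq[OF mono] by (auto intro: le_less_trans)
      then have "Suc n \<le> N" if "\<mu> n < R\<^sup>2" for n
        using card_mono[OF fin, of "{..n}"] that card by auto
      then have "{n. \<mu> n < R\<^sup>2} \<subseteq> {..<N}" by (auto simp: Suc_le_eq)
      then show ?thesis using card by (intro card_subset_eq) auto
    qed
    then show ?thesis by (auto simp: R_def)
  qed
  have "\<mu> n > 0 \<and> \<bar>sqrt (\<mu> n) - (real n + \<kappa>)\<bar> \<le> (4 * C / norm c) / (real n + 1)" if n: "n \<ge> N1" for n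
  proof -
    define l where "l = sqrt (\<mu> n)"
    define R where "R = real n + \<kappa> - 1/2"
    \<comment> \<open>R >= n - 1/2 >= (n + 1) / 4 for n >= 1, which trades R for n + 1 in the final
      bound.\<close>
    have R: "R \<ge> K" "R \<ge> 1" "R \<ge> (real n + 1) / 4" using n N1 c \<kappa> by (auto simp: R_def)
    have lo: "R\<^sup>2 \<le> \<mu> n" using iff[OF n, of n] by (simp add: R_def)
    have hi: "\<mu> n < (R + 1)\<^sup>2" using iff[of "Suc n" n] n by (simp add: R_def algebra_simps)
    have pos: "\<mu> n > 0" using lo R by (smt (verit) zero_less_power2)
    have l: "R \<le> l" "l < R + 1" "l > 0"
      using lo hi R pos real_le_rsqrt[of R "\<mu> n"] real_sqrt_less_mono[of "\<mu> n" "(R + 1)\<^sup>2"] by (auto simp: l_def)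
    have cl: "csqrt (of_real (\<mu> n)) = of_real l" using pos by (simp add: l_def csqrt_of_real)
    have "sl_char q \<alpha> \<beta> (of_real (\<mu> n)) = 0" using rng by auto
    then have "norm c * norm (sl_main \<kappa> (of_real (\<mu> n))) \<le> C * l powr (- 2 * \<kappa>)"
      using as[of "of_real (\<mu> n)"] cl l R by (simp add: norm_mult)
    then have "norm c * (l powr (1 - 2 * \<kappa>) * \<bar>sin (pi * (l - \<kappa>))\<bar>) \<le> C * l powr (- 2 * \<kappa>)"
      using norm_sl_main[OF \<kappa>, of "of_real (\<mu> n)"] cl l pos
      by (simp add: sin_of_real flip: of_real_diff of_real_mult)
    also have "l powr (1 - 2 * \<kappa>) = l * l powr (- 2 * \<kappa>)" using l by (simp add: powr_diff powr_minus field_simps)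
    finally have "(norm c * l * \<bar>sin (pi * (l - \<kappa>))\<bar>) * l powr (- 2 * \<kappa>) \<le> C * l powr (- 2 * \<kappa>)"
      by (simp add: mult_ac)
    then have s1: "norm c * l * \<bar>sin (pi * (l - \<kappa>))\<bar> \<le> C" using l by simp
    define d where "d = l - (real n + \<kappa>)"
    have d: "\<bar>d\<bar> \<le> 1/2" using l(1,2) unfolding d_def R_def by linarith
    have "pi * (l - \<kappa>) = pi * d + pi * real n" by (simp add: d_def algebra_simps)
    then have "\<bar>sin (pi * (l - \<kappa>))\<bar> = \<bar>sin (pi * d)\<bar>"
      by (simp add: sin_add cos_npi sin_npi abs_mult mult.commute)
    moreover have "\<bar>pi * d\<bar> / 2 \<le> \<bar>sin (pi * d)\<bar>"
      using d by (intro abs_sin_ge_half) (simp add: abs_mult)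
    moreover have "\<bar>d\<bar> \<le> \<bar>pi * d\<bar> / 2" using mult_right_mono[of 2 pi "\<bar>d\<bar>"] pi_ge_two by (simp add: abs_mult)
    ultimately have s2: "\<bar>d\<bar> \<le> \<bar>sin (pi * (l - \<kappa>))\<bar>" by linarith
    have "norm c * ((real n + 1) / 4) * \<bar>d\<bar> \<le> norm c * l * \<bar>sin (pi * (l - \<kappa>))\<bar>"
      using s2 R l by (intro mult_mono) auto
    then have "norm c * ((real n + 1) / 4) * \<bar>d\<bar> \<le> C" using s1 by linarith
    moreover have "norm c * ((real n + 1) / 4) > 0" using c by simp
    ultimately have "\<bar>d\<bar> \<le> C / (norm c * ((real n + 1) / 4))" by (simp only: pos_le_divide_eq mult.commute)
    also have "\<dots> = (4 * C / norm c) / (real n + 1)" by simp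
    finally have "\<bar>d\<bar> \<le> (4 * C / norm c) / (real n + 1)" .
    then show ?thesis using pos by (simp add: d_def l_def)
  qed
  then show ?thesis by (rule that)
qed

subsection \<open>Square-integrable functions\<close>

lemma L2_funD: "L2_fun M f \<Longrightarrow> f \<in> borel_measurable M" "L2_fun M f \<Longrightarrow> integrable M (\<lambda>x. (cmod (f x))\<^sup>2)"
  by (auto simp: L2_fun_def)

lemma L2_norm_power2: "(L2_norm M f)\<^sup>2 = (LINT x|M. (cmod (f x))\<^sup>2)"
  by (simp add: L2_norm_def)

lemma L2_norm_nonneg [simp]: "L2_norm M f \<ge> 0"
  by (simp add: L2_norm_def)

lemma L2_fun_dominated:
  assumes "f \<in> borel_measurable M" "integrable M (\<lambda>x. (g x)\<^sup>2)" "AE x in M. cmod (f x) \<le> g x"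
  shows "L2_fun M f"
  unfolding L2_fun_def
proof (intro conjI assms(1))
  have "AE x in M. norm ((cmod (f x))\<^sup>2) \<le> norm ((g x)\<^sup>2)"
    using assms(3) by eventually_elim (simp add: power_mono)
  then show "integrable M (\<lambda>x. (cmod (f x))\<^sup>2)"
    using assms by (intro Bochner_Integration.integrable_bound[OF assms(2)]) auto
qed

lemma L2_fun_cmult:
  assumes "L2_fun M f" shows "L2_fun M (\<lambda>x. c * f x)" "L2_norm M (\<lambda>x. c * f x) = cmod c * L2_norm M f"
  using assms by (auto simp: L2_fun_def norm_mult power_mult_distrib L2_norm_def real_sqrt_mult)

lemma L2_fun_add:
  assumes "L2_fun M f" "L2_fun M g" shows "L2_fun M (\<lambda>x. f x + g x)"
  unfolding L2_fun_def
proof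
  show "(\<lambda>x. f x + g x) \<in> borel_measurable M" by (intro borel_measurable_add L2_funD(1) assms)
  have i: "integrable M (\<lambda>x. 2 * (cmod (f x))\<^sup>2 + 2 * (cmod (g x))\<^sup>2)"
    by (intro Bochner_Integration.integrable_add integrable_mult_right L2_funD assms)
  show "integrable M (\<lambda>x. (cmod (f x + g x))\<^sup>2)"
  proof (rule Bochner_Integration.integrable_bound[OF i])
    show "AE x in M. norm ((cmod (f x + g x))\<^sup>2) \<le> norm (2 * (cmod (f x))\<^sup>2 + 2 * (cmod (g x))\<^sup>2)"
    proof (rule AE_I2)
      fix x
      have "(cmod (f x + g x))\<^sup>2 \<le> (cmod (f x) + cmod (g x))\<^sup>2" by (intro power_mono norm_triangle_ineq) auto
      also have "\<dots> \<le> 2 * (cmod (f x))\<^sup>2 + 2 * (cmod (g x))\<^sup>2"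
        using sum_squares_bound[of "cmod (f x)" "cmod (g x)"] by (simp add: power2_sum)
      finally show "norm ((cmod (f x + g x))\<^sup>2) \<le> norm (2 * (cmod (f x))\<^sup>2 + 2 * (cmod (g x))\<^sup>2)" by simp
    qed
    show "(\<lambda>x. (cmod (f x + g x))\<^sup>2) \<in> borel_measurable M"
      by (intro borel_measurable_power borel_measurable_norm[THEN measurable_compose[rotated]] borel_measurable_add L2_funD(1) assms)
  qed
qed

lemma L2_fun_diff:
  assumes "L2_fun M f" "L2_fun M g" shows "L2_fun M (\<lambda>x. f x - g x)"
  using L2_fun_add[OF assms(1) L2_fun_cmult(1)[OF assms(2), of "-1"]] by simp

lemma L2_fun_zero [simp]: "L2_fun M (\<lambda>x. 0)" by (simp add: L2_fun_def)

lemma L2_fun_sum: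
  "(\<And>j. j \<in> F \<Longrightarrow> L2_fun M (f j)) \<Longrightarrow> L2_fun M (\<lambda>x. \<Sum>j\<in>F. f j x)"
  by (induction F rule: infinite_finite_induct) (auto intro: L2_fun_add)

lemma L2_mult_integrable:
  assumes "L2_fun M f" "L2_fun M g" shows "integrable M (\<lambda>x. f x * cnj (g x))"
proof (rule Bochner_Integration.integrable_bound[of _ "\<lambda>x. (cmod (f x))\<^sup>2 + (cmod (g x))\<^sup>2"])
  show "AE x in M. norm (f x * cnj (g x)) \<le> norm ((cmod (f x))\<^sup>2 + (cmod (g x))\<^sup>2)"
  proof (rule AE_I2)
    fix x
    show "norm (f x * cnj (g x)) \<le> norm ((cmod (f x))\<^sup>2 + (cmod (g x))\<^sup>2)"
      using sum_squares_bound[of "cmod (f x)" "cmod (g x)"] zero_le_power2[of "cmod (f x)"] zero_le_power2[of "cmod (g x)"]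
        mult_nonneg_nonneg[of "cmod (f x)" "cmod (g x)", OF norm_ge_zero norm_ge_zero]
      unfolding norm_mult complex_mod_cnj real_norm_def by linarith
  qed
  show "(\<lambda>x. f x * cnj (g x)) \<in> borel_measurable M"
    by (intro borel_measurable_times measurable_compose[OF L2_funD(1)[OF assms(2)]] borel_measurable_continuous_onI
        continuous_intros L2_funD(1) assms)
  show "integrable M (\<lambda>x. (cmod (f x))\<^sup>2 + (cmod (g x))\<^sup>2)"
    by (intro Bochner_Integration.integrable_add L2_funD assms)
qed

lemma L2_inner_add_left: "L2_fun M f \<Longrightarrow> L2_fun M g \<Longrightarrow> L2_fun M h \<Longrightarrow>
    L2_inner M (\<lambda>x. f x + g x) h = L2_inner M f h + L2_inner M g h"
  unfolding L2_inner_def by (simp add: distrib_right L2_mult_integrable)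

lemma L2_inner_diff_left: "L2_fun M f \<Longrightarrow> L2_fun M g \<Longrightarrow> L2_fun M h \<Longrightarrow>
    L2_inner M (\<lambda>x. f x - g x) h = L2_inner M f h - L2_inner M g h"
  unfolding L2_inner_def by (simp add: left_diff_distrib L2_mult_integrable)

lemma L2_inner_cmult_left: "L2_inner M (\<lambda>x. c * f x) h = c * L2_inner M f h"
  unfolding L2_inner_def by (simp add: mult.assoc)

lemma L2_inner_sum_left: "(\<And>j. j \<in> F \<Longrightarrow> L2_fun M (f j)) \<Longrightarrow> L2_fun M h \<Longrightarrow>
    L2_inner M (\<lambda>x. \<Sum>j\<in>F. f j x) h = (\<Sum>j\<in>F. L2_inner M (f j) h)"
  by (induction F rule: infinite_finite_induct) (auto simp: L2_inner_add_left L2_fun_sum L2_inner_def[of M "\<lambda>x. 0"])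

lemma L2_inner_commute: "L2_inner M g f = cnj (L2_inner M f g)"
  unfolding L2_inner_def by (subst Bochner_Integration.integral_cnj[symmetric]) (simp add: mult.commute)

lemma L2_inner_self: "L2_inner M f f = of_real ((L2_norm M f)\<^sup>2)"
proof -
  have "(\<lambda>x. f x * cnj (f x)) = (\<lambda>x. complex_of_real ((cmod (f x))\<^sup>2))"
    by (simp add: complex_norm_square fun_eq_iff del: of_real_power)
  then show ?thesis unfolding L2_inner_def L2_norm_power2 by (simp only: integral_complex_of_real)
qed

lemma L2_norm_diff_power2:
  assumes "L2_fun M f" "L2_fun M g"
  shows "(L2_norm M (\<lambda>x. f x - g x))\<^sup>2 = (L2_norm M f)\<^sup>2 - 2 * Re (L2_inner M f g) + (L2_norm M g)\<^sup>2"
proof -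
  note d = L2_fun_diff[OF assms]
  have "L2_inner M (\<lambda>x. f x - g x) (\<lambda>x. f x - g x) = L2_inner M f (\<lambda>x. f x - g x) - L2_inner M g (\<lambda>x. f x - g x)"
    by (rule L2_inner_diff_left[OF assms d])
  also have "\<dots> = cnj (L2_inner M (\<lambda>x. f x - g x) f) - cnj (L2_inner M (\<lambda>x. f x - g x) g)"
    by (simp add: L2_inner_commute[of M "\<lambda>x. f x - g x"])
  also have "\<dots> = L2_inner M f f - cnj (L2_inner M g f) - cnj (L2_inner M f g) + L2_inner M g g"
    using assms by (simp add: L2_inner_diff_left L2_inner_self)
  also have "cnj (L2_inner M g f) = L2_inner M f g" by (simp add: L2_inner_commute[of M g])
  finally have "complex_of_real ((L2_norm M (\<lambda>x. f x - g x))\<^sup>2) =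
     of_real ((L2_norm M f)\<^sup>2) - (L2_inner M f g + cnj (L2_inner M f g)) + of_real ((L2_norm M g)\<^sup>2)"
    by (simp add: L2_inner_self)
  then have "complex_of_real ((L2_norm M (\<lambda>x. f x - g x))\<^sup>2) =
     of_real ((L2_norm M f)\<^sup>2 - 2 * Re (L2_inner M f g) + (L2_norm M g)\<^sup>2)"
    by (simp only: complex_add_cnj of_real_diff of_real_add)
  then show ?thesis unfolding of_real_eq_iff .
qed

text \<open>Expanding the norm of t f - g with t = r cnj c gives a quadratic inequality in the real
  number r. The value r = 1 / a^2 yields the claim; if a = 0, a large r forces c = 0.\<close>

lemma L2_cauchy_schwarz:
  assumes f: "L2_fun M f" and g: "L2_fun M g"
  shows "cmod (L2_inner M f g) \<le> L2_norm M f * L2_norm M g"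
proof -
  define a b c where "a = L2_norm M f" and "b = L2_norm M g" and "c = L2_inner M f g"
  have *: "2 * Re (t * c) \<le> (cmod t)\<^sup>2 * a\<^sup>2 + b\<^sup>2" for t
    using zero_le_power2[of "L2_norm M (\<lambda>x. t * f x - g x)"] L2_norm_diff_power2[OF L2_fun_cmult(1)[OF f, of t] g] f
    by (simp add: a_def b_def c_def L2_inner_cmult_left L2_fun_cmult(2) power_mult_distrib)
  have **: "2 * r * (cmod c)\<^sup>2 \<le> r\<^sup>2 * (cmod c)\<^sup>2 * a\<^sup>2 + b\<^sup>2" for r :: real
  proof -
    have "of_real r * cnj c * c = of_real (r * (cmod c)\<^sup>2)"
      by (simp only: of_real_mult complex_norm_square mult_ac)
    then have "Re (of_real r * cnj c * c) = r * (cmod c)\<^sup>2" by (simp only: Re_complex_of_real)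
    then show ?thesis using *[of "of_real r * cnj c"] by (simp add: norm_mult power_mult_distrib)
  qed
  have "a \<ge> 0" "b \<ge> 0" by (auto simp: a_def b_def)
  show ?thesis
  proof (cases "a = 0")
    case True
    have "cmod c = 0"
    proof (rule ccontr)
      assume "cmod c \<noteq> 0"
      then have "2 * ((b\<^sup>2 + 1) / (cmod c)\<^sup>2) * (cmod c)\<^sup>2 \<le> b\<^sup>2" using **[of "(b\<^sup>2 + 1) / (cmod c)\<^sup>2"] True by simp
      then have "2 * (b\<^sup>2 + 1) \<le> b\<^sup>2" using \<open>cmod c \<noteq> 0\<close> by simp
      then have "b\<^sup>2 + b\<^sup>2 + 2 \<le> b\<^sup>2" by (simp add: algebra_simps)
      then show False using zero_le_power2[of b] by linarith
    qed
    then show ?thesis by (simp add: c_def)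
  next
    case False
    have "2 * (1 / a\<^sup>2) * (cmod c)\<^sup>2 \<le> (1 / a\<^sup>2)\<^sup>2 * (cmod c)\<^sup>2 * a\<^sup>2 + b\<^sup>2" by (rule **)
    also have "(1 / a\<^sup>2)\<^sup>2 * (cmod c)\<^sup>2 * a\<^sup>2 = (1 / a\<^sup>2) * (cmod c)\<^sup>2" using False by (simp add: power2_eq_square)
    finally have "(1 / a\<^sup>2) * (cmod c)\<^sup>2 \<le> b\<^sup>2" by linarith
    then have "a\<^sup>2 * ((1 / a\<^sup>2) * (cmod c)\<^sup>2) \<le> a\<^sup>2 * b\<^sup>2" by (rule mult_left_mono) simp
    then have "(cmod c)\<^sup>2 \<le> (a * b)\<^sup>2" using False by (simp add: power_mult_distrib)
    then show ?thesis unfolding a_def[symmetric] b_def[symmetric] c_def[symmetric]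
      using \<open>a \<ge> 0\<close> \<open>b \<ge> 0\<close> by - (rule power2_le_imp_le, auto)
  qed
qed

lemma L2_norm_triangle:
  assumes f: "L2_fun M f" and g: "L2_fun M g"
  shows "L2_norm M (\<lambda>x. f x + g x) \<le> L2_norm M f + L2_norm M g"
proof (rule power2_le_imp_le)
  have "(L2_norm M (\<lambda>x. f x - (-1) * g x))\<^sup>2 = (L2_norm M f)\<^sup>2 - 2 * Re (L2_inner M f (\<lambda>x. (-1) * g x)) + (L2_norm M (\<lambda>x. (-1) * g x))\<^sup>2"
    by (rule L2_norm_diff_power2[OF f L2_fun_cmult(1)[OF g]])
  also have "\<dots> \<le> (L2_norm M f)\<^sup>2 + 2 * (L2_norm M f * L2_norm M g) + (L2_norm M g)\<^sup>2"
    using L2_cauchy_schwarz[OF f L2_fun_cmult(1)[OF g, of "-1"]] abs_Re_le_cmod[of "L2_inner M f (\<lambda>x. (-1) * g x)"]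
      L2_fun_cmult(2)[OF g, of "-1"] by simp
  finally show "(L2_norm M (\<lambda>x. f x + g x))\<^sup>2 \<le> (L2_norm M f + L2_norm M g)\<^sup>2"
    by (simp add: power2_sum algebra_simps)
qed simp

lemma L2_norm_triangle_diff:
  assumes "L2_fun M f" "L2_fun M g" "L2_fun M h"
  shows "L2_norm M (\<lambda>x. f x - h x) \<le> L2_norm M (\<lambda>x. f x - g x) + L2_norm M (\<lambda>x. g x - h x)"
  using L2_norm_triangle[OF L2_fun_diff[OF assms(1,2)] L2_fun_diff[OF assms(2,3)]] by simp

lemma L2_norm_AE_cong:
  assumes "AE x in M. f x = g x" "f \<in> borel_measurable M" "g \<in> borel_measurable M"
  shows "L2_norm M f = L2_norm M g"
proof -
  have "(LINT x|M. (cmod (f x))\<^sup>2) = (LINT x|M. (cmod (g x))\<^sup>2)"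
    using assms by (intro integral_cong_AE) auto
  then show ?thesis by (simp add: L2_norm_def)
qed

lemma L2_inner_AE_cong:
  assumes "AE x in M. f x = g x" "L2_fun M f" "L2_fun M g" "L2_fun M h"
  shows "L2_inner M f h = L2_inner M g h"
  unfolding L2_inner_def using assms
  by (intro integral_cong_AE) (auto intro: borel_measurable_integrable[OF L2_mult_integrable])

lemma L2_norm_eq_0_iff:
  assumes "L2_fun M f" shows "L2_norm M f = 0 \<longleftrightarrow> (AE x in M. f x = 0)"
  using integral_nonneg_eq_0_iff_AE[OF L2_funD(2)[OF assms]] by (simp add: L2_norm_def)

lemma L2_norm_mono:
  assumes "L2_fun M f" "L2_fun M g" "AE x in M. cmod (f x) \<le> cmod (g x)"
  shows "L2_norm M f \<le> L2_norm M g"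
  unfolding L2_norm_def
  using assms by (intro real_sqrt_le_mono integral_mono_AE) (auto dest: L2_funD intro: power_mono elim: AE_mp)

text \<open>For the orthogonal projection g of f onto the span, both the inner product of f with g
  and the squared norm of g equal the sum s of the squared coefficients, so f - g has squared norm
  |f|^2 - s.\<close>

lemma L2_bessel:
  assumes J: "finite F" "\<And>j. j \<in> F \<Longrightarrow> L2_fun M (e j)"
    and on: "\<And>i j. i \<in> F \<Longrightarrow> j \<in> F \<Longrightarrow> L2_inner M (e i) (e j) = (if i = j then 1 else 0)"
    and f: "L2_fun M f"
  shows "(\<Sum>j\<in>F. (cmod (L2_inner M f (e j)))\<^sup>2) \<le> (L2_norm M f)\<^sup>2"
    and "(L2_norm M (\<lambda>x. f x - (\<Sum>j\<in>F. L2_inner M f (e j) * e j x)))\<^sup>2 =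
       (L2_norm M f)\<^sup>2 - (\<Sum>j\<in>F. (cmod (L2_inner M f (e j)))\<^sup>2)"
proof -
  define g where "g x = (\<Sum>j\<in>F. L2_inner M f (e j) * e j x)" for x
  have gL: "L2_fun M g" unfolding g_def[abs_def] using J by (intro L2_fun_sum L2_fun_cmult)
  have ge: "L2_inner M g (e i) = L2_inner M f (e i)" if "i \<in> F" for i
  proof -
    have "L2_inner M g (e i) = (\<Sum>j\<in>F. L2_inner M f (e j) * L2_inner M (e j) (e i))"
      unfolding g_def[abs_def] using J that
      by (subst L2_inner_sum_left) (auto intro: L2_fun_cmult simp: L2_inner_cmult_left)
    also have "\<dots> = (\<Sum>j\<in>F. if j = i then L2_inner M f (e j) else 0)"
      using on that by (intro sum.cong) auto
    finally show ?thesis using J that by simp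
  qed
  have gh: "L2_inner M h g = (\<Sum>j\<in>F. cnj (L2_inner M f (e j)) * L2_inner M h (e j))" if "L2_fun M h" for h
  proof -
    have "L2_inner M h g = cnj (L2_inner M g h)" by (rule L2_inner_commute)
    also have "L2_inner M g h = (\<Sum>j\<in>F. L2_inner M f (e j) * L2_inner M (e j) h)"
      unfolding g_def[abs_def] using J that
      by (subst L2_inner_sum_left) (auto intro: L2_fun_cmult simp: L2_inner_cmult_left)
    finally show ?thesis by (simp add: L2_inner_commute[of M h])
  qed
  define s where "s = (\<Sum>j\<in>F. (cmod (L2_inner M f (e j)))\<^sup>2)"
  have cm: "cnj z * z = of_real ((cmod z)\<^sup>2)" for z by (simp add: complex_norm_square mult.commute del: of_real_power)
  have fg: "L2_inner M f g = of_real s" by (simp add: gh[OF f] cm s_def)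
  have "L2_inner M g g = of_real s" by (simp add: gh[OF gL] ge cm s_def)
  then have gg: "(L2_norm M g)\<^sup>2 = s" unfolding L2_inner_self of_real_eq_iff .
  have main: "(L2_norm M (\<lambda>x. f x - g x))\<^sup>2 = (L2_norm M f)\<^sup>2 - s"
    using L2_norm_diff_power2[OF f gL] fg gg by simp
  then show "(L2_norm M (\<lambda>x. f x - (\<Sum>j\<in>F. L2_inner M f (e j) * e j x)))\<^sup>2 =
       (L2_norm M f)\<^sup>2 - (\<Sum>j\<in>F. (cmod (L2_inner M f (e j)))\<^sup>2)"
    by (simp add: g_def s_def)
  show "(\<Sum>j\<in>F. (cmod (L2_inner M f (e j)))\<^sup>2) \<le> (L2_norm M f)\<^sup>2"
    using main zero_le_power2[of "L2_norm M (\<lambda>x. f x - g x)"] by (simp add: s_def)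
qed

text \<open>If f is orthogonal to all e j, every finite combination of them is at least as far from
  f as 0 is; density then forces the norm of f to vanish.\<close>

lemma orthonormal_basis_total:
  assumes e: "orthonormal_basis_L2 M J e" and f: "L2_fun M f" and z: "\<And>j. j \<in> J \<Longrightarrow> L2_inner M f (e j) = 0"
  shows "AE x in M. f x = 0"
proof -
  have eL: "\<And>j. j \<in> J \<Longrightarrow> L2_fun M (e j)" using e by (auto simp: orthonormal_basis_L2_def)
  have "L2_norm M f \<le> \<epsilon>" if eps: "\<epsilon> > 0" for \<epsilon>
  proof -
    have "\<forall>f. L2_fun M f \<longrightarrow> (\<forall>\<epsilon>>0. \<exists>F c. finite F \<and> F \<subseteq> J \<and>
        L2_norm M (\<lambda>x. f x - (\<Sum>j\<in>F. c j * e j x)) < \<epsilon>)"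
      using e unfolding orthonormal_basis_L2_def by (elim conjE)
    from this[rule_format, OF f eps]
    obtain F c where "finite F \<and> F \<subseteq> J \<and> L2_norm M (\<lambda>x. f x - (\<Sum>j\<in>F. c j * e j x)) < \<epsilon>"
      by (elim exE)
    then have F: "finite F" "F \<subseteq> J" "L2_norm M (\<lambda>x. f x - (\<Sum>j\<in>F. c j * e j x)) < \<epsilon>" by auto
    define g where "g x = (\<Sum>j\<in>F. c j * e j x)" for x
    have gL: "L2_fun M g" unfolding g_def[abs_def] using F eL by (intro L2_fun_sum L2_fun_cmult) auto
    have "L2_inner M g f = (\<Sum>j\<in>F. c j * L2_inner M (e j) f)"
      unfolding g_def[abs_def] using F eL f
      by (subst L2_inner_sum_left) (auto intro!: L2_fun_cmult simp: L2_inner_cmult_left)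
    also have "\<dots> = 0"
      using F z by (intro sum.neutral) (auto simp: L2_inner_commute[of M _ f])
    finally have "L2_inner M f g = 0" by (simp add: L2_inner_commute[of M f])
    then have "(L2_norm M f)\<^sup>2 \<le> (L2_norm M (\<lambda>x. f x - g x))\<^sup>2"
      using L2_norm_diff_power2[OF f gL] by simp
    then have "L2_norm M f \<le> L2_norm M (\<lambda>x. f x - g x)" by (rule power2_le_imp_le) simp
    then show ?thesis using F by (simp add: g_def[abs_def])
  qed
  then have "L2_norm M f = 0"
    using L2_norm_nonneg[of M f] by (metis dense_ge dual_order.antisym)
  then show ?thesis using L2_norm_eq_0_iff[OF f] by simp
qed

subsection \<open>Density in the space of square-integrable functions on an interval\<close>

abbreviation LP :: "real measure" where "LP \<equiv> lebesgue_on {0..pi}"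

lemma L2_bounded:
  assumes f: "f \<in> borel_measurable LP" and b: "\<And>x. x \<in> {0..pi} \<Longrightarrow> cmod (f x) \<le> B"
  shows "L2_fun LP f" "L2_norm LP f \<le> sqrt pi * B"
proof -
  have B: "B \<ge> 0" using order_trans[OF norm_ge_zero b[of 0]] by simp
  have i: "integrable LP (\<lambda>x. B\<^sup>2)" by simp
  show L: "L2_fun LP f"
    by (rule L2_fun_dominated[OF f i]) (auto intro!: AE_I2 b)
  have "(LINT x|LP. (cmod (f x))\<^sup>2) \<le> (LINT x|LP. B\<^sup>2)"
    by (rule integral_mono[OF L2_funD(2)[OF L] i]) (auto intro!: power_mono b)
  also have "\<dots> = pi * B\<^sup>2" by (simp add: measure_restrict_space)
  finally have "L2_norm LP f \<le> sqrt (pi * B\<^sup>2)" unfolding L2_norm_def by (rule real_sqrt_le_mono)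
  then show "L2_norm LP f \<le> sqrt pi * B" using B by (simp add: real_sqrt_mult)
qed

lemma L2_continuous:
  assumes "continuous_on {0..pi} f" shows "L2_fun LP f"
proof -
  obtain B where "\<forall>x\<in>{0..pi}. norm (f x) \<le> B"
    using compact_imp_bounded[OF compact_continuous_image[OF assms compact_Icc]] unfolding bounded_iff by auto
  then show ?thesis
    using assms by (intro L2_bounded(1)[of f B] continuous_imp_measurable_on_sets_lebesgue) auto
qed

lemma L2_norm_tendsto_0:
  assumes f: "\<And>n. L2_fun LP (f n)" and g: "integrable LP (\<lambda>x. (g x)\<^sup>2)"
    and dom: "\<And>n. AE x in LP. cmod (f n x) \<le> g x" and lim: "AE x in LP. (\<lambda>n. f n x) \<longlonglongrightarrow> 0"
  shows "(\<lambda>n. L2_norm LP (f n)) \<longlonglongrightarrow> 0"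
proof -
  have "(\<lambda>n. LINT x|LP. (cmod (f n x))\<^sup>2) \<longlonglongrightarrow> (LINT x|LP. 0)"
  proof (rule integral_dominated_convergence)
    show "integrable LP (\<lambda>x. (g x)\<^sup>2)" by (rule g)
    show "AE x in LP. (\<lambda>n. (cmod (f n x))\<^sup>2) \<longlonglongrightarrow> 0"
      using lim by eventually_elim (auto intro!: tendsto_eq_intros)
    show "AE x in LP. norm ((cmod (f n x))\<^sup>2) \<le> (g x)\<^sup>2" for n
      using dom[of n] by eventually_elim (simp add: power_mono)
  qed (use L2_funD(2)[OF f] in \<open>auto intro: borel_measurable_integrable\<close>)
  then have "(\<lambda>n. sqrt (LINT x|LP. (cmod (f n x))\<^sup>2)) \<longlonglongrightarrow> sqrt 0" by (intro tendsto_real_sqrt) simp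
  then show ?thesis by (simp add: L2_norm_def)
qed

text \<open>A measurable function is the limit almost everywhere of continuous ones. These may be
  unbounded, so they are composed with the radial retraction \<open>cl\<close> of the plane onto the
  disc of radius B', which fixes the values of h; dominated convergence then applies.\<close>

lemma L2_bounded_approx_continuous:
  fixes h :: "real \<Rightarrow> complex"
  assumes h: "h \<in> borel_measurable LP" and b: "\<And>x. x \<in> {0..pi} \<Longrightarrow> cmod (h x) \<le> B" and e: "\<epsilon> > 0"
  obtains c where "continuous_on {0..pi} c" "L2_norm LP (\<lambda>x. h x - c x) < \<epsilon>"
proof -
  define B' where "B' = max B 1"
  have B': "B' > 0" "\<And>x. x \<in> {0..pi} \<Longrightarrow> cmod (h x) \<le> B'" using b by (auto simp: B'_def intro!: max.coboundedI1)
  have "h measurable_on {0..pi}" using h by (simp add: measurable_on_iff_borel_measurable)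
  then obtain N g where N: "negligible N" and gc: "\<And>n::nat. continuous_on UNIV (g n)"
    and gl: "\<And>x. x \<notin> N \<Longrightarrow> (\<lambda>n. g n x) \<longlonglongrightarrow> (if x \<in> {0..pi} then h x else 0)"
    unfolding measurable_on_def by blast
  define cl :: "complex \<Rightarrow> complex" where "cl z = z * of_real (B' / max B' (cmod z))" for z
  have clc: "continuous_on UNIV cl" unfolding cl_def[abs_def] using B'(1) by (intro continuous_intros) auto
  have clb: "cmod (cl z) \<le> B'" for z
  proof -
    have "cmod (cl z) = cmod z * B' / max B' (cmod z)" using B'(1) by (simp add: cl_def norm_mult norm_divide)
    also have "\<dots> \<le> B'" using B'(1) by (simp add: pos_divide_le_eq mult.commute)
    finally show ?thesis .
  qed
  have cli: "cl z = z" if "cmod z \<le> B'" for z using that B'(1) by (simp add: cl_def max_def)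
  define u where "u n x = cl (g n x)" for n x
  have uc: "continuous_on S (u n)" for n S
    unfolding u_def[abs_def] using continuous_on_compose2[OF clc gc] continuous_on_subset by blast
  have hu: "L2_fun LP (\<lambda>x. h x - u n x)" for n
  proof (rule L2_bounded(1))
    show "(\<lambda>x. h x - u n x) \<in> borel_measurable LP"
      by (intro borel_measurable_diff h continuous_imp_measurable_on_sets_lebesgue uc) auto
    show "cmod (h x - u n x) \<le> B' + B'" if "x \<in> {0..pi}" for x
      using norm_triangle_ineq4[of "h x" "u n x"] B'(2)[OF that] clb[of "g n x"] unfolding u_def by linarith
  qed
  have "(\<lambda>n. L2_norm LP (\<lambda>x. h x - u n x)) \<longlonglongrightarrow> 0"
  proof (rule L2_norm_tendsto_0[OF hu])
    show "integrable LP (\<lambda>x. (2 * B')\<^sup>2)" by simp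
    show "AE x in LP. cmod (h x - u n x) \<le> 2 * B'" for n
    proof (rule AE_I2)
      fix x assume "x \<in> space LP"
      then have "x \<in> {0..pi}" by simp
      then show "cmod (h x - u n x) \<le> 2 * B'"
        using norm_triangle_ineq4[of "h x" "u n x"] B'(2)[of x] clb[of "g n x"] unfolding u_def by linarith
    qed
    have "AE x in lebesgue. x \<in> {0..pi} \<longrightarrow> (\<lambda>n. h x - u n x) \<longlonglongrightarrow> 0"
      unfolding eventually_ae_filter_negligible
    proof (intro exI[of _ N] conjI N)
      show "{x. \<not> (x \<in> {0..pi} \<longrightarrow> (\<lambda>n. h x - u n x) \<longlonglongrightarrow> 0)} \<subseteq> N"
      proof (rule subsetI, rule ccontr)
        fix x assume x: "x \<in> {x. \<not> (x \<in> {0..pi} \<longrightarrow> (\<lambda>n. h x - u n x) \<longlonglongrightarrow> 0)}" and "x \<notin> N"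
        then have "(\<lambda>n. g n x) \<longlonglongrightarrow> h x" using gl[of x] by auto
        then have "(\<lambda>n. cl (g n x)) \<longlonglongrightarrow> cl (h x)"
          using clc by (intro isCont_tendsto_compose[of _ cl]) (auto simp: continuous_on_eq_continuous_at)
        then have "(\<lambda>n. h x - u n x) \<longlonglongrightarrow> h x - h x"
          using cli[of "h x"] B'(2)[of x] x by (intro tendsto_intros) (auto simp: u_def)
        then show False using x by simp
      qed
    qed
    then show "AE x in LP. (\<lambda>n. h x - u n x) \<longlonglongrightarrow> 0"
      by (subst AE_restrict_space_iff) auto
  qed
  then have "\<forall>\<^sub>F n in sequentially. L2_norm LP (\<lambda>x. h x - u n x) < \<epsilon>" using e by (rule order_tendstoD)
  then obtain n where "L2_norm LP (\<lambda>x. h x - u n x) < \<epsilon>" by (auto simp: eventually_sequentially)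
  then show ?thesis using that uc by blast
qed

text \<open>The weight w vanishes only at the end points; dividing by it is what turns approximation by
  polynomials in cos x into approximation by sines.\<close>

lemma L2_approx_weighted:
  fixes f :: "real \<Rightarrow> complex" and w :: "real \<Rightarrow> real"
  assumes f: "L2_fun LP f" and w: "continuous_on {0..pi} w" "\<And>x. x \<in> {0..pi} \<Longrightarrow> 0 \<le> w x \<and> w x \<le> 1"
    "\<And>x. x \<in> {0<..<pi} \<Longrightarrow> 0 < w x" and e: "\<epsilon> > 0"
  obtains c where "continuous_on {0..pi} c" "L2_norm LP (\<lambda>x. f x - of_real (w x) * c x) < \<epsilon>"
proof -
  have wm: "w \<in> borel_measurable LP" using w(1) by (intro continuous_imp_measurable_on_sets_lebesgue) auto
  have fm: "f \<in> borel_measurable LP" by (rule L2_funD(1)[OF f])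
  \<comment> \<open>The quotient f / w is cut off where it exceeds n in modulus; off the end points,
    where w > 0, the cut-off stops acting for large n.\<close>
  define h where "h n x = (if cmod (f x) \<le> real n * w x then f x / of_real (w x) else 0)" for n :: nat and x
  have hm: "h n \<in> borel_measurable LP" for n
    unfolding h_def[abs_def]
    by (rule measurable_If, use fm wm in measurable)
  have hb: "cmod (h n x) \<le> real n" if "x \<in> {0..pi}" for n x
    using w(2)[OF that] by (auto simp: h_def norm_divide divide_le_eq)
  have whL: "L2_fun LP (\<lambda>x. of_real (w x) * h n x)" for n
  proof (rule L2_bounded(1))
    show "(\<lambda>x. of_real (w x) * h n x) \<in> borel_measurable LP" using wm hm[of n] by measurable
    show "cmod (of_real (w x) * h n x) \<le> 1 * real n" if "x \<in> {0..pi}" for x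
      using w(2)[OF that] mult_mono[OF _ hb[OF that, of n], of "w x" 1] by (simp add: norm_mult)
  qed
  have "(\<lambda>n. L2_norm LP (\<lambda>x. f x - of_real (w x) * h n x)) \<longlonglongrightarrow> 0"
  proof (rule L2_norm_tendsto_0[OF L2_fun_diff[OF f whL] L2_funD(2)[OF f]])
    have "f x - of_real (w x) * h n x = (if cmod (f x) \<le> real n * w x then 0 else f x) \<or> w x = 0 \<and> f x = 0" for n x
      by (auto simp: h_def)
    then have le: "cmod (f x - of_real (w x) * h n x) \<le> cmod (f x)" for n x
      by (smt (verit) norm_ge_zero norm_zero diff_zero mult_eq_0_iff of_real_0)
    then show "AE x in LP. cmod (f x - of_real (w x) * h n x) \<le> cmod (f x)" for n by simp
    have "AE x in lebesgue. x \<in> {0..pi} \<longrightarrow> (\<lambda>n. f x - of_real (w x) * h n x) \<longlonglongrightarrow> 0"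
      unfolding eventually_ae_filter_negligible
    proof (intro exI conjI)
      show "negligible {0, pi}" by (intro negligible_finite) auto
      show "{x. \<not> (x \<in> {0..pi} \<longrightarrow> (\<lambda>n. f x - of_real (w x) * h n x) \<longlonglongrightarrow> 0)} \<subseteq> {0, pi}"
      proof (rule subsetI, rule ccontr)
        fix x assume x: "x \<in> {x. \<not> (x \<in> {0..pi} \<longrightarrow> (\<lambda>n. f x - of_real (w x) * h n x) \<longlonglongrightarrow> 0)}" "x \<notin> {0, pi}"
        then have wx: "w x > 0" using w(3)[of x] by auto
        obtain n0 :: nat where "real n0 \<ge> cmod (f x) / w x" using real_arch_simple by blast
        then have n0: "cmod (f x) \<le> real n0 * w x" using wx by (simp add: divide_le_eq)
        have "f x - of_real (w x) * h n x = 0" if "n \<ge> n0" for n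
        proof -
          have "real n0 * w x \<le> real n * w x" using that wx by (intro mult_right_mono) auto
          then have "cmod (f x) \<le> real n * w x" using n0 by linarith
          then show ?thesis using wx by (simp add: h_def)
        qed
        then have "(\<lambda>n. f x - of_real (w x) * h n x) \<longlonglongrightarrow> 0"
          by (intro tendsto_eventually) (auto simp: eventually_sequentially)
        then show False using x by simp
      qed
    qed
    then show "AE x in LP. (\<lambda>n. f x - of_real (w x) * h n x) \<longlonglongrightarrow> 0"
      by (subst AE_restrict_space_iff) auto
  qed
  then have "\<forall>\<^sub>F n in sequentially. L2_norm LP (\<lambda>x. f x - of_real (w x) * h n x) < \<epsilon>/2"
    using e by (intro order_tendstoD) auto
  then obtain n where n: "L2_norm LP (\<lambda>x. f x - of_real (w x) * h n x) < \<epsilon>/2" by (auto simp: eventually_sequentially)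
  obtain c where c: "continuous_on {0..pi} c" "L2_norm LP (\<lambda>x. h n x - c x) < \<epsilon>/2"
    using L2_bounded_approx_continuous[OF hm[of n] hb, of "\<epsilon>/2"] e by auto
  have wc: "L2_fun LP (\<lambda>x. of_real (w x) * c x)" by (intro L2_continuous continuous_intros w c)
  have hL: "L2_fun LP (h n)" by (rule L2_bounded(1)[OF hm hb])
  have "L2_norm LP (\<lambda>x. of_real (w x) * h n x - of_real (w x) * c x) \<le> L2_norm LP (\<lambda>x. h n x - c x)"
  proof (rule L2_norm_mono[OF L2_fun_diff[OF whL wc] L2_fun_diff[OF hL L2_continuous[OF c(1)]]], rule AE_I2)
    fix x assume "x \<in> space LP"
    then have "0 \<le> w x \<and> w x \<le> 1" using w(2) by simp
    then show "cmod (of_real (w x) * h n x - of_real (w x) * c x) \<le> cmod (h n x - c x)"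
      by (simp add: norm_mult mult_left_le_one_le flip: right_diff_distrib)
  qed
  then have "L2_norm LP (\<lambda>x. f x - of_real (w x) * c x) < \<epsilon>"
    using L2_norm_triangle_diff[OF f whL[of n] wc] n c(2) by linarith
  then show ?thesis using that c by blast
qed

subsection \<open>Sine bases\<close>

definition sine_poly :: "real \<Rightarrow> (real \<Rightarrow> complex) \<Rightarrow> bool" where
  "sine_poly \<kappa> g \<longleftrightarrow> (\<exists>(n::nat) b. \<forall>x. g x = (\<Sum>j<n. b j * of_real (sin ((real j + \<kappa>) * x))))"

lemma sine_poly_sin: "sine_poly \<kappa> (\<lambda>x. of_real (sin ((real j + \<kappa>) * x)))"
  unfolding sine_poly_def
  by (intro exI[of _ "Suc j"] exI[of _ "\<lambda>i. if i = j then 1 else 0"])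
    (simp add: if_distrib[of "\<lambda>c. c * _"] cong: if_cong)

lemma sine_poly_zero: "sine_poly \<kappa> (\<lambda>x. 0)"
  unfolding sine_poly_def by (intro exI[of _ 0]) simp

lemma sine_poly_cmult: "sine_poly \<kappa> g \<Longrightarrow> sine_poly \<kappa> (\<lambda>x. c * g x)"
proof -
  assume "sine_poly \<kappa> g"
  then obtain n b where "\<forall>x. g x = (\<Sum>j<n. b j * of_real (sin ((real j + \<kappa>) * x)))" unfolding sine_poly_def by blast
  then show ?thesis unfolding sine_poly_def
    by (intro exI[of _ n] exI[of _ "\<lambda>j. c * b j"]) (simp add: sum_distrib_left mult.assoc)
qed

lemma sine_poly_add:
  assumes "sine_poly \<kappa> g" "sine_poly \<kappa> h" shows "sine_poly \<kappa> (\<lambda>x. g x + h x)"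
proof -
  obtain n b where b: "\<forall>x. g x = (\<Sum>j<n. b j * of_real (sin ((real j + \<kappa>) * x)))"
    using assms(1) unfolding sine_poly_def by blast
  obtain m c where c: "\<forall>x. h x = (\<Sum>j<m. c j * of_real (sin ((real j + \<kappa>) * x)))"
    using assms(2) unfolding sine_poly_def by blast
  have pad: "(\<Sum>j<k. d j * s j) = (\<Sum>j<max n m. (if j < k then d j else 0) * s j)" if "k \<le> max n m"
    for k and d s :: "nat \<Rightarrow> complex"
    using that by (intro sum.mono_neutral_cong_left) auto
  have "g x + h x = (\<Sum>j<max n m. ((if j < n then b j else 0) + (if j < m then c j else 0)) * of_real (sin ((real j + \<kappa>) * x)))" for x
    using b c pad[of n b] pad[of m c] by (simp add: distrib_right sum.distrib)
  then show ?thesis unfolding sine_poly_def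
    by (intro exI[of _ "max n m"] exI[of _ "\<lambda>j. (if j < n then b j else 0) + (if j < m then c j else 0)"]) blast
qed

lemma sine_poly_sum: "(\<And>i. i \<in> F \<Longrightarrow> sine_poly \<kappa> (g i)) \<Longrightarrow> sine_poly \<kappa> (\<lambda>x. \<Sum>i\<in>F. g i x)"
  by (induction F rule: infinite_finite_induct) (auto intro: sine_poly_add sine_poly_zero)

text \<open>The product formula moves the frequency j + \<kappa> by one in both directions. Only j =
  0 could leave the family, but \<kappa> - 1 is 0 for \<kappa> = 1, and for \<kappa> = 1/2 it is the
  negative of the lowest frequency.\<close>

lemma sine_poly_mult_cos:
  assumes \<kappa>: "\<kappa> \<in> {1/2, 1}" and g: "sine_poly \<kappa> g"
  shows "sine_poly \<kappa> (\<lambda>x. of_real (cos x) * g x)"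
proof -
  have s: "sine_poly \<kappa> (\<lambda>x. of_real (cos x) * of_real (sin ((real j + \<kappa>) * x)))" for j
  proof -
    have prod: "cos x * sin ((real j + \<kappa>) * x) = 1/2 * sin ((real (Suc j) + \<kappa>) * x) + 1/2 * sin ((real j + \<kappa> - 1) * x)" for x
    proof -
      have "(real (Suc j) + \<kappa>) * x = (real j + \<kappa>) * x + x" "(real j + \<kappa> - 1) * x = (real j + \<kappa>) * x - x"
        by (simp_all add: algebra_simps)
      then show ?thesis by (simp only: sin_add sin_diff) (simp add: algebra_simps)
    qed
    have low: "sine_poly \<kappa> (\<lambda>x. of_real (sin ((real j + \<kappa> - 1) * x)))"
    proof (cases j)
      case 0
      from \<kappa> consider "\<kappa> = 1" | "\<kappa> = 1/2" by blast
      then show ?thesis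
      proof cases
        case 1
        then show ?thesis using 0 sine_poly_zero[of 1] by simp
      next
        case 2
        have "(\<lambda>x. complex_of_real (sin ((real j + \<kappa> - 1) * x))) = (\<lambda>x. (-1) * of_real (sin ((real 0 + \<kappa>) * x)))"
          unfolding 0 2 by (simp add: fun_eq_iff flip: sin_minus)
        then show ?thesis using sine_poly_cmult[OF sine_poly_sin[of \<kappa> 0], of "-1"] by simp
      qed
    next
      case (Suc i)
      then show ?thesis using sine_poly_sin[of \<kappa> i] by (simp add: algebra_simps)
    qed
    have "sine_poly \<kappa> (\<lambda>x. (1/2) * of_real (sin ((real (Suc j) + \<kappa>) * x)) + (1/2) * of_real (sin ((real j + \<kappa> - 1) * x)))"
      by (intro sine_poly_add sine_poly_cmult sine_poly_sin low)
    also have "(\<lambda>x. (1/2) * of_real (sin ((real (Suc j) + \<kappa>) * x)) + (1/2) * of_real (sin ((real j + \<kappa> - 1) * x))) =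
       (\<lambda>x. complex_of_real (cos x) * of_real (sin ((real j + \<kappa>) * x)))"
      unfolding of_real_mult[symmetric] prod by (simp add: fun_eq_iff)
    finally show ?thesis .
  qed
  obtain n b where "\<And>x. g x = (\<Sum>j<n. b j * of_real (sin ((real j + \<kappa>) * x)))"
    using g unfolding sine_poly_def by blast
  then have "(\<lambda>x. of_real (cos x) * g x) = (\<lambda>x. \<Sum>j<n. b j * (of_real (cos x) * of_real (sin ((real j + \<kappa>) * x))))"
    by (simp add: fun_eq_iff sum_distrib_left mult.left_commute)
  then show ?thesis using s by (simp add: sine_poly_sum sine_poly_cmult)
qed

text \<open>The substitution u = cos x carries [0, pi] homeomorphically to [-1, 1], where
  Weierstrass's theorem applies to the real and imaginary parts.\<close>

lemma continuous_approx_cos_polynomial: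
  fixes c :: "real \<Rightarrow> complex"
  assumes c: "continuous_on {0..pi} c" and e: "\<epsilon> > 0"
  obtains n :: nat and a :: "nat \<Rightarrow> complex"
  where "\<And>x. x \<in> {0..pi} \<Longrightarrow> cmod (c x - (\<Sum>i\<le>n. a i * of_real (cos x) ^ i)) < \<epsilon>"
proof -
  have part: "\<exists>(n::nat) a. \<forall>x\<in>{0..pi}. \<bar>r x - (\<Sum>i\<le>n. a i * cos x ^ i)\<bar> < \<epsilon>/2" if r: "continuous_on {0..pi} r" for r :: "real \<Rightarrow> real"
  proof -
    have "continuous_on {-1..1} (\<lambda>u. r (arccos u))"
      by (rule continuous_on_compose2[OF r continuous_on_arccos']) (auto intro: arccos_lbound arccos_ubound)
    then obtain g where g: "real_polynomial_function g" "\<And>u. u \<in> {-1..1} \<Longrightarrow> \<bar>r (arccos u) - g u\<bar> < \<epsilon>/2"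
      using Stone_Weierstrass_real_polynomial_function[of "{-1..1}" "\<lambda>u. r (arccos u)" "\<epsilon>/2"] e by auto
    obtain a n where a: "g = (\<lambda>x. \<Sum>i\<le>n. a i * x ^ i)" using g(1) unfolding real_polynomial_function_iff_sum by blast
    have "\<bar>r x - (\<Sum>i\<le>n. a i * cos x ^ i)\<bar> < \<epsilon>/2" if "x \<in> {0..pi}" for x
      using g(2)[of "cos x"] that by (simp add: a arccos_cos)
    then show ?thesis by blast
  qed
  have "continuous_on {0..pi} (\<lambda>x. Re (c x))" "continuous_on {0..pi} (\<lambda>x. Im (c x))" using c by (auto intro: continuous_intros)
  from part[OF this(1)] part[OF this(2)]
  obtain n m :: nat and a b where n: "\<forall>x\<in>{0..pi}. \<bar>Re (c x) - (\<Sum>i\<le>n. a i * cos x ^ i)\<bar> < \<epsilon>/2"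
    and m: "\<forall>x\<in>{0..pi}. \<bar>Im (c x) - (\<Sum>i\<le>m. b i * cos x ^ i)\<bar> < \<epsilon>/2"
    by (elim exE)
  define k where "k = max n m"
  define a' b' where "a' i = (if i \<le> n then a i else 0)" and "b' i = (if i \<le> m then b i else 0)" for i
  have pa: "(\<Sum>i\<le>n. a i * y ^ i) = (\<Sum>i\<le>k. a' i * y ^ i)" and pb: "(\<Sum>i\<le>m. b i * y ^ i) = (\<Sum>i\<le>k. b' i * y ^ i)" for y
    by (auto intro!: sum.mono_neutral_cong_left simp: k_def a'_def b'_def split: if_splits)
  show ?thesis
  proof (rule that[of "\<lambda>i. Complex (a' i) (b' i)" k])
    fix x assume x: "x \<in> {0..pi}"
    have s: "(\<Sum>i\<le>k. Complex (a' i) (b' i) * of_real (cos x) ^ i) = Complex (\<Sum>i\<le>k. a' i * cos x ^ i) (\<Sum>i\<le>k. b' i * cos x ^ i)"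
      by (rule complex_eqI) (simp_all flip: of_real_power)
    have "cmod (c x - (\<Sum>i\<le>k. Complex (a' i) (b' i) * of_real (cos x) ^ i)) \<le>
       \<bar>Re (c x) - (\<Sum>i\<le>k. a' i * cos x ^ i)\<bar> + \<bar>Im (c x) - (\<Sum>i\<le>k. b' i * cos x ^ i)\<bar>"
      unfolding s by (rule order_trans[OF cmod_le]) simp
    also have "\<dots> < \<epsilon>/2 + \<epsilon>/2" using n[rule_format, OF x] m[rule_format, OF x] unfolding pa pb by (rule add_strict_mono)
    finally show "cmod (c x - (\<Sum>i\<le>k. Complex (a' i) (b' i) * of_real (cos x) ^ i)) < \<epsilon>" by simp
  qed
qed

text \<open>The lowest sine, sin (\<kappa> x), is positive inside the interval and serves as the
  weight: f is close to the weight times a continuous function, hence to the weight times a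
  polynomial in cos x, and such products are sine polynomials by
  \<open>sine_poly_mult_cos\<close>.\<close>

lemma sine_poly_dense:
  assumes \<kappa>: "\<kappa> \<in> {1/2, 1}" and f: "L2_fun LP f" and e: "\<epsilon> > 0"
  obtains g where "sine_poly \<kappa> g" "L2_norm LP (\<lambda>x. f x - g x) < \<epsilon>"
proof -
  define w where "w x = sin (\<kappa> * x)" for x
  have wc: "continuous_on S w" for S unfolding w_def[abs_def] by (intro continuous_intros)
  have kx: "0 \<le> \<kappa> * x \<and> \<kappa> * x \<le> pi" if "x \<in> {0..pi}" for x
  proof -
    have k: "0 \<le> \<kappa>" "\<kappa> \<le> 1" using \<kappa> by auto
    then have "\<kappa> * x \<le> 1 * x" using that by (intro mult_right_mono) auto
    then show ?thesis using k that by auto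
  qed
  have w01: "0 \<le> w x \<and> w x \<le> 1" if "x \<in> {0..pi}" for x
    using kx[OF that] by (auto simp: w_def intro: sin_ge_zero)
  have wpos: "0 < w x" if "x \<in> {0<..<pi}" for x
  proof -
    have k: "0 < \<kappa>" "\<kappa> \<le> 1" using \<kappa> by auto
    then have "\<kappa> * x \<le> 1 * x" using that by (intro mult_right_mono) auto
    moreover have "x < pi" using that by simp
    ultimately have "\<kappa> * x < pi" by linarith
    then show ?thesis using k that by (auto simp: w_def intro!: sin_gt_zero)
  qed
  obtain c where c: "continuous_on {0..pi} c" "L2_norm LP (\<lambda>x. f x - of_real (w x) * c x) < \<epsilon>/2"
    using L2_approx_weighted[OF f wc w01 wpos, of "\<epsilon>/2"] e by auto
  \<comment> \<open>The L2 norm is at most sqrt pi times the supremum, so this tolerance costs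
    \<epsilon> / 4.\<close>
  have "\<epsilon> / (4 * sqrt pi) > 0" using e by simp
  then obtain n a where na: "\<And>x. x \<in> {0..pi} \<Longrightarrow> cmod (c x - (\<Sum>i\<le>n. a i * of_real (cos x) ^ i)) < \<epsilon> / (4 * sqrt pi)"
    using continuous_approx_cos_polynomial[OF c(1)] by metis
  define g where "g x = of_real (w x) * (\<Sum>i\<le>n. a i * of_real (cos x) ^ i)" for x
  have "sine_poly \<kappa> (\<lambda>x. of_real (cos x) ^ i * of_real (w x))" for i
  proof (induction i)
    case 0
    show ?case using sine_poly_sin[of \<kappa> 0] by (simp add: w_def)
  next
    case (Suc i)
    show ?case using sine_poly_mult_cos[OF \<kappa> Suc] by (simp add: mult.assoc)
  qed
  then have "sine_poly \<kappa> (\<lambda>x. \<Sum>i\<le>n. a i * (of_real (cos x) ^ i * of_real (w x)))"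
    by (intro sine_poly_sum sine_poly_cmult)
  then have gs: "sine_poly \<kappa> g" by (simp add: g_def[abs_def] sum_distrib_left mult_ac)
  have wcc: "continuous_on {0..pi} (\<lambda>x. of_real (w x) * c x)" by (intro continuous_intros wc c)
  have gc: "continuous_on {0..pi} g" unfolding g_def[abs_def] by (intro continuous_intros wc)
  have "L2_norm LP (\<lambda>x. of_real (w x) * c x - g x) \<le> sqrt pi * (\<epsilon> / (4 * sqrt pi))"
  proof (rule L2_bounded(2))
    show "(\<lambda>x. of_real (w x) * c x - g x) \<in> borel_measurable LP"
      by (intro continuous_imp_measurable_on_sets_lebesgue continuous_intros wcc gc) auto
    fix x assume x: "x \<in> {0..pi}"
    have "of_real (w x) * c x - g x = of_real (w x) * (c x - (\<Sum>i\<le>n. a i * of_real (cos x) ^ i))"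
      by (simp add: g_def right_diff_distrib)
    then have "cmod (of_real (w x) * c x - g x) \<le> 1 * (\<epsilon> / (4 * sqrt pi))"
      using w01[OF x] na[OF x] by (simp only: norm_mult) (intro mult_mono, auto)
    then show "cmod (of_real (w x) * c x - g x) \<le> \<epsilon> / (4 * sqrt pi)" by simp
  qed
  also have "\<dots> < \<epsilon>/2" using e by simp
  finally have "L2_norm LP (\<lambda>x. f x - g x) < \<epsilon>"
    using L2_norm_triangle_diff[OF f L2_continuous[OF wcc] L2_continuous[OF gc]] c(2) by linarith
  then show ?thesis using that gs by blast
qed

definition sine_basis :: "real \<Rightarrow> nat \<Rightarrow> real \<Rightarrow> complex" where
  "sine_basis \<kappa> j x = of_real (sqrt (2 / pi) * sin ((real j + \<kappa>) * x))"

lemma integral_cos_multiple: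
  fixes k :: int
  shows "integral {0..pi} (\<lambda>x. cos (real_of_int k * x)) = (if k = 0 then pi else 0)"
proof (cases "k = 0")
  case False
  have "((\<lambda>x. cos (real_of_int k * x)) has_integral (sin (real_of_int k * pi) / real_of_int k - sin (real_of_int k * 0) / real_of_int k)) {0..pi}"
    by (rule fundamental_theorem_of_calculus[where f = "\<lambda>x. sin (real_of_int k * x) / real_of_int k"])
      (use False in \<open>auto intro!: derivative_eq_intros simp: has_real_derivative_iff_has_vector_derivative[symmetric]\<close>)
  moreover have "sin (real_of_int k * pi) = 0" by (simp add: sin_zero_iff_int2)
  ultimately show ?thesis using False by (simp add: has_integral_iff)
qed simp

lemma sine_basis_orthonormal:
  assumes \<kappa>: "\<kappa> \<in> {1/2, 1}"
  shows "orthonormal_basis_L2 LP UNIV (sine_basis \<kappa>)"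
  unfolding orthonormal_basis_L2_def
proof (intro conjI ballI allI impI)
  have sc: "continuous_on S (sine_basis \<kappa> j)" for S j
    unfolding sine_basis_def[abs_def] by (intro continuous_intros)
  show sL: "L2_fun LP (sine_basis \<kappa> j)" for j by (intro L2_continuous sc)
  show "L2_inner LP (sine_basis \<kappa> i) (sine_basis \<kappa> j) = (if i = j then 1 else 0)" for i j
  proof -
    \<comment> \<open>2 \<kappa> is a positive integer, so the sum i + j + 2 \<kappa> of two
      frequencies is a nonzero integer and its cosine integrates to 0.\<close>
    obtain k :: int where k: "2 * \<kappa> = real_of_int k" "k \<ge> 1" using \<kappa> by (metis empty_iff insert_iff mult.commute mult_2_right nonzero_mult_div_cancel_left of_int_1 of_int_numeral one_add_one one_le_numeral order_refl times_divide_eq_left zero_neq_numeral mult_1)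
    define r where "r x = (2 / pi) * (sin ((real i + \<kappa>) * x) * sin ((real j + \<kappa>) * x))" for x
    have rc: "continuous_on {0..pi} r" unfolding r_def[abs_def] by (intro continuous_intros)
    have sq: "sqrt (2 / pi) * u * (sqrt (2 / pi) * v) = (2 / pi) * (u * v)" for u v
    proof -
      have "sqrt (2 / pi) * u * (sqrt (2 / pi) * v) = (sqrt (2 / pi) * sqrt (2 / pi)) * (u * v)" by (simp only: mult_ac)
      then show ?thesis by simp
    qed
    have "L2_inner LP (sine_basis \<kappa> i) (sine_basis \<kappa> j) = (LINT x|LP. complex_of_real (r x))"
      unfolding L2_inner_def sine_basis_def r_def
      by (intro Bochner_Integration.integral_cong refl) (simp only: complex_cnj_complex_of_real of_real_mult[symmetric] sq)
    also have "\<dots> = of_real (LINT x|LP. r x)" by simp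
    also have "(LINT x|LP. r x) = integral {0..pi} r"
      by (intro lebesgue_integral_eq_integral continuous_imp_integrable_real rc) auto
    also have "\<dots> = integral {0..pi} (\<lambda>x. (1 / pi) * (cos (real_of_int (int i - int j) * x) - cos (real_of_int (int i + int j + k) * x)))"
    proof (rule integral_cong)
      fix x
      have "real_of_int (int i - int j) * x = (real i + \<kappa>) * x - (real j + \<kappa>) * x"
        "real_of_int (int i + int j + k) * x = (real i + \<kappa>) * x + (real j + \<kappa>) * x"
        using k by (simp_all add: algebra_simps flip: k(1))
      then show "r x = (1 / pi) * (cos (real_of_int (int i - int j) * x) - cos (real_of_int (int i + int j + k) * x))"
        by (simp only: r_def cos_diff cos_add) (simp add: field_simps)
    qed
    also have "\<dots> = (1 / pi) * (integral {0..pi} (\<lambda>x. cos (real_of_int (int i - int j) * x)) - integral {0..pi} (\<lambda>x. cos (real_of_int (int i + int j + k) * x)))"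
      by (subst integral_mult_right, subst integral_diff) (auto intro!: integrable_continuous_interval continuous_intros)
    also have "\<dots> = (if i = j then 1 else 0)" unfolding integral_cos_multiple using k by auto
    finally show ?thesis by simp
  qed
  fix f and \<epsilon> :: real assume f: "L2_fun LP f" and e: "\<epsilon> > 0"
  obtain g where g: "sine_poly \<kappa> g" "L2_norm LP (\<lambda>x. f x - g x) < \<epsilon>"
    using sine_poly_dense[OF \<kappa> f e] by blast
  obtain n b where b: "\<And>x. g x = (\<Sum>j<n. b j * of_real (sin ((real j + \<kappa>) * x)))"
    using g(1) unfolding sine_poly_def by blast
  have "g x = (\<Sum>j<n. (b j / of_real (sqrt (2 / pi))) * sine_basis \<kappa> j x)" for x
    by (simp add: b sine_basis_def)
  then have "L2_norm LP (\<lambda>x. f x - (\<Sum>j\<in>{..<n}. (b j / of_real (sqrt (2 / pi))) * sine_basis \<kappa> j x)) < \<epsilon>"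
    using g(2) by simp
  then show "\<exists>F c. finite F \<and> F \<subseteq> UNIV \<and> L2_norm LP (\<lambda>x. f x - (\<Sum>j\<in>F. c j * sine_basis \<kappa> j x)) < \<epsilon>"
    by (intro exI[of _ "{..<n}"] exI[of _ "\<lambda>j. b j / of_real (sqrt (2 / pi))"] conjI) simp_all
qed

subsection \<open>Bounded operators and Riesz bases\<close>

lemma bounded_linear_L2D:
  assumes "bounded_linear_L2 M A"
  shows "\<And>f. L2_fun M f \<Longrightarrow> L2_fun M (A f)"
    "\<And>f g. L2_fun M f \<Longrightarrow> L2_fun M g \<Longrightarrow> AE x in M. A (\<lambda>t. f t + g t) x = A f x + A g x"
    "\<And>f c. L2_fun M f \<Longrightarrow> AE x in M. A (\<lambda>t. c * f t) x = c * A f x"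
    "\<exists>C\<ge>0. \<forall>f. L2_fun M f \<longrightarrow> L2_norm M (A f) \<le> C * L2_norm M f"
proof -
  note 0 = assms[unfolded bounded_linear_L2_def]
  note A = 0[THEN conjunct1] 0[THEN conjunct2, THEN conjunct1] 0[THEN conjunct2, THEN conjunct2, THEN conjunct1]
    0[THEN conjunct2, THEN conjunct2, THEN conjunct2]
  show "\<And>f. L2_fun M f \<Longrightarrow> L2_fun M (A f)" using A(1) by (elim allE impE)
  show "\<And>f g. L2_fun M f \<Longrightarrow> L2_fun M g \<Longrightarrow> AE x in M. A (\<lambda>t. f t + g t) x = A f x + A g x"
    using A(2) by simp
  show "\<And>f c. L2_fun M f \<Longrightarrow> AE x in M. A (\<lambda>t. c * f t) x = c * A f x" using A(3) by simp
  obtain C where C: "\<And>f. L2_fun M f \<Longrightarrow> L2_norm M (A f) \<le> C * L2_norm M f" using A(4) by blast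
  have "L2_norm M (A f) \<le> max C 0 * L2_norm M f" if "L2_fun M f" for f
    using C[OF that] mult_right_mono[of C "max C 0" "L2_norm M f"] by simp
  then show "\<exists>C\<ge>0. \<forall>f. L2_fun M f \<longrightarrow> L2_norm M (A f) \<le> C * L2_norm M f" by (intro exI[of _ "max C 0"]) simp
qed

lemma bounded_linear_L2_diff:
  assumes A: "bounded_linear_L2 M A" and f: "L2_fun M f" and g: "L2_fun M g"
  shows "AE x in M. A (\<lambda>t. f t - g t) x = A f x - A g x"
proof -
  have "AE x in M. A (\<lambda>t. f t + (-1) * g t) x = A f x + A (\<lambda>t. (-1) * g t) x"
    by (rule bounded_linear_L2D(2)[OF A f L2_fun_cmult(1)[OF g]])
  moreover have "AE x in M. A (\<lambda>t. (-1) * g t) x = (-1) * A g x" by (rule bounded_linear_L2D(3)[OF A g])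
  ultimately show ?thesis by eventually_elim simp
qed

lemma bounded_linear_L2_AE_cong:
  assumes A: "bounded_linear_L2 M A" and f: "L2_fun M f" and g: "L2_fun M g" and eq: "AE x in M. f x = g x"
  shows "AE x in M. A f x = A g x"
proof -
  obtain C where C: "\<forall>f. L2_fun M f \<longrightarrow> L2_norm M (A f) \<le> C * L2_norm M f" using bounded_linear_L2D(4)[OF A] by blast
  note d = L2_fun_diff[OF f g]
  have "AE x in M. f x - g x = 0" using eq by eventually_elim simp
  then have "L2_norm M (\<lambda>x. f x - g x) = 0" using L2_norm_eq_0_iff[OF d] by simp
  then have "L2_norm M (A (\<lambda>x. f x - g x)) = 0"
    using C[rule_format, OF d] L2_norm_nonneg[of M "A (\<lambda>x. f x - g x)"] by simp
  then have "AE x in M. A (\<lambda>x. f x - g x) x = 0" using L2_norm_eq_0_iff[OF bounded_linear_L2D(1)[OF A d]] by simp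
  with bounded_linear_L2_diff[OF A f g] show ?thesis by eventually_elim simp
qed

lemma bounded_linear_L2_compose:
  assumes A: "bounded_linear_L2 M A" and B: "bounded_linear_L2 M B"
  shows "bounded_linear_L2 M (\<lambda>f. A (B f))"
proof -
  obtain C where C: "C \<ge> 0" "\<forall>f. L2_fun M f \<longrightarrow> L2_norm M (A f) \<le> C * L2_norm M f" using bounded_linear_L2D(4)[OF A] by blast
  obtain D where D: "D \<ge> 0" "\<forall>f. L2_fun M f \<longrightarrow> L2_norm M (B f) \<le> D * L2_norm M f" using bounded_linear_L2D(4)[OF B] by blast
  note BL = bounded_linear_L2D(1)[OF B]
  show ?thesis unfolding bounded_linear_L2_def
  proof (intro conjI allI impI exI[of _ "C * D"])
    show "L2_fun M (A (B f))" if "L2_fun M f" for f using that by (intro bounded_linear_L2D(1)[OF A] BL)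
    show "AE x in M. A (B (\<lambda>t. f t + g t)) x = A (B f) x + A (B g) x" if f: "L2_fun M f" and g: "L2_fun M g" for f g
    proof -
      have "AE x in M. A (B (\<lambda>t. f t + g t)) x = A (\<lambda>x. B f x + B g x) x"
        by (rule bounded_linear_L2_AE_cong[OF A BL[OF L2_fun_add[OF f g]] L2_fun_add[OF BL[OF f] BL[OF g]] bounded_linear_L2D(2)[OF B f g]])
      with bounded_linear_L2D(2)[OF A BL[OF f] BL[OF g]] show ?thesis by eventually_elim simp
    qed
    show "AE x in M. A (B (\<lambda>t. c * f t)) x = c * A (B f) x" if f: "L2_fun M f" for f c
    proof -
      have "AE x in M. A (B (\<lambda>t. c * f t)) x = A (\<lambda>x. c * B f x) x"
        by (rule bounded_linear_L2_AE_cong[OF A BL[OF L2_fun_cmult(1)[OF f]] L2_fun_cmult(1)[OF BL[OF f]] bounded_linear_L2D(3)[OF B f]])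
      with bounded_linear_L2D(3)[OF A BL[OF f]] show ?thesis by eventually_elim simp
    qed
    show "L2_norm M (A (B f)) \<le> C * D * L2_norm M f" if f: "L2_fun M f" for f
    proof -
      have "L2_norm M (A (B f)) \<le> C * L2_norm M (B f)" using C BL[OF f] by blast
      also have "\<dots> \<le> C * (D * L2_norm M f)" using C D f by (intro mult_left_mono) auto
      finally show ?thesis by (simp add: mult.assoc)
    qed
  qed
qed

text \<open>The inverse B is chosen pointwise from surjectivity. Its linearity and the identity B A
  = 1 follow by applying A and using injectivity, which the lower bound supplies; the same bound
  makes B bounded.\<close>

lemma bounded_invertible_L2I:
  assumes A: "bounded_linear_L2 M A"
    and below: "\<And>f. L2_fun M f \<Longrightarrow> L2_norm M f \<le> C * L2_norm M (A f)"
    and surj: "\<And>g. L2_fun M g \<Longrightarrow> \<exists>f. L2_fun M f \<and> (AE x in M. A f x = g x)"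
  shows "bounded_invertible_L2 M A"
proof -
  note AL = bounded_linear_L2D(1)[OF A]
  define B where "B g = (SOME f. L2_fun M f \<and> (AE x in M. A f x = g x))" for g
  have BL: "L2_fun M (B g)" and AB: "AE x in M. A (B g) x = g x" if "L2_fun M g" for g
    using someI_ex[OF surj[OF that]] unfolding B_def by blast+
  have inj: "AE x in M. f x = g x" if f: "L2_fun M f" and g: "L2_fun M g" and eq: "AE x in M. A f x = A g x" for f g
  proof -
    note d = L2_fun_diff[OF f g]
    have "AE x in M. A (\<lambda>t. f t - g t) x = 0" using eq bounded_linear_L2_diff[OF A f g] by eventually_elim simp
    then have "L2_norm M (A (\<lambda>t. f t - g t)) = 0" using L2_norm_eq_0_iff[OF AL[OF d]] by simp
    then have "L2_norm M (\<lambda>t. f t - g t) \<le> 0" using below[OF d] by simp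
    then have "L2_norm M (\<lambda>t. f t - g t) = 0" using L2_norm_nonneg by (rule antisym)
    then have "AE x in M. f x - g x = 0" using L2_norm_eq_0_iff[OF d] by simp
    then show ?thesis by eventually_elim simp
  qed
  have "bounded_linear_L2 M B" unfolding bounded_linear_L2_def
  proof (intro conjI allI impI exI[of _ C])
    show "L2_fun M (B f)" if "L2_fun M f" for f using BL[OF that] .
    show "AE x in M. B (\<lambda>t. f t + g t) x = B f x + B g x" if f: "L2_fun M f" and g: "L2_fun M g" for f g
    proof (rule inj[OF BL[OF L2_fun_add[OF f g]] L2_fun_add[OF BL[OF f] BL[OF g]]])
      show "AE x in M. A (B (\<lambda>t. f t + g t)) x = A (\<lambda>x. B f x + B g x) x"
        using AB[OF L2_fun_add[OF f g]] bounded_linear_L2D(2)[OF A BL[OF f] BL[OF g]] AB[OF f] AB[OF g]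
        by eventually_elim simp
    qed
    show "AE x in M. B (\<lambda>t. c * f t) x = c * B f x" if f: "L2_fun M f" for f c
    proof (rule inj[OF BL[OF L2_fun_cmult(1)[OF f]] L2_fun_cmult(1)[OF BL[OF f]]])
      show "AE x in M. A (B (\<lambda>t. c * f t)) x = A (\<lambda>x. c * B f x) x"
        using AB[OF L2_fun_cmult(1)[OF f, of c]] bounded_linear_L2D(3)[OF A BL[OF f], of c] AB[OF f]
        by eventually_elim simp
    qed
    show "L2_norm M (B f) \<le> C * L2_norm M f" if f: "L2_fun M f" for f
    proof -
      have "L2_norm M (A (B f)) = L2_norm M f"
        by (rule L2_norm_AE_cong[OF AB[OF f] L2_funD(1)[OF AL[OF BL[OF f]]] L2_funD(1)[OF f]])
      then show ?thesis using below[OF BL[OF f]] by simp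
    qed
  qed
  moreover have "AE x in M. B (A f) x = f x" if f: "L2_fun M f" for f
    by (rule inj[OF BL[OF AL[OF f]] f AB[OF AL[OF f]]])
  ultimately show ?thesis unfolding bounded_invertible_L2_def using A AB by blast
qed

lemma bounded_invertible_L2_compose:
  assumes "bounded_invertible_L2 M A" "bounded_invertible_L2 M A'"
  shows "bounded_invertible_L2 M (\<lambda>f. A (A' f))"
proof -
  obtain B where A: "bounded_linear_L2 M A" and B: "bounded_linear_L2 M B"
    and AB: "\<And>f. L2_fun M f \<Longrightarrow> AE x in M. A (B f) x = f x" "\<And>f. L2_fun M f \<Longrightarrow> AE x in M. B (A f) x = f x"
    using assms(1) unfolding bounded_invertible_L2_def by blast
  obtain B' where A': "bounded_linear_L2 M A'" and B': "bounded_linear_L2 M B'"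
    and AB': "\<And>f. L2_fun M f \<Longrightarrow> AE x in M. A' (B' f) x = f x" "\<And>f. L2_fun M f \<Longrightarrow> AE x in M. B' (A' f) x = f x"
    using assms(2) unfolding bounded_invertible_L2_def by blast
  note L = bounded_linear_L2D(1)[OF A] bounded_linear_L2D(1)[OF B] bounded_linear_L2D(1)[OF A'] bounded_linear_L2D(1)[OF B']
  have "AE x in M. A (A' (B' (B f))) x = f x" if f: "L2_fun M f" for f
  proof -
    have "AE x in M. A (A' (B' (B f))) x = A (B f) x"
      by (rule bounded_linear_L2_AE_cong[OF A _ _ AB'(1)]) (intro L f)+
    with AB(1)[OF f] show ?thesis by eventually_elim simp
  qed
  moreover have "AE x in M. B' (B (A (A' f))) x = f x" if f: "L2_fun M f" for f
  proof -
    have "AE x in M. B' (B (A (A' f))) x = B' (A' f) x"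
      by (rule bounded_linear_L2_AE_cong[OF B' _ _ AB(2)]) (intro L f)+
    with AB'(2)[OF f] show ?thesis by eventually_elim simp
  qed
  ultimately show ?thesis unfolding bounded_invertible_L2_def
    using bounded_linear_L2_compose[OF A A'] bounded_linear_L2_compose[OF B' B] by blast
qed

text \<open>For e in an orthonormal basis, an operator of this form moves e to e + r and fixes the
  other basis vectors; it serves to exchange one vector.\<close>

lemma bounded_linear_L2_rank_one:
  assumes e: "L2_fun M e" and r: "L2_fun M r"
  shows "bounded_linear_L2 M (\<lambda>g x. g x + L2_inner M g e * r x)"
  unfolding bounded_linear_L2_def
proof (intro conjI allI impI exI[of _ "1 + L2_norm M e * L2_norm M r"])
  show "L2_fun M (\<lambda>x. g x + L2_inner M g e * r x)" if "L2_fun M g" for g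
    by (intro L2_fun_add L2_fun_cmult that r)
  show "AE x in M. (f x + g x) + L2_inner M (\<lambda>t. f t + g t) e * r x = (f x + L2_inner M f e * r x) + (g x + L2_inner M g e * r x)"
    if "L2_fun M f" "L2_fun M g" for f g
    using L2_inner_add_left[OF that e] by (simp add: algebra_simps)
  show "AE x in M. c * f x + L2_inner M (\<lambda>t. c * f t) e * r x = c * (f x + L2_inner M f e * r x)" for f c
    by (simp add: L2_inner_cmult_left algebra_simps)
  show "L2_norm M (\<lambda>x. g x + L2_inner M g e * r x) \<le> (1 + L2_norm M e * L2_norm M r) * L2_norm M g" if g: "L2_fun M g" for g
  proof -
    have "L2_norm M (\<lambda>x. g x + L2_inner M g e * r x) \<le> L2_norm M g + cmod (L2_inner M g e) * L2_norm M r"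
      using L2_norm_triangle[OF g L2_fun_cmult(1)[OF r, of "L2_inner M g e"]] L2_fun_cmult(2)[OF r, of "L2_inner M g e"] by simp
    also have "\<dots> \<le> L2_norm M g + (L2_norm M g * L2_norm M e) * L2_norm M r"
      using L2_cauchy_schwarz[OF g e] by (intro add_left_mono mult_right_mono) auto
    finally show ?thesis by (simp add: algebra_simps)
  qed
qed

section \<open>Coordinate functionals of a Riesz basis\<close>

definition bounded_functional_L2 :: "'a measure \<Rightarrow> (('a \<Rightarrow> complex) \<Rightarrow> complex) \<Rightarrow> bool" where
  "bounded_functional_L2 M \<phi> \<longleftrightarrow>
     (\<forall>f g. L2_fun M f \<longrightarrow> L2_fun M g \<longrightarrow> \<phi> (\<lambda>t. f t + g t) = \<phi> f + \<phi> g) \<and>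
     (\<forall>f c. L2_fun M f \<longrightarrow> \<phi> (\<lambda>t. c * f t) = c * \<phi> f) \<and>
     (\<exists>C\<ge>0. \<forall>f. L2_fun M f \<longrightarrow> cmod (\<phi> f) \<le> C * L2_norm M f)"

lemma bounded_functional_L2D:
  assumes "bounded_functional_L2 M \<phi>"
  shows "\<And>f g. L2_fun M f \<Longrightarrow> L2_fun M g \<Longrightarrow> \<phi> (\<lambda>t. f t + g t) = \<phi> f + \<phi> g"
    "\<And>f c. L2_fun M f \<Longrightarrow> \<phi> (\<lambda>t. c * f t) = c * \<phi> f"
    "\<And>f g. L2_fun M f \<Longrightarrow> L2_fun M g \<Longrightarrow> \<phi> (\<lambda>t. f t - g t) = \<phi> f - \<phi> g"
    "\<exists>C\<ge>0. \<forall>f. L2_fun M f \<longrightarrow> cmod (\<phi> f) \<le> C * L2_norm M f"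
proof -
  show 1: "\<And>f g. L2_fun M f \<Longrightarrow> L2_fun M g \<Longrightarrow> \<phi> (\<lambda>t. f t + g t) = \<phi> f + \<phi> g"
    and 2: "\<And>f c. L2_fun M f \<Longrightarrow> \<phi> (\<lambda>t. c * f t) = c * \<phi> f"
    and "\<exists>C\<ge>0. \<forall>f. L2_fun M f \<longrightarrow> cmod (\<phi> f) \<le> C * L2_norm M f"
    using assms by (simp_all add: bounded_functional_L2_def)
  show "\<phi> (\<lambda>t. f t - g t) = \<phi> f - \<phi> g" if f: "L2_fun M f" and g: "L2_fun M g" for f g
    using 1[OF f L2_fun_cmult(1)[OF g, of "-1"]] 2[OF g, of "-1"] by simp
qed

lemma bounded_functional_L2_AE_cong:
  assumes \<phi>: "bounded_functional_L2 M \<phi>" and f: "L2_fun M f" and g: "L2_fun M g" and eq: "AE x in M. f x = g x"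
  shows "\<phi> f = \<phi> g"
proof -
  obtain C where C: "\<forall>f. L2_fun M f \<longrightarrow> cmod (\<phi> f) \<le> C * L2_norm M f" using bounded_functional_L2D(4)[OF \<phi>] by blast
  note d = L2_fun_diff[OF f g]
  have "AE x in M. f x - g x = 0" using eq by eventually_elim simp
  then have "L2_norm M (\<lambda>x. f x - g x) = 0" using L2_norm_eq_0_iff[OF d] by simp
  then have "\<phi> (\<lambda>x. f x - g x) = 0" using C[rule_format, OF d] by simp
  then show ?thesis using bounded_functional_L2D(3)[OF \<phi> f g] by simp
qed

lemma bounded_functional_L2_sum:
  assumes \<phi>: "bounded_functional_L2 M \<phi>" and "\<And>j. j \<in> F \<Longrightarrow> L2_fun M (f j)"
  shows "\<phi> (\<lambda>x. \<Sum>j\<in>F. b j * f j x) = (\<Sum>j\<in>F. b j * \<phi> (f j))"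
  using assms(2)
proof (induction F rule: infinite_finite_induct)
  case (insert a F)
  then show ?case
    using bounded_functional_L2D(1)[OF \<phi> L2_fun_cmult(1)[of M "f a" "b a"] L2_fun_sum[of F M "\<lambda>j x. b j * f j x"]]
    by (simp add: L2_fun_cmult bounded_functional_L2D(2)[OF \<phi>])
qed (use bounded_functional_L2D(2)[OF \<phi> L2_fun_zero, of 0] in simp_all)

lemma bounded_functional_L2_add:
  assumes "bounded_functional_L2 M \<phi>" "bounded_functional_L2 M \<psi>"
  shows "bounded_functional_L2 M (\<lambda>g. \<phi> g + c * \<psi> g)"
proof -
  obtain C where C: "C \<ge> 0" "\<forall>f. L2_fun M f \<longrightarrow> cmod (\<phi> f) \<le> C * L2_norm M f" using bounded_functional_L2D(4)[OF assms(1)] by blast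
  obtain D where D: "D \<ge> 0" "\<forall>f. L2_fun M f \<longrightarrow> cmod (\<psi> f) \<le> D * L2_norm M f" using bounded_functional_L2D(4)[OF assms(2)] by blast
  have "cmod (\<phi> f + c * \<psi> f) \<le> (C + cmod c * D) * L2_norm M f" if f: "L2_fun M f" for f
  proof -
    have "cmod (\<phi> f + c * \<psi> f) \<le> cmod (\<phi> f) + cmod c * cmod (\<psi> f)" by (metis norm_mult norm_triangle_ineq)
    also have "\<dots> \<le> C * L2_norm M f + cmod c * (D * L2_norm M f)"
      using C D f by (intro add_mono mult_left_mono) auto
    finally show ?thesis by (simp add: algebra_simps)
  qed
  then have "\<exists>E\<ge>0. \<forall>f. L2_fun M f \<longrightarrow> cmod (\<phi> f + c * \<psi> f) \<le> E * L2_norm M f"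
    using C D by (intro exI[of _ "C + cmod c * D"]) simp
  then show ?thesis unfolding bounded_functional_L2_def
    by (simp add: bounded_functional_L2D(1,2)[OF assms(1)] bounded_functional_L2D(1,2)[OF assms(2)] algebra_simps)
qed

text \<open>If A maps the orthonormal basis e to f and B is its inverse, the coordinate c j g is the
  inner product of B g with e j. For the exchange, let P fix e i for i other than j and send e j to
  B g. P is the identity plus a rank one operator, invertible because its diagonal coefficient c j g
  is nonzero, and A P maps the same orthonormal basis to the new system.\<close>

theorem riesz_basis_coordinates:
  fixes f :: "'i \<Rightarrow> 'a \<Rightarrow> complex"
  assumes rb: "riesz_basis_L2 M J f"
  obtains c where "\<And>j. j \<in> J \<Longrightarrow> bounded_functional_L2 M (c j)"
    "\<And>i j. i \<in> J \<Longrightarrow> j \<in> J \<Longrightarrow> c j (f i) = (if i = j then 1 else 0)"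
    "\<And>g. L2_fun M g \<Longrightarrow> \<forall>j\<in>J. c j g = 0 \<Longrightarrow> AE x in M. g x = 0"
    "\<And>\<phi> g. bounded_functional_L2 M \<phi> \<Longrightarrow> \<forall>j\<in>J. \<phi> (f j) = 0 \<Longrightarrow> L2_fun M g \<Longrightarrow> \<phi> g = 0"
    "\<And>j g. j \<in> J \<Longrightarrow> L2_fun M g \<Longrightarrow> c j g \<noteq> 0 \<Longrightarrow> riesz_basis_L2 M J (f(j := g))"
proof -
  obtain e A where e: "orthonormal_basis_L2 M J e" and inv: "bounded_invertible_L2 M A"
    and fA: "\<And>j. j \<in> J \<Longrightarrow> AE x in M. f j x = A (e j) x" and fL: "\<And>j. j \<in> J \<Longrightarrow> L2_fun M (f j)"
    using rb unfolding riesz_basis_L2_def by blast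
  obtain B where A: "bounded_linear_L2 M A" and B: "bounded_linear_L2 M B"
    and AB: "\<And>f. L2_fun M f \<Longrightarrow> AE x in M. A (B f) x = f x" "\<And>f. L2_fun M f \<Longrightarrow> AE x in M. B (A f) x = f x"
    using inv unfolding bounded_invertible_L2_def by blast
  note AL = bounded_linear_L2D(1)[OF A] and BL = bounded_linear_L2D(1)[OF B]
  have eL: "\<And>j. j \<in> J \<Longrightarrow> L2_fun M (e j)"
    and eo: "\<And>i j. i \<in> J \<Longrightarrow> j \<in> J \<Longrightarrow> L2_inner M (e i) (e j) = (if i = j then 1 else 0)"
    and ed: "\<forall>f. L2_fun M f \<longrightarrow> (\<forall>\<epsilon>>0. \<exists>F c. finite F \<and> F \<subseteq> J \<and>
        L2_norm M (\<lambda>x. f x - (\<Sum>j\<in>F. c j * e j x)) < \<epsilon>)"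
    using e unfolding orthonormal_basis_L2_def by simp_all
  define c where "c j g = L2_inner M (B g) (e j)" for j g
  obtain D where D: "D \<ge> 0" "\<forall>f. L2_fun M f \<longrightarrow> L2_norm M (B f) \<le> D * L2_norm M f" using bounded_linear_L2D(4)[OF B] by blast
  have cf: "bounded_functional_L2 M (c j)" if j: "j \<in> J" for j
    unfolding bounded_functional_L2_def
  proof (intro conjI allI impI exI[of _ "D * L2_norm M (e j)"])
    show "c j (\<lambda>t. f t + g t) = c j f + c j g" if f: "L2_fun M f" and g: "L2_fun M g" for f g
      unfolding c_def L2_inner_add_left[OF BL[OF f] BL[OF g] eL[OF j], symmetric]
      by (rule L2_inner_AE_cong[OF bounded_linear_L2D(2)[OF B f g] BL[OF L2_fun_add[OF f g]] L2_fun_add[OF BL[OF f] BL[OF g]] eL[OF j]])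
    show "c j (\<lambda>t. k * f t) = k * c j f" if f: "L2_fun M f" for f k
      unfolding c_def L2_inner_cmult_left[symmetric]
      by (rule L2_inner_AE_cong[OF bounded_linear_L2D(3)[OF B f] BL[OF L2_fun_cmult(1)[OF f]] L2_fun_cmult(1)[OF BL[OF f]] eL[OF j]])
    show "cmod (c j f) \<le> D * L2_norm M (e j) * L2_norm M f" if f: "L2_fun M f" for f
    proof -
      have "cmod (c j f) \<le> L2_norm M (B f) * L2_norm M (e j)" unfolding c_def by (rule L2_cauchy_schwarz[OF BL[OF f] eL[OF j]])
      also have "\<dots> \<le> (D * L2_norm M f) * L2_norm M (e j)" using D f by (intro mult_right_mono) auto
      finally show ?thesis by (simp add: mult_ac)
    qed
    show "0 \<le> D * L2_norm M (e j)" using D by simp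
  qed
  have Bf: "AE x in M. B (f i) x = e i x" if i: "i \<in> J" for i
    using bounded_linear_L2_AE_cong[OF B fL[OF i] AL[OF eL[OF i]] fA[OF i]] AB(2)[OF eL[OF i]] by eventually_elim simp
  have bi: "c j (f i) = (if i = j then 1 else 0)" if i: "i \<in> J" and j: "j \<in> J" for i j
    unfolding c_def eo[OF i j, symmetric]
    by (rule L2_inner_AE_cong[OF Bf[OF i] BL[OF fL[OF i]] eL[OF i] eL[OF j]])
  have total: "AE x in M. g x = 0" if g: "L2_fun M g" and z: "\<And>j. j \<in> J \<Longrightarrow> c j g = 0" for g
  proof -
    have "AE x in M. B g x = 0" by (rule orthonormal_basis_total[OF e BL[OF g]]) (use z in \<open>simp add: c_def\<close>)
    then have "AE x in M. A (B g) x = A (\<lambda>x. 0) x" by (rule bounded_linear_L2_AE_cong[OF A BL[OF g] L2_fun_zero])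
    moreover have "AE x in M. A (\<lambda>x. 0) x = 0" using bounded_linear_L2D(3)[OF A L2_fun_zero, of 0] by simp
    ultimately show ?thesis using AB(1)[OF g] by eventually_elim simp
  qed
  have dens: "\<phi> g = 0" if \<phi>: "bounded_functional_L2 M \<phi>" and z: "\<And>j. j \<in> J \<Longrightarrow> \<phi> (f j) = 0" and g: "L2_fun M g" for \<phi> g
  proof -
    obtain C where C: "C \<ge> 0" "\<forall>f. L2_fun M f \<longrightarrow> cmod (\<phi> f) \<le> C * L2_norm M f" using bounded_functional_L2D(4)[OF \<phi>] by blast
    obtain A' where A': "A' \<ge> 0" "\<forall>f. L2_fun M f \<longrightarrow> L2_norm M (A f) \<le> A' * L2_norm M f" using bounded_linear_L2D(4)[OF A] by blast
    have phiA: "\<phi> (A u) = \<phi> (A v)" if "L2_fun M u" "L2_fun M v" "AE x in M. u x = v x" for u v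
      by (rule bounded_functional_L2_AE_cong[OF \<phi> AL AL bounded_linear_L2_AE_cong[OF A]]) (rule that)+
    \<comment> \<open>Composed with A the functional vanishes on every e j, and the span of these is
      dense.\<close>
    have pA: "bounded_functional_L2 M (\<lambda>u. \<phi> (A u))"
      unfolding bounded_functional_L2_def
    proof (intro conjI allI impI exI[of _ "C * A'"])
      show "\<phi> (A (\<lambda>t. u t + v t)) = \<phi> (A u) + \<phi> (A v)" if u: "L2_fun M u" and v: "L2_fun M v" for u v
        unfolding bounded_functional_L2D(1)[OF \<phi> AL[OF u] AL[OF v], symmetric]
        by (rule bounded_functional_L2_AE_cong[OF \<phi> AL[OF L2_fun_add[OF u v]] L2_fun_add[OF AL[OF u] AL[OF v]] bounded_linear_L2D(2)[OF A u v]])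
      show "\<phi> (A (\<lambda>t. k * u t)) = k * \<phi> (A u)" if u: "L2_fun M u" for u k
        unfolding bounded_functional_L2D(2)[OF \<phi> AL[OF u], symmetric]
        by (rule bounded_functional_L2_AE_cong[OF \<phi> AL[OF L2_fun_cmult(1)[OF u]] L2_fun_cmult(1)[OF AL[OF u]] bounded_linear_L2D(3)[OF A u]])
      show "0 \<le> C * A'" using C A' by simp
      show "cmod (\<phi> (A u)) \<le> C * A' * L2_norm M u" if u: "L2_fun M u" for u
      proof -
        have "cmod (\<phi> (A u)) \<le> C * L2_norm M (A u)" using C AL[OF u] by blast
        also have "\<dots> \<le> C * (A' * L2_norm M u)" using C A' u by (intro mult_left_mono) auto
        finally show ?thesis by (simp add: mult.assoc)
      qed
    qed
    have "\<phi> (A (e j)) = 0" if j: "j \<in> J" for j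
      using z[OF j] bounded_functional_L2_AE_cong[OF \<phi> fL[OF j] AL[OF eL[OF j]] fA[OF j]] by simp
    then have van: "\<phi> (A (\<lambda>x. \<Sum>j\<in>F. b j * e j x)) = 0" if "F \<subseteq> J" for F b
      using that eL by (subst bounded_functional_L2_sum[OF pA]) (auto intro!: sum.neutral)
    have small: "cmod (\<phi> (A (B g))) \<le> C * A' * \<epsilon>" if eps: "\<epsilon> > 0" for \<epsilon>
    proof -
      from ed[rule_format, OF BL[OF g] eps] obtain F b
        where "finite F \<and> F \<subseteq> J \<and> L2_norm M (\<lambda>x. B g x - (\<Sum>j\<in>F. b j * e j x)) < \<epsilon>" by (elim exE)
      then have F: "finite F" "F \<subseteq> J" "L2_norm M (\<lambda>x. B g x - (\<Sum>j\<in>F. b j * e j x)) < \<epsilon>" by auto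
      have sL: "L2_fun M (\<lambda>x. \<Sum>j\<in>F. b j * e j x)" using F eL by (intro L2_fun_sum L2_fun_cmult) auto
      have "\<phi> (A (B g)) = \<phi> (A (\<lambda>x. B g x - (\<Sum>j\<in>F. b j * e j x)))"
        using bounded_functional_L2D(3)[OF pA BL[OF g] sL] van[OF F(2)] by simp
      also have "cmod \<dots> \<le> C * L2_norm M (A (\<lambda>x. B g x - (\<Sum>j\<in>F. b j * e j x)))"
        using C AL[OF L2_fun_diff[OF BL[OF g] sL]] by blast
      also have "\<dots> \<le> C * (A' * L2_norm M (\<lambda>x. B g x - (\<Sum>j\<in>F. b j * e j x)))"
        using C A' L2_fun_diff[OF BL[OF g] sL] by (intro mult_left_mono) auto
      also have "\<dots> \<le> C * (A' * \<epsilon>)" using C A' F by (intro mult_left_mono) auto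
      finally show ?thesis by (simp add: mult.assoc)
    qed
    have "cmod (\<phi> (A (B g))) \<le> 0"
    proof (cases "C * A' = 0")
      case False
      then have pos: "C * A' > 0" using C A' by (simp add: less_le)
      show ?thesis
      proof (rule field_le_epsilon)
        fix \<epsilon> :: real assume "\<epsilon> > 0"
        then have "cmod (\<phi> (A (B g))) \<le> C * A' * (\<epsilon> / (C * A'))" using pos by (intro small) simp
        also have "\<dots> = \<epsilon>" using nonzero_mult_div_cancel_left[OF False, of \<epsilon>] by (simp only: times_divide_eq_right)
        finally show "cmod (\<phi> (A (B g))) \<le> 0 + \<epsilon>" by simp
      qed
    next
      case True
      then show ?thesis using small[OF zero_less_one] by (simp only: mult_zero_left)
    qed
    then show ?thesis
      using bounded_functional_L2_AE_cong[OF \<phi> AL[OF BL[OF g]] g AB(1)[OF g]] by simp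
  qed
  have exch: "riesz_basis_L2 M J (f(j := g))" if j: "j \<in> J" and g: "L2_fun M g" and nz: "c j g \<noteq> 0" for j g
  proof -
    define v where "v = B g"
    define k where "k = L2_inner M v (e j)"
    have k0: "k \<noteq> 0" using nz by (simp add: k_def v_def c_def)
    have vL: "L2_fun M v" unfolding v_def by (rule BL[OF g])
    define r where "r x = v x - e j x" for x
    have rL: "L2_fun M r" unfolding r_def[abs_def] by (rule L2_fun_diff[OF vL eL[OF j]])
    have re: "L2_inner M r (e j) = k - 1"
      unfolding r_def[abs_def] using L2_inner_diff_left[OF vL eL[OF j] eL[OF j]] eo[OF j j] by (simp add: k_def)
    define P where "P u x = u x + L2_inner M u (e j) * r x" for u x
    \<comment> \<open>The inverse of 1 + r <., e j> is 1 - r <., e j> / (1 + <r, e j>), and here 1 +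
      <r, e j> = k.\<close>
    define r' where "r' x = (- 1 / k) * r x" for x
    have rL': "L2_fun M r'" unfolding r'_def[abs_def] by (rule L2_fun_cmult(1)[OF rL])
    define Q where "Q u x = u x + L2_inner M u (e j) * r' x" for u x
    have P: "bounded_linear_L2 M P" unfolding P_def[abs_def] by (rule bounded_linear_L2_rank_one[OF eL[OF j] rL])
    have Q: "bounded_linear_L2 M Q" unfolding Q_def[abs_def] by (rule bounded_linear_L2_rank_one[OF eL[OF j] rL'])
    have Pe: "L2_inner M (P u) (e j) = L2_inner M u (e j) * k" if u: "L2_fun M u" for u
    proof -
      have "L2_inner M (P u) (e j) = L2_inner M u (e j) + L2_inner M u (e j) * (k - 1)"
        unfolding P_def[abs_def] using L2_inner_add_left[OF u L2_fun_cmult(1)[OF rL] eL[OF j]] re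
        by (simp add: L2_inner_cmult_left)
      then show ?thesis by (simp add: algebra_simps)
    qed
    have re': "L2_inner M r' (e j) = (- 1 / k) * (k - 1)"
      unfolding r'_def[abs_def] L2_inner_cmult_left re ..
    have Qe: "L2_inner M (Q u) (e j) = L2_inner M u (e j) / k" if u: "L2_fun M u" for u
    proof -
      have "L2_inner M (Q u) (e j) = L2_inner M u (e j) + L2_inner M u (e j) * ((- 1 / k) * (k - 1))"
        unfolding Q_def[abs_def] using L2_inner_add_left[OF u L2_fun_cmult(1)[OF rL'] eL[OF j]] re'
        by (simp add: L2_inner_cmult_left)
      then show ?thesis using k0 by (simp add: field_simps)
    qed
    have PQ: "P (Q u) x = u x" and QP: "Q (P u) x = u x" if u: "L2_fun M u" for u x
      using Pe[OF u] Qe[OF u] k0 by (simp_all add: P_def[of "Q u"] Q_def[of u] Q_def[of "P u"] P_def[of u] r'_def)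
    have "bounded_invertible_L2 M P"
      unfolding bounded_invertible_L2_def using P Q PQ QP by (intro conjI exI[of _ Q]) auto
    then have inv': "bounded_invertible_L2 M (\<lambda>u. A (P u))" by (rule bounded_invertible_L2_compose[OF inv])
    have "AE x in M. (f(j := g)) i x = A (P (e i)) x" if i: "i \<in> J" for i
    proof (cases "i = j")
      case True
      have "P (e j) = v" using eo[OF j j] by (simp add: fun_eq_iff P_def r_def)
      then show ?thesis using AB(1)[OF g] True by (simp add: v_def eq_commute)
    next
      case False
      have "P (e i) = e i" using eo[OF i j] False by (simp add: fun_eq_iff P_def)
      then show ?thesis using fA[OF i] False by simp
    qed
    then show ?thesis unfolding riesz_basis_L2_def using e inv' fL g by (intro conjI exI[of _ e] exI[of _ "\<lambda>u. A (P u)"]) auto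
  qed
  show ?thesis
  proof (rule that[of c])
    show "AE x in M. g x = 0" if "L2_fun M g" "\<forall>j\<in>J. c j g = 0" for g
      using that by (intro total) auto
    show "\<phi> g = 0" if "bounded_functional_L2 M \<phi>" "\<forall>j\<in>J. \<phi> (f j) = 0" "L2_fun M g" for \<phi> g
      using that(2) by (intro dens[OF that(1) _ that(3)]) auto
  qed (simp_all add: cf bi exch)
qed

section \<open>Rescaling, renumbering and perturbing Riesz bases\<close>

lemma riesz_basis_L2_cmult:
  assumes "riesz_basis_L2 M J f" "k \<noteq> 0"
  shows "riesz_basis_L2 M J (\<lambda>j x. k * f j x)"
proof -
  obtain e A where e: "orthonormal_basis_L2 M J e" and inv: "bounded_invertible_L2 M A"
    and fA: "\<And>j. j \<in> J \<Longrightarrow> AE x in M. f j x = A (e j) x" and fL: "\<And>j. j \<in> J \<Longrightarrow> L2_fun M (f j)"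
    using assms(1) unfolding riesz_basis_L2_def by blast
  have lin: "bounded_linear_L2 M (\<lambda>u x. a * u x)" for a
    unfolding bounded_linear_L2_def
    by (intro conjI exI[of _ "cmod a"]) (auto simp: L2_fun_cmult algebra_simps)
  have "bounded_invertible_L2 M (\<lambda>u x. k * u x)"
    unfolding bounded_invertible_L2_def using assms(2) by (intro conjI lin exI[of _ "\<lambda>u x. (1/k) * u x"]) auto
  then have "bounded_invertible_L2 M (\<lambda>u x. k * A u x)" by (rule bounded_invertible_L2_compose[OF _ inv])
  moreover have "AE x in M. k * f j x = k * A (e j) x" if "j \<in> J" for j
    using fA[OF that] by eventually_elim simp
  moreover have "L2_fun M (\<lambda>x. k * f j x)" if "j \<in> J" for j by (rule L2_fun_cmult(1)[OF fL[OF that]])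
  ultimately show ?thesis unfolding riesz_basis_L2_def using e
    by (intro conjI exI[of _ e] exI[of _ "\<lambda>u x. k * A u x"]) auto
qed

text \<open>The operator stays the same; only the orthonormal basis is renumbered.\<close>

lemma riesz_basis_L2_reindex:
  assumes rb: "riesz_basis_L2 M J f" and \<pi>: "bij_betw \<pi> I J"
  shows "riesz_basis_L2 M I (\<lambda>i. f (\<pi> i))"
proof -
  obtain e A where e: "orthonormal_basis_L2 M J e" and inv: "bounded_invertible_L2 M A"
    and fA: "\<And>j. j \<in> J \<Longrightarrow> AE x in M. f j x = A (e j) x" and fL: "\<And>j. j \<in> J \<Longrightarrow> L2_fun M (f j)"
    using rb unfolding riesz_basis_L2_def by blast
  have pJ: "\<pi> i \<in> J" if "i \<in> I" for i using \<pi> that by (auto simp: bij_betw_def)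
  have inj: "\<pi> i = \<pi> j \<longleftrightarrow> i = j" if "i \<in> I" "j \<in> I" for i j using \<pi> that by (auto simp: bij_betw_def inj_on_def)
  have eL: "\<And>j. j \<in> J \<Longrightarrow> L2_fun M (e j)"
    and eo: "\<And>i j. i \<in> J \<Longrightarrow> j \<in> J \<Longrightarrow> L2_inner M (e i) (e j) = (if i = j then 1 else 0)"
    and ed: "\<forall>f. L2_fun M f \<longrightarrow> (\<forall>\<epsilon>>0. \<exists>F c. finite F \<and> F \<subseteq> J \<and>
        L2_norm M (\<lambda>x. f x - (\<Sum>j\<in>F. c j * e j x)) < \<epsilon>)"
    using e unfolding orthonormal_basis_L2_def by simp_all
  have "orthonormal_basis_L2 M I (\<lambda>i. e (\<pi> i))" unfolding orthonormal_basis_L2_def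
  proof (intro conjI ballI allI impI)
    show "L2_fun M (e (\<pi> i))" if "i \<in> I" for i using eL pJ that by blast
    show "L2_inner M (e (\<pi> i)) (e (\<pi> j)) = (if i = j then 1 else 0)" if "i \<in> I" "j \<in> I" for i j
      using eo[OF pJ pJ] that inj by simp
    fix u and \<epsilon> :: real assume u: "L2_fun M u" and eps: "\<epsilon> > 0"
    from ed[rule_format, OF u eps] obtain F b
      where "finite F \<and> F \<subseteq> J \<and> L2_norm M (\<lambda>x. u x - (\<Sum>j\<in>F. b j * e j x)) < \<epsilon>" by (elim exE)
    then have F: "finite F" "F \<subseteq> J" "L2_norm M (\<lambda>x. u x - (\<Sum>j\<in>F. b j * e j x)) < \<epsilon>" by auto
    define G where "G = {i \<in> I. \<pi> i \<in> F}"
    have bij: "bij_betw \<pi> G F" using \<pi> F(2) by (auto simp: G_def bij_betw_def inj_on_def)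
    have "finite G" using bij F(1) by (simp add: bij_betw_finite)
    moreover have "(\<Sum>j\<in>F. b j * e j x) = (\<Sum>i\<in>G. b (\<pi> i) * e (\<pi> i) x)" for x
      using sum.reindex_bij_betw[OF bij, of "\<lambda>j. b j * e j x"] by simp
    ultimately show "\<exists>F c. finite F \<and> F \<subseteq> I \<and> L2_norm M (\<lambda>x. u x - (\<Sum>j\<in>F. c j * e (\<pi> j) x)) < \<epsilon>"
      using F(3) by (intro exI[of _ G] exI[of _ "\<lambda>i. b (\<pi> i)"]) (auto simp: G_def)
  qed
  then show ?thesis unfolding riesz_basis_L2_def using inv fA fL pJ
    by (intro conjI exI[of _ "\<lambda>i. e (\<pi> i)"] exI[of _ A]) auto
qed

text \<open>Uniform smallness of the perturbations makes the perturbing operator map into bounded continuous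
  functions, where the equation f + K f = g is solved by a contraction in the supremum norm.\<close>

theorem riesz_basis_perturbation:
  fixes e d :: "nat \<Rightarrow> real \<Rightarrow> complex" and \<delta> :: "nat \<Rightarrow> real"
  assumes e: "orthonormal_basis_L2 LP UNIV e" and dc: "\<And>j. continuous_on {0..pi} (d j)"
    and db: "\<And>j x. x \<in> {0..pi} \<Longrightarrow> cmod (d j x) \<le> \<delta> j"
    and \<delta>: "summable (\<lambda>j. (\<delta> j)\<^sup>2)" and small: "pi * (\<Sum>j. (\<delta> j)\<^sup>2) < 1"
  shows "riesz_basis_L2 LP UNIV (\<lambda>j x. e j x + d j x)"
proof -
  have eL: "\<And>j. L2_fun LP (e j)"
    and eo: "\<And>i j. L2_inner LP (e i) (e j) = (if i = j then 1 else 0)"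
    using e unfolding orthonormal_basis_L2_def by simp_all
  have \<delta>0: "\<delta> j \<ge> 0" for j using order_trans[OF norm_ge_zero db[of 0 j]] by simp
  define \<theta> where "\<theta> = sqrt (\<Sum>j. (\<delta> j)\<^sup>2)"
  have \<theta>0: "\<theta> \<ge> 0" unfolding \<theta>_def by (simp add: suminf_nonneg[OF \<delta>])
  \<comment> \<open>\<theta> bounds K from L2 to the supremum norm. An L2 norm on [0, pi] is at most
    sqrt pi times the supremum, so \<rho> bounds K on either space.\<close>
  define \<rho> where "\<rho> = sqrt pi * \<theta>"
  have \<rho>: "0 \<le> \<rho>" "\<rho> < 1"
  proof -
    show "0 \<le> \<rho>" using \<theta>0 by (simp add: \<rho>_def)
    have "\<rho> = sqrt (pi * (\<Sum>j. (\<delta> j)\<^sup>2))" by (simp add: \<rho>_def \<theta>_def real_sqrt_mult)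
    then show "\<rho> < 1" using small by simp
  qed
  define a where "a g j = L2_inner LP g (e j)" for g j
  define K where "K g x = (\<Sum>j. a g j * d j x)" for g x
  \<comment> \<open>Cauchy-Schwarz, with Bessel's inequality for the coefficients.\<close>
  have part: "(\<Sum>j<n. cmod (a g j) * \<delta> j) \<le> L2_norm LP g * \<theta>" if g: "L2_fun LP g" for g n
  proof -
    have "(\<Sum>j<n. cmod (a g j) * \<delta> j) = (\<Sum>j<n. \<bar>cmod (a g j)\<bar> * \<bar>\<delta> j\<bar>)" using \<delta>0 by simp
    also have "\<dots> \<le> L2_set (\<lambda>j. cmod (a g j)) {..<n} * L2_set \<delta> {..<n}" by (rule L2_set_mult_ineq)
    also have "\<dots> \<le> L2_norm LP g * \<theta>"
    proof (rule mult_mono)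
      have "(\<Sum>j<n. (cmod (a g j))\<^sup>2) \<le> (L2_norm LP g)\<^sup>2"
        unfolding a_def by (rule L2_bessel(1)) (auto intro: eL g simp: eo)
      then show "L2_set (\<lambda>j. cmod (a g j)) {..<n} \<le> L2_norm LP g"
        unfolding L2_set_def by (intro real_le_lsqrt) (auto intro: sum_nonneg)
      have "(\<Sum>j<n. (\<delta> j)\<^sup>2) \<le> (\<Sum>j. (\<delta> j)\<^sup>2)" by (rule sum_le_suminf[OF \<delta>]) auto
      then show "L2_set \<delta> {..<n} \<le> \<theta>" unfolding L2_set_def \<theta>_def by (rule real_sqrt_le_mono)
    qed (auto intro: L2_set_nonneg)
    finally show ?thesis .
  qed
  have sm: "summable (\<lambda>j. cmod (a g j) * \<delta> j)" and sb: "(\<Sum>j. cmod (a g j) * \<delta> j) \<le> \<theta> * L2_norm LP g"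
    if g: "L2_fun LP g" for g
  proof -
    show s: "summable (\<lambda>j. cmod (a g j) * \<delta> j)"
      by (rule summableI_nonneg_bounded[OF _ part[OF g]]) (simp add: \<delta>0)
    have "(\<Sum>j. cmod (a g j) * \<delta> j) \<le> L2_norm LP g * \<theta>" by (rule suminf_le_const[OF s part[OF g]])
    then show "(\<Sum>j. cmod (a g j) * \<delta> j) \<le> \<theta> * L2_norm LP g" by (simp add: mult.commute)
  qed
  have tb: "cmod (a g j * d j x) \<le> cmod (a g j) * \<delta> j" if "x \<in> {0..pi}" for g j x
    using db[OF that] by (simp add: norm_mult mult_left_mono)
  have sn: "summable (\<lambda>j. cmod (a g j * d j x))" if "L2_fun LP g" "x \<in> {0..pi}" for g x
    by (rule summable_comparison_test'[OF sm[OF that(1)], of 0]) (use tb[OF that(2)] in simp)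
  have sK: "summable (\<lambda>j. a g j * d j x)" if "L2_fun LP g" "x \<in> {0..pi}" for g x
    by (rule summable_norm_cancel[OF sn[OF that]])
  have Kb: "cmod (K g x) \<le> \<theta> * L2_norm LP g" if g: "L2_fun LP g" and x: "x \<in> {0..pi}" for g x
  proof -
    have "cmod (K g x) \<le> (\<Sum>j. cmod (a g j * d j x))" unfolding K_def by (rule summable_norm[OF sn[OF g x]])
    also have "\<dots> \<le> (\<Sum>j. cmod (a g j) * \<delta> j)" by (rule suminf_le[OF tb[OF x] sn[OF g x] sm[OF g]])
    also have "\<dots> \<le> \<theta> * L2_norm LP g" by (rule sb[OF g])
    finally show ?thesis .
  qed
  have Kc: "continuous_on {0..pi} (K g)" if g: "L2_fun LP g" for g
  proof (rule uniform_limit_theorem)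
    show "uniform_limit {0..pi} (\<lambda>n x. \<Sum>j<n. a g j * d j x) (K g) sequentially"
      unfolding K_def[abs_def] by (rule Weierstrass_m_test[OF tb sm[OF g]])
    show "\<forall>\<^sub>F n in sequentially. continuous_on {0..pi} (\<lambda>x. \<Sum>j<n. a g j * d j x)"
      by (intro always_eventually allI continuous_intros dc)
  qed simp
  have KL: "L2_fun LP (K g)" if "L2_fun LP g" for g by (rule L2_continuous[OF Kc[OF that]])
  have Kn: "L2_norm LP (K g) \<le> \<rho> * L2_norm LP g" if "L2_fun LP g" for g
    using L2_bounded(2)[OF L2_funD(1)[OF KL[OF that]] Kb[OF that]] by (simp add: \<rho>_def mult.assoc)
  have Kadd: "K (\<lambda>t. f t + g t) x = K f x + K g x" if "L2_fun LP f" "L2_fun LP g" "x \<in> {0..pi}" for f g x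
    using suminf_add[OF sK[OF that(1,3)] sK[OF that(2,3)]] L2_inner_add_left[OF that(1,2) eL]
    by (simp add: K_def a_def distrib_right)
  have Kmul: "K (\<lambda>t. c * f t) x = c * K f x" if "L2_fun LP f" "x \<in> {0..pi}" for c f x
    using suminf_mult[OF sK[OF that], of c] by (simp add: K_def a_def L2_inner_cmult_left mult.assoc)
  have Kdiff: "K (\<lambda>t. f t - g t) x = K f x - K g x" if "L2_fun LP f" "L2_fun LP g" "x \<in> {0..pi}" for f g x
    using Kadd[OF that(1) L2_fun_cmult(1)[OF that(2), of "-1"] that(3)] Kmul[OF that(2,3), of "-1"] by simp
  define A where "A g x = g x + K g x" for g x
  have AL: "L2_fun LP (A g)" if "L2_fun LP g" for g
    unfolding A_def[abs_def] by (rule L2_fun_add[OF that KL[OF that]])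
  have A: "bounded_linear_L2 LP A" unfolding bounded_linear_L2_def
  proof (intro conjI allI impI exI[of _ "1 + \<rho>"])
    show "L2_fun LP (A f)" if "L2_fun LP f" for f by (rule AL[OF that])
    show "AE x in LP. A (\<lambda>t. f t + g t) x = A f x + A g x" if "L2_fun LP f" "L2_fun LP g" for f g
      by (rule AE_I2) (use Kadd[OF that] in \<open>simp add: A_def\<close>)
    show "AE x in LP. A (\<lambda>t. c * f t) x = c * A f x" if "L2_fun LP f" for f c
      by (rule AE_I2) (use Kmul[OF that] in \<open>simp add: A_def distrib_left\<close>)
    show "L2_norm LP (A f) \<le> (1 + \<rho>) * L2_norm LP f" if f: "L2_fun LP f" for f
      using L2_norm_triangle[OF f KL[OF f]] Kn[OF f] by (simp add: A_def[abs_def] distrib_right)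
  qed
  have inv: "bounded_invertible_L2 LP A"
  proof (rule bounded_invertible_L2I[OF A])
    show "L2_norm LP f \<le> (1 / (1 - \<rho>)) * L2_norm LP (A f)" if f: "L2_fun LP f" for f
    proof -
      have "L2_norm LP (\<lambda>x. A f x - K f x) \<le> L2_norm LP (A f) + L2_norm LP (\<lambda>x. (-1) * K f x)"
        using L2_norm_triangle[OF AL[OF f] L2_fun_cmult(1)[OF KL[OF f], of "-1"]] by simp
      then have "L2_norm LP f \<le> L2_norm LP (A f) + \<rho> * L2_norm LP f"
        using Kn[OF f] L2_fun_cmult(2)[OF KL[OF f], of "-1"] by (simp add: A_def)
      then have "(1 - \<rho>) * L2_norm LP f \<le> L2_norm LP (A f)" by (simp add: algebra_simps)
      then show ?thesis using \<rho> by (simp add: field_simps)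
    qed
    fix g assume g: "L2_fun LP g"
    define cl :: "real \<Rightarrow> real" where "cl x = max 0 (min x pi)" for x
    have cl: "cl x \<in> {0..pi}" for x by (auto simp: cl_def)
    have clc: "continuous_on UNIV cl" unfolding cl_def[abs_def] by (intro continuous_intros)
    have uL: "L2_fun LP (apply_bcontfun u)" for u by (rule L2_continuous[OF continuous_on_apply_bcontfun])
    note guL = L2_fun_diff[OF g uL]
    \<comment> \<open>Writing f = g - u turns f + K f = g into u = K (g - u), whose unknown u is
      continuous although g need not be.\<close>
    define T where "T u = Bcontfun (\<lambda>x. K (\<lambda>t. g t - apply_bcontfun u t) (cl x))" for u
    have T: "apply_bcontfun (T u) x = K (\<lambda>t. g t - apply_bcontfun u t) (cl x)" for u x
    proof -
      have "(\<lambda>x. K (\<lambda>t. g t - apply_bcontfun u t) (cl x)) \<in> bcontfun"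
        by (rule bcontfun_normI[OF continuous_on_compose2[OF Kc[OF guL] clc] Kb[OF guL cl]]) (use cl in auto)
      then show ?thesis unfolding T_def by (simp add: Bcontfun_inverse)
    qed
    have "\<exists>!u. T u = u"
    proof (rule banach_fix_type[OF \<rho>], intro allI dist_bound)
      fix u v x
      note uv = L2_fun_diff[OF uL[of v] uL[of u]]
      have "apply_bcontfun (T u) x - apply_bcontfun (T v) x = K (\<lambda>t. apply_bcontfun v t - apply_bcontfun u t) (cl x)"
        using Kdiff[OF guL[of u] guL[of v] cl[of x]] by (simp add: T)
      then have "dist (apply_bcontfun (T u) x) (apply_bcontfun (T v) x) \<le> \<theta> * L2_norm LP (\<lambda>t. apply_bcontfun v t - apply_bcontfun u t)"
        using Kb[OF uv cl[of x]] by (simp add: dist_norm)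
      also have "\<dots> \<le> \<theta> * (sqrt pi * dist u v)"
      proof (rule mult_left_mono[OF L2_bounded(2)[OF L2_funD(1)[OF uv]] \<theta>0])
        show "cmod (apply_bcontfun v t - apply_bcontfun u t) \<le> dist u v" for t
          using dist_bounded[of u t v] by (simp add: dist_norm norm_minus_commute)
      qed
      finally show "dist (apply_bcontfun (T u) x) (apply_bcontfun (T v) x) \<le> \<rho> * dist u v"
        by (simp add: \<rho>_def mult_ac)
    qed
    then obtain u where u: "T u = u" by blast
    have "A (\<lambda>t. g t - apply_bcontfun u t) x = g x" if x: "x \<in> {0..pi}" for x
    proof -
      have "cl x = x" using x by (auto simp: cl_def)
      then have "apply_bcontfun u x = K (\<lambda>t. g t - apply_bcontfun u t) x" using T[of u x] u by simp
      then show ?thesis by (simp add: A_def)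
    qed
    then show "\<exists>f. L2_fun LP f \<and> (AE x in LP. A f x = g x)"
      using guL[of u] by (intro exI[of _ "\<lambda>t. g t - apply_bcontfun u t"] conjI AE_I2) auto
  qed
  have Ae: "A (e i) x = e i x + d i x" for i x
  proof -
    have "K (e i) x = (\<Sum>j. if j = i then d i x else 0)"
      unfolding K_def a_def eo by (intro suminf_cong) auto
    also have "\<dots> = d i x" using sums_unique[OF sums_single[of i "\<lambda>_. d i x"]] by simp
    finally show ?thesis by (simp add: A_def)
  qed
  show ?thesis unfolding riesz_basis_L2_def
    using e inv Ae L2_fun_add[OF eL L2_continuous[OF dc]]
    by (intro conjI exI[of _ e] exI[of _ A]) auto
qed

subsection \<open>Exchanging sine functions in a Riesz basis\<close>

lemma L2_fun_integrable:
  assumes g: "L2_fun LP g" and c: "continuous_on {0..pi} c" and t: "t \<in> {0..pi}"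
  shows "(\<lambda>x. c x * g x) integrable_on {0..t}"
proof -
  have "integrable LP (\<lambda>x. g x * cnj (cnj (c x)))"
    by (rule L2_mult_integrable[OF g L2_continuous]) (intro continuous_intros c)
  then have "integrable LP (\<lambda>x. c x * g x)" by (simp add: mult.commute)
  then have "(\<lambda>x. c x * g x) integrable_on {0..pi}" by (rule integrable_on_lebesgue_on) simp
  then show ?thesis by (rule integrable_on_subinterval) (use t in auto)
qed

lemma L2_fun_integral_bound:
  assumes g: "L2_fun LP g" and c: "continuous_on {0..pi} c" and t: "t \<in> {0..pi}"
    and C: "\<And>x. x \<in> {0..pi} \<Longrightarrow> cmod (c x) \<le> C"
  shows "cmod (integral {0..t} (\<lambda>x. c x * g x)) \<le> C * sqrt pi * L2_norm LP g"
proof -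
  have C0: "C \<ge> 0" using order_trans[OF norm_ge_zero C[of 0]] by simp
  have gL: "L2_fun LP (\<lambda>x. of_real (cmod (g x)))" "L2_norm LP (\<lambda>x. of_real (cmod (g x))) = L2_norm LP g"
    using g by (auto simp: L2_fun_def L2_norm_def)
  have oL: "L2_fun LP (\<lambda>x. 1)" "L2_norm LP (\<lambda>x. 1) \<le> sqrt pi" using L2_bounded[of "\<lambda>x. 1" 1] by auto
  have ig: "integrable LP (\<lambda>x. cmod (g x))"
  proof -
    have "integrable LP (\<lambda>x. complex_of_real (cmod (g x)))" using L2_mult_integrable[OF gL(1) oL(1)] by simp
    from Bochner_Integration.integrable_norm[OF this] show ?thesis by simp
  qed
  have igS: "(\<lambda>x. cmod (g x)) integrable_on {0..pi}" by (rule integrable_on_lebesgue_on[OF ig]) simp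
  have igt: "(\<lambda>x. cmod (g x)) integrable_on {0..t}" by (rule integrable_on_subinterval[OF igS]) (use t in auto)
  have "cmod (integral {0..t} (\<lambda>x. c x * g x)) \<le> integral {0..t} (\<lambda>x. C * cmod (g x))"
    using C t by (intro integral_norm_bound_integral L2_fun_integrable[OF g c t] integrable_on_mult_right igt)
      (auto simp: norm_mult intro!: mult_right_mono)
  also have "\<dots> = C * integral {0..t} (\<lambda>x. cmod (g x))" by simp
  also have "\<dots> \<le> C * integral {0..pi} (\<lambda>x. cmod (g x))"
    using t C0 igt igS by (intro mult_left_mono integral_subset_le) auto
  also have "integral {0..pi} (\<lambda>x. cmod (g x)) = (LINT x|LP. cmod (g x))"
    by (rule lebesgue_integral_eq_integral[OF ig, symmetric]) simp
  also have "C * (LINT x|LP. cmod (g x)) \<le> C * (sqrt pi * L2_norm LP g)"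
  proof (rule mult_left_mono[OF _ C0])
    have "complex_of_real (LINT x|LP. cmod (g x)) = L2_inner LP (\<lambda>x. of_real (cmod (g x))) (\<lambda>x. 1)"
      by (simp add: L2_inner_def)
    then have "cmod (complex_of_real (LINT x|LP. cmod (g x))) \<le> L2_norm LP g * L2_norm LP (\<lambda>x. 1)"
      using L2_cauchy_schwarz[OF gL(1) oL(1)] gL(2) by simp
    also have "\<dots> \<le> L2_norm LP g * sqrt pi" using oL(2) by (intro mult_left_mono) auto
    finally show "(LINT x|LP. cmod (g x)) \<le> sqrt pi * L2_norm LP g" by (simp add: mult.commute)
  qed
  finally show ?thesis by (simp add: mult.assoc)
qed

lemma cos_sin_sol_pythagoras: "cos_sol a t * cos_sol a t + a * sin_sol a t * sin_sol a t = 1"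
proof (cases "a = 0")
  case False
  have "a = csqrt a * csqrt a" by (simp add: csqrt_mult_self)
  then have "a * (sin (csqrt a * of_real t) / csqrt a) * (sin (csqrt a * of_real t) / csqrt a) = (sin (csqrt a * of_real t))\<^sup>2"
    using False by (simp add: field_simps power2_eq_square)
  then show ?thesis
    using False sin_cos_squared_add[of "csqrt a * of_real t"]
    by (simp add: cos_sol_def sin_sol_def power2_eq_square add.commute)
qed (simp add: cos_sol_def)

text \<open>The solution u of u'' + a u = g with vanishing Cauchy data at 0, by variation of constants.\<close>

definition free_resolvent :: "complex \<Rightarrow> (real \<Rightarrow> complex) \<Rightarrow> real \<Rightarrow> complex" where
  "free_resolvent a g t = (if t \<in> {0..pi} then
     sin_sol a t * integral {0..t} (\<lambda>x. cos_sol a x * g x) - cos_sol a t * integral {0..t} (\<lambda>x. sin_sol a x * g x) else 0)"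

text \<open>Write s_a for \<open>sin_sol\<close> a. The kernel k x is s_a (t - x), expanded by the
  addition formula. Lagrange's identity makes (a - b) k s_b an exact derivative, and its boundary
  values at 0 and t give the formula.\<close>

lemma free_resolvent_sin_sol:
  assumes t: "t \<in> {0..pi}" and ab: "b \<noteq> a"
  shows "free_resolvent a (sin_sol b) t = (sin_sol a t - sin_sol b t) / (b - a)"
proof -
  define k where "k x = sin_sol a t * cos_sol a x - cos_sol a t * sin_sol a x" for x
  define k' where "k' x = - a * sin_sol a t * sin_sol a x - cos_sol a t * cos_sol a x" for x
  have kd: "(k has_vector_derivative k' x) (at x within S)" for x S
    unfolding k_def[abs_def] k'_def
    using has_vector_derivative_diff[OF has_vector_derivative_mult_right[OF cos_sol_derivative, of "sin_sol a t" a x S]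
        has_vector_derivative_mult_right[OF sin_sol_derivative, of "cos_sol a t" a x S]]
    by (simp add: algebra_simps)
  have k'd: "(k' has_vector_derivative - a * k x) (at x within S)" for x S
    unfolding k_def k'_def[abs_def]
    using has_vector_derivative_diff[OF has_vector_derivative_mult_right[OF sin_sol_derivative, of "- a * sin_sol a t" a x S]
        has_vector_derivative_mult_right[OF cos_sol_derivative, of "cos_sol a t" a x S]]
    by (simp add: algebra_simps)
  have "((\<lambda>x. k x * cos_sol b x - k' x * sin_sol b x) has_vector_derivative ((a - b) * (k x * sin_sol b x))) (at x within S)" for x S
    using has_vector_derivative_diff[OF has_vector_derivative_mult[OF kd[of x S] cos_sol_derivative[of b x S]]
        has_vector_derivative_mult[OF k'd[of x S] sin_sol_derivative[of b x S]]]
    by (simp add: algebra_simps)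
  then have "((\<lambda>x. (a - b) * (k x * sin_sol b x)) has_integral
     ((k t * cos_sol b t - k' t * sin_sol b t) - (k 0 * cos_sol b 0 - k' 0 * sin_sol b 0))) {0..t}"
    using t by (intro fundamental_theorem_of_calculus) auto
  moreover have "k t = 0" "k' t = -1" "k 0 = sin_sol a t"
    using cos_sin_sol_pythagoras[of a t] by (simp_all add: k_def k'_def algebra_simps)
  ultimately have *: "((\<lambda>x. (a - b) * (k x * sin_sol b x)) has_integral (sin_sol b t - sin_sol a t)) {0..t}" by simp
  have ints: "(\<lambda>x. cos_sol a x * sin_sol b x) integrable_on {0..t}" "(\<lambda>x. sin_sol a x * sin_sol b x) integrable_on {0..t}"
    by (intro integrable_continuous_interval continuous_intros continuous_on_sol)+
  have E: "integral {0..t} (\<lambda>x. (a - b) * (k x * sin_sol b x)) = (a - b) * free_resolvent a (sin_sol b) t"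
  proof -
    have "(\<lambda>x. k x * sin_sol b x) = (\<lambda>x. sin_sol a t * (cos_sol a x * sin_sol b x) - cos_sol a t * (sin_sol a x * sin_sol b x))"
      by (simp add: k_def fun_eq_iff algebra_simps)
    then have "integral {0..t} (\<lambda>x. k x * sin_sol b x) = free_resolvent a (sin_sol b) t"
      using ints t by (simp add: free_resolvent_def integral_diff integrable_on_mult_right)
    then show ?thesis by simp
  qed
  have "(a - b) * free_resolvent a (sin_sol b) t = sin_sol b t - sin_sol a t"
    unfolding E[symmetric] by (rule integral_unique[OF *])
  then have "free_resolvent a (sin_sol b) t = (sin_sol b t - sin_sol a t) / (a - b)" using ab by (simp add: field_simps)
  then show ?thesis by (metis minus_diff_eq minus_divide_divide)
qed

text \<open>With the kernel in product form t stays outside the integrands, so continuity in t and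
  the bounds are immediate. The value 0 outside the interval makes linearity an identity of
  functions, not merely almost everywhere.\<close>

lemma free_resolvent_L2:
  shows "\<And>g. L2_fun LP g \<Longrightarrow> L2_fun LP (free_resolvent a g)"
    "\<exists>C\<ge>0. \<forall>g. L2_fun LP g \<longrightarrow> L2_norm LP (free_resolvent a g) \<le> C * L2_norm LP g"
    "\<And>f g. L2_fun LP f \<Longrightarrow> L2_fun LP g \<Longrightarrow> free_resolvent a (\<lambda>t. f t + g t) = (\<lambda>t. free_resolvent a f t + free_resolvent a g t)"
    "\<And>f c. L2_fun LP f \<Longrightarrow> free_resolvent a (\<lambda>t. c * f t) = (\<lambda>t. c * free_resolvent a f t)"
proof -
  obtain B where B: "\<forall>x\<in>{0..pi}. cmod (cos_sol a x) \<le> B"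
    using compact_imp_bounded[OF compact_continuous_image[OF continuous_on_sol(1)[of "{0..pi}" a] compact_Icc]] unfolding bounded_iff by auto
  obtain D where D: "\<forall>x\<in>{0..pi}. cmod (sin_sol a x) \<le> D"
    using compact_imp_bounded[OF compact_continuous_image[OF continuous_on_sol(2)[of "{0..pi}" a] compact_Icc]] unfolding bounded_iff by auto
  have B0: "B \<ge> 0" and D0: "D \<ge> 0" using order_trans[OF norm_ge_zero B[rule_format, of 0]] order_trans[OF norm_ge_zero D[rule_format, of 0]] by simp_all
  have cb: "cmod (free_resolvent a g t) \<le> 2 * B * D * sqrt pi * L2_norm LP g" if g: "L2_fun LP g" and t: "t \<in> {0..pi}" for g t
  proof -
    have "cmod (free_resolvent a g t) \<le> cmod (sin_sol a t) * cmod (integral {0..t} (\<lambda>x. cos_sol a x * g x))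
        + cmod (cos_sol a t) * cmod (integral {0..t} (\<lambda>x. sin_sol a x * g x))"
      unfolding free_resolvent_def using t by (simp add: norm_triangle_ineq4[THEN order_trans] norm_mult[symmetric])
    also have "\<dots> \<le> D * (B * sqrt pi * L2_norm LP g) + B * (D * sqrt pi * L2_norm LP g)"
      using B D B0 D0 t g
      by (intro add_mono mult_mono L2_fun_integral_bound continuous_on_sol) auto
    finally show ?thesis by (simp add: algebra_simps)
  qed
  have cont: "continuous_on {0..pi} (free_resolvent a g)" if g: "L2_fun LP g" for g
  proof -
    have "continuous_on {0..pi} (\<lambda>t. sin_sol a t * integral {0..t} (\<lambda>x. cos_sol a x * g x) - cos_sol a t * integral {0..t} (\<lambda>x. sin_sol a x * g x))"
      by (intro continuous_intros continuous_on_sol indefinite_integral_continuous_1 L2_fun_integrable g) auto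
    then show ?thesis by (rule continuous_on_eq) (simp add: free_resolvent_def)
  qed
  show L: "L2_fun LP (free_resolvent a g)" if "L2_fun LP g" for g by (rule L2_continuous[OF cont[OF that]])
  have "L2_norm LP (free_resolvent a g) \<le> (sqrt pi * (2 * B * D * sqrt pi)) * L2_norm LP g" if g: "L2_fun LP g" for g
    using L2_bounded(2)[OF L2_funD(1)[OF L[OF g]] cb[OF g]] by (simp add: mult_ac)
  then show "\<exists>C\<ge>0. \<forall>g. L2_fun LP g \<longrightarrow> L2_norm LP (free_resolvent a g) \<le> C * L2_norm LP g"
    using B0 D0 by (intro exI[of _ "sqrt pi * (2 * B * D * sqrt pi)"]) simp
  show "free_resolvent a (\<lambda>t. f t + g t) = (\<lambda>t. free_resolvent a f t + free_resolvent a g t)" if f: "L2_fun LP f" and g: "L2_fun LP g" for f g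
  proof
    fix t
    show "free_resolvent a (\<lambda>t. f t + g t) t = free_resolvent a f t + free_resolvent a g t"
    proof (cases "t \<in> {0..pi}")
      case t: True
      have "integral {0..t} (\<lambda>x. c x * (f x + g x)) = integral {0..t} (\<lambda>x. c x * f x) + integral {0..t} (\<lambda>x. c x * g x)"
        if "continuous_on {0..pi} c" for c
        using L2_fun_integrable[OF f that t] L2_fun_integrable[OF g that t] by (simp add: distrib_left integral_add)
      from this[OF continuous_on_sol(1)] this[OF continuous_on_sol(2)] t show ?thesis by (simp add: free_resolvent_def algebra_simps)
    next
      case False
      then show ?thesis unfolding free_resolvent_def if_not_P[OF False] by simp
    qed
  qed
  show "free_resolvent a (\<lambda>t. c * f t) = (\<lambda>t. c * free_resolvent a f t)" for f c
  proof
    fix t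
    have "integral {0..t} (\<lambda>x. k x * (c * f x)) = c * integral {0..t} (\<lambda>x. k x * f x)" for k
      by (simp add: mult.left_commute)
    then show "free_resolvent a (\<lambda>t. c * f t) t = c * free_resolvent a f t" by (simp add: free_resolvent_def right_diff_distrib mult.left_commute)
  qed
qed

lemma sin_sol_L2: "L2_fun LP (sin_sol b)"
  by (rule L2_continuous[OF continuous_on_sol(2)])

text \<open>A continuous function that vanishes almost everywhere on the interval vanishes
  identically there, but the derivative at 0 is 1.\<close>

lemma sin_sol_nonzero: "\<not> (AE x in LP. sin_sol b x = 0)"
proof
  assume "AE x in LP. sin_sol b x = 0"
  then have "(LINT x|LP. (cmod (sin_sol b x))\<^sup>2) = 0" by (subst integral_cong_AE[of _ _ "\<lambda>x. 0"]) (auto intro: borel_measurable_integrable[OF L2_funD(2)[OF sin_sol_L2]])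
  moreover have "(LINT x|LP. (cmod (sin_sol b x))\<^sup>2) = integral {0..pi} (\<lambda>x. (cmod (sin_sol b x))\<^sup>2)"
    by (rule lebesgue_integral_eq_integral[OF L2_funD(2)[OF sin_sol_L2]]) simp
  ultimately have "integral {0..pi} (\<lambda>x. (cmod (sin_sol b x))\<^sup>2) = 0" by simp
  then have "\<forall>x\<in>{0..pi}. (cmod (sin_sol b x))\<^sup>2 = 0"
    by (subst (asm) integral_eq_0_iff) (auto intro!: continuous_intros continuous_on_sol)
  then have z: "sin_sol b x = 0" if "x \<in> {0..pi}" for x using that by auto
  have "(sin_sol b has_vector_derivative cos_sol b 0) (at 0 within {0..pi})" by (rule sin_sol_derivative)
  then have "((\<lambda>_. 0) has_vector_derivative cos_sol b 0) (at 0 within {0..pi})"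
    using z by (intro has_vector_derivative_transform[of 0 "{0..pi}" "\<lambda>_. 0" "sin_sol b"]) auto
  then have "cos_sol b 0 = 0"
    by (intro vector_derivative_unique_within_closed_interval[of 0 pi 0 "\<lambda>_. 0"]) auto
  then show False by simp
qed

text \<open>If the coordinate of the new function at the exchanged index vanished, then applying the resolvent
  at the removed parameter and comparing coordinates would force all coordinates to vanish.\<close>

theorem riesz_basis_exchange_sin_sol:
  fixes m :: "'i \<Rightarrow> complex" and n :: "'i \<Rightarrow> complex"
  assumes rb: "riesz_basis_L2 LP J (\<lambda>j x. n j * sin_sol (m j) x)" and j0: "j0 \<in> J"
    and n0: "\<And>j. j \<in> J \<Longrightarrow> n j \<noteq> 0" and k0: "k \<noteq> 0"
    and b: "\<And>j. j \<in> J \<Longrightarrow> j \<noteq> j0 \<Longrightarrow> m j \<noteq> b" and inj: "\<And>j. j \<in> J \<Longrightarrow> j \<noteq> j0 \<Longrightarrow> m j \<noteq> m j0"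
  shows "riesz_basis_L2 LP J ((\<lambda>j x. n j * sin_sol (m j) x)(j0 := (\<lambda>x. k * sin_sol b x)))"
proof -
  define f where "f j = (\<lambda>x. n j * sin_sol (m j) x)" for j
  define a where "a = m j0"
  have rb': "riesz_basis_L2 LP J f" using rb by (simp add: f_def[abs_def])
  obtain c where cf: "\<And>j. j \<in> J \<Longrightarrow> bounded_functional_L2 LP (c j)"
    and ci: "\<And>i j. i \<in> J \<Longrightarrow> j \<in> J \<Longrightarrow> c j (f i) = (if i = j then 1 else 0)"
    and ct: "\<And>g. L2_fun LP g \<Longrightarrow> \<forall>j\<in>J. c j g = 0 \<Longrightarrow> AE x in LP. g x = 0"
    and cd: "\<And>\<phi> g. bounded_functional_L2 LP \<phi> \<Longrightarrow> \<forall>j\<in>J. \<phi> (f j) = 0 \<Longrightarrow> L2_fun LP g \<Longrightarrow> \<phi> g = 0"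
    and ce: "\<And>j g. j \<in> J \<Longrightarrow> L2_fun LP g \<Longrightarrow> c j g \<noteq> 0 \<Longrightarrow> riesz_basis_L2 LP J (f(j := g))"
    by (rule riesz_basis_coordinates[OF rb']) (rule that, assumption+)
  have fL: "L2_fun LP (f j)" for j unfolding f_def by (rule L2_fun_cmult(1)[OF sin_sol_L2])
  have cs: "c j (sin_sol (m i)) = (if i = j then 1 / n i else 0)" if i: "i \<in> J" and j: "j \<in> J" for i j
  proof -
    have "n i * c j (sin_sol (m i)) = (if i = j then 1 else 0)"
      using ci[OF i j] bounded_functional_L2D(2)[OF cf[OF j] sin_sol_L2, of "n i" "m i"] by (simp add: f_def)
    then show ?thesis using n0[OF i] by (auto simp: field_simps split: if_splits)
  qed
  have "c j0 (sin_sol b) \<noteq> 0"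
  proof (cases "b = a")
    case True
    then show ?thesis using cs[OF j0 j0] n0[OF j0] by (simp add: a_def)
  next
    case ba: False
    show ?thesis
    proof
      assume z: "c j0 (sin_sol b) = 0"
      obtain C where C: "C \<ge> 0" "\<forall>g. L2_fun LP g \<longrightarrow> L2_norm LP (free_resolvent a g) \<le> C * L2_norm LP g"
        using free_resolvent_L2(2) by blast
      note VL = free_resolvent_L2(1)[of _ a] and Vadd = free_resolvent_L2(3)[of _ _ a] and Vmul = free_resolvent_L2(4)[of _ a]
      have V: "c j (free_resolvent a (sin_sol b')) = (c j (sin_sol a) - c j (sin_sol b')) / (b' - a)"
        if j: "j \<in> J" and ne: "b' \<noteq> a" for j b'
      proof -
        have "c j (free_resolvent a (sin_sol b')) = c j (\<lambda>t. (1 / (b' - a)) * (sin_sol a t - sin_sol b' t))"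
        proof (rule bounded_functional_L2_AE_cong[OF cf[OF j] VL[OF sin_sol_L2] L2_fun_cmult(1)[OF L2_fun_diff[OF sin_sol_L2 sin_sol_L2]]])
          show "AE x in LP. free_resolvent a (sin_sol b') x = (1 / (b' - a)) * (sin_sol a x - sin_sol b' x)"
            by (rule AE_I2) (use free_resolvent_sin_sol[OF _ ne] in simp)
        qed
        also have "\<dots> = (1 / (b' - a)) * (c j (sin_sol a) - c j (sin_sol b'))"
          by (simp only: bounded_functional_L2D(2)[OF cf[OF j] L2_fun_diff[OF sin_sol_L2 sin_sol_L2]]
              bounded_functional_L2D(3)[OF cf[OF j] sin_sol_L2 sin_sol_L2])
        finally show ?thesis by simp
      qed
      have "c j (sin_sol b) = 0" if j: "j \<in> J" for j
      proof (cases "j = j0")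
        case jj: False
        have ma: "m j \<noteq> a" and mb: "m j \<noteq> b" using inj b j jj by (auto simp: a_def)
        \<comment> \<open>The weight 1 / (m j - a) cancels the contribution of the resolvent at f j;
          at the other f i with i different from j0 both terms vanish.\<close>
        define \<phi> where "\<phi> g = c j (free_resolvent a g) + (1 / (m j - a)) * c j g" for g
        have cV: "bounded_functional_L2 LP (\<lambda>g. c j (free_resolvent a g))"
        proof -
          obtain D where D: "D \<ge> 0" "\<forall>f. L2_fun LP f \<longrightarrow> cmod (c j f) \<le> D * L2_norm LP f"
            using bounded_functional_L2D(4)[OF cf[OF j]] by blast
          have "cmod (c j (free_resolvent a g)) \<le> D * C * L2_norm LP g" if g: "L2_fun LP g" for g
          proof -
            have "cmod (c j (free_resolvent a g)) \<le> D * L2_norm LP (free_resolvent a g)" using D VL[OF g] by blast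
            also have "\<dots> \<le> D * (C * L2_norm LP g)" using C D g by (intro mult_left_mono) auto
            finally show ?thesis by (simp add: mult.assoc)
          qed
          then show ?thesis unfolding bounded_functional_L2_def
            using bounded_functional_L2D(1)[OF cf[OF j] VL VL] bounded_functional_L2D(2)[OF cf[OF j] VL] C D
            by (intro conjI allI impI exI[of _ "D * C"]) (simp_all add: Vadd Vmul)
        qed
        have \<phi>: "bounded_functional_L2 LP \<phi>"
          unfolding \<phi>_def[abs_def] by (rule bounded_functional_L2_add[OF cV cf[OF j]])
        have \<phi>n: "\<phi> (f i) = n i * \<phi> (sin_sol (m i))" for i
          unfolding f_def by (rule bounded_functional_L2D(2)[OF \<phi> sin_sol_L2])
        have van: "\<phi> (f i) = 0" if i: "i \<in> J" and "i \<noteq> j0" for i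
        proof -
          have mi: "m i \<noteq> a" using inj that by (auto simp: a_def)
          have "\<phi> (sin_sol (m i)) = - c j (sin_sol (m i)) / (m i - a) + (1 / (m j - a)) * c j (sin_sol (m i))"
            unfolding \<phi>_def V[OF j mi] using cs[OF j0 j] jj by (simp add: a_def)
          also have "\<dots> = 0" using cs[OF i j] by auto
          finally show ?thesis by (simp add: \<phi>n)
        qed
        define d where "d = \<phi> (f j0)"
        \<comment> \<open>Subtracting d times c j0 also annihilates f j0, so the functional vanishes
          on the whole basis and hence everywhere.\<close>
        have \<psi>: "bounded_functional_L2 LP (\<lambda>g. \<phi> g + (- d) * c j0 g)"
          by (rule bounded_functional_L2_add[OF \<phi> cf[OF j0]])
        have "\<phi> (sin_sol b) + (- d) * c j0 (sin_sol b) = 0"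
        proof (rule cd[OF \<psi> _ sin_sol_L2], rule ballI)
          fix i assume i: "i \<in> J"
          show "\<phi> (f i) + (- d) * c j0 (f i) = 0"
            using van[OF i] ci[OF i j0] by (cases "i = j0") (auto simp: d_def)
        qed
        then have "\<phi> (sin_sol b) = 0" using z by simp
        \<comment> \<open>The two terms carry the factors 1 / (b - a) and 1 / (m j - a), which
          differ because b is not m j; so c j vanishes at the new function.\<close>
        then have "- c j (sin_sol b) / (b - a) + c j (sin_sol b) / (m j - a) = 0"
          unfolding \<phi>_def V[OF j ba] using cs[OF j0 j] jj by (simp add: a_def)
        then have "c j (sin_sol b) / (m j - a) = c j (sin_sol b) / (b - a)" by simp
        then have "c j (sin_sol b) * (b - a) = c j (sin_sol b) * (m j - a)" using ba ma by (auto simp: frac_eq_eq)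
        then have "c j (sin_sol b) * (b - m j) = 0" by (simp add: algebra_simps)
        then show ?thesis using mb by simp
      qed (use z in simp)
      then have "AE x in LP. sin_sol b x = 0" by (intro ct[OF sin_sol_L2] ballI)
      then show False using sin_sol_nonzero by blast
    qed
  qed
  then have "c j0 (\<lambda>x. k * sin_sol b x) \<noteq> 0"
    using bounded_functional_L2D(2)[OF cf[OF j0] sin_sol_L2] k0 by simp
  from ce[OF j0 L2_fun_cmult(1)[OF sin_sol_L2] this] show ?thesis by (simp add: f_def[abs_def])
qed

text \<open>Functions are exchanged one at a time. The hypotheses keep every intermediate mixture of
  old and new parameters pairwise distinct; a new parameter may agree with the old one at its own
  index.\<close>

lemma riesz_basis_replace_finite:
  fixes m t n n' :: "'i \<Rightarrow> complex"
  assumes rb: "riesz_basis_L2 LP J (\<lambda>j x. n j * sin_sol (m j) x)" and n: "\<And>j. j \<in> J \<Longrightarrow> n j \<noteq> 0"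
    and mm: "\<And>j k. j \<in> J \<Longrightarrow> k \<in> J \<Longrightarrow> j \<noteq> k \<Longrightarrow> m j \<noteq> m k"
    and F: "finite F" "F \<subseteq> J" and n': "\<And>j. j \<in> F \<Longrightarrow> n' j \<noteq> 0"
    and tt: "\<And>j k. j \<in> F \<Longrightarrow> k \<in> F \<Longrightarrow> j \<noteq> k \<Longrightarrow> t j \<noteq> t k"
    and mt: "\<And>j k. j \<in> J \<Longrightarrow> k \<in> F \<Longrightarrow> j \<noteq> k \<Longrightarrow> m j \<noteq> t k"
  shows "riesz_basis_L2 LP J (\<lambda>j x. (if j \<in> F then n' j else n j) * sin_sol (if j \<in> F then t j else m j) x)"
  using F n' tt mt
proof (induction F rule: finite_induct)
  case empty
  then show ?case using rb by simp
next
  case (insert a F)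
  have IH: "riesz_basis_L2 LP J (\<lambda>j x. (if j \<in> F then n' j else n j) * sin_sol (if j \<in> F then t j else m j) x)"
    using insert.prems by (intro insert.IH) auto
  have "riesz_basis_L2 LP J ((\<lambda>j x. (if j \<in> F then n' j else n j) * sin_sol (if j \<in> F then t j else m j) x)
      (a := (\<lambda>x. n' a * sin_sol (t a) x)))"
  proof (rule riesz_basis_exchange_sin_sol[OF IH])
    show "a \<in> J" "n' a \<noteq> 0" using insert.prems by auto
    show "(if j \<in> F then n' j else n j) \<noteq> 0" if "j \<in> J" for j using insert.prems(2) n that by auto
    show "(if j \<in> F then t j else m j) \<noteq> t a" if "j \<in> J" "j \<noteq> a" for j
      using insert.prems(3)[of j a] insert.prems(4)[of j a] that by auto
    show "(if j \<in> F then t j else m j) \<noteq> (if a \<in> F then t a else m a)" if "j \<in> J" "j \<noteq> a" for j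
      using insert.prems(1) insert.prems(4)[of a j] mm[of j a] that insert.hyps by (auto dest: sym)
  qed
  also have "(\<lambda>j x. (if j \<in> F then n' j else n j) * sin_sol (if j \<in> F then t j else m j) x)(a := (\<lambda>x. n' a * sin_sol (t a) x)) =
     (\<lambda>j x. (if j \<in> insert a F then n' j else n j) * sin_sol (if j \<in> insert a F then t j else m j) x)"
    by (auto simp: fun_eq_iff)
  finally show ?case .
qed

section \<open>The sine systems of the problem\<close>

lemma sin_eq_sin_sol:
  assumes "l\<^sup>2 = \<mu>" "\<mu> \<noteq> 0"
  shows "sin (l * of_real x) = l * sin_sol \<mu> x"
proof -
  have "l\<^sup>2 = (csqrt \<mu>)\<^sup>2" using assms by simp
  then have "l = csqrt \<mu> \<or> l = - csqrt \<mu>" unfolding power2_eq_iff .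
  then show ?thesis using assms(2) by (auto simp: sin_sol_def)
qed

lemma abs_sin_diff_le: "\<bar>sin a - sin b\<bar> \<le> \<bar>a - b :: real\<bar>"
proof -
  have "\<bar>sin a - sin b\<bar> = 2 * \<bar>sin ((a - b) / 2)\<bar> * \<bar>cos ((a + b) / 2)\<bar>" by (simp add: sin_diff_sin abs_mult)
  also have "\<dots> \<le> 2 * \<bar>(a - b) / 2\<bar> * 1"
    by (intro mult_mono abs_sin_x_le_abs_x abs_cos_le_one) auto
  finally show ?thesis by simp
qed

text \<open>The asymptotics control only the tail, so the perturbation theorem is applied with
  unperturbed sines at the first indices, and these are exchanged afterwards. Every function is a
  nonzero multiple of \<open>sin_sol\<close> of its parameter; a negative m j with imaginary l j,
  and the function x for m j = 0, thus fit into the same exchange.\<close>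

theorem sine_riesz_basis:
  fixes m :: "nat \<Rightarrow> real" and l :: "nat \<Rightarrow> complex"
  assumes \<kappa>: "\<kappa> \<in> {1/2, 1}" and inj: "inj m" and l: "\<And>j. (l j)\<^sup>2 = of_real (m j)"
    and as: "\<And>j. j \<ge> N \<Longrightarrow> m j > 0 \<and> l j = of_real (sqrt (m j)) \<and> \<bar>sqrt (m j) - (real j + \<kappa>)\<bar> \<le> B / (real j + 1)"
  shows "riesz_basis_L2 LP UNIV (\<lambda>j x. if l j = 0 then of_real x else sin (l j * of_real x))"
proof -
  define c where "c = sqrt (2 / pi)"
  have c0: "c > 0" by (simp add: c_def)
  \<comment> \<open>D / (j + 1) bounds c |sin (sqrt (m j) x) - sin ((j + \<kappa>) x)| on [0, pi],
    where x is at most pi.\<close>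
  define D where "D = c * pi * \<bar>B\<bar>"
  have sD: "summable (\<lambda>j. (D / (real j + 1))\<^sup>2)"
  proof -
    have "summable (\<lambda>j. inverse ((real j) ^ 2))" by (rule inverse_power_summable) simp
    then have "summable (\<lambda>j. inverse ((real (j + 1)) ^ 2))" by (subst summable_iff_shift)
    then have "summable (\<lambda>j. D\<^sup>2 * inverse ((real (j + 1)) ^ 2))" by (rule summable_mult)
    moreover have "(D / (real j + 1))\<^sup>2 = D\<^sup>2 * inverse ((real (j + 1)) ^ 2)" for j
      by (simp add: power_divide divide_inverse power_mult_distrib power_inverse add.commute)
    ultimately show ?thesis by (simp only:)
  qed
  obtain N1 where N1: "\<And>n. n \<ge> N1 \<Longrightarrow> norm (\<Sum>i. (D / (real (i + n) + 1))\<^sup>2) < 1 / pi"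
    using suminf_exist_split[OF _ sD, of "1 / pi"] by auto
  \<comment> \<open>Beyond N2 the deviation is below 1/2, so no m k of the tail equals one of the
    squares (j + \<kappa>)^2 kept at the first indices.\<close>
  obtain N2 :: nat where N2: "real N2 > 2 * \<bar>B\<bar>" using reals_Archimedean2 by blast
  define N' where "N' = max N (max N1 N2)"
  have near: "\<bar>sqrt (m j) - (real j + \<kappa>)\<bar> < 1/2" if "j \<ge> N'" for j
  proof -
    have "j \<ge> N" "real j \<ge> real N2" using that by (auto simp: N'_def)
    then have "\<bar>sqrt (m j) - (real j + \<kappa>)\<bar> \<le> B / (real j + 1)" using as by blast
    also have "\<dots> < 1/2" using N2 \<open>real j \<ge> real N2\<close> by (simp add: divide_less_eq)
    finally show ?thesis .
  qed
  define \<delta> where "\<delta> j = (if j < N' then 0 else D / (real j + 1))" for j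
  define d where "d j x = (if j < N' then 0 else complex_of_real (c * (sin (sqrt (m j) * x) - sin ((real j + \<kappa>) * x))))" for j x
  have "riesz_basis_L2 LP UNIV (\<lambda>j x. sine_basis \<kappa> j x + d j x)"
  proof (rule riesz_basis_perturbation[OF sine_basis_orthonormal[OF \<kappa>]])
    show "continuous_on {0..pi} (d j)" for j
      unfolding d_def[abs_def] by (cases "j < N'") (auto intro!: continuous_intros)
    show "cmod (d j x) \<le> \<delta> j" if x: "x \<in> {0..pi}" for j x
    proof (cases "j < N'")
      case False
      then have a: "\<bar>sqrt (m j) - (real j + \<kappa>)\<bar> \<le> B / (real j + 1)" using as[of j] by (auto simp: N'_def)
      have "cmod (d j x) = c * \<bar>sin (sqrt (m j) * x) - sin ((real j + \<kappa>) * x)\<bar>"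
        using False c0 unfolding d_def by (simp only: if_False norm_of_real abs_mult)
      also have "\<dots> \<le> c * \<bar>sqrt (m j) * x - (real j + \<kappa>) * x\<bar>" using c0 by (intro mult_left_mono abs_sin_diff_le) auto
      also have "\<bar>sqrt (m j) * x - (real j + \<kappa>) * x\<bar> = \<bar>sqrt (m j) - (real j + \<kappa>)\<bar> * x"
        using x by (simp add: abs_mult flip: left_diff_distrib)
      also have "c * (\<bar>sqrt (m j) - (real j + \<kappa>)\<bar> * x) \<le> c * ((\<bar>B\<bar> / (real j + 1)) * pi)"
      proof -
        have "B / (real j + 1) \<le> \<bar>B\<bar> / (real j + 1)" by (intro divide_right_mono) auto
        then show ?thesis using a x c0 by (intro mult_left_mono mult_mono) auto
      qed
      finally show ?thesis using False by (simp add: \<delta>_def D_def mult_ac)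
    qed (simp add: d_def \<delta>_def)
    show s: "summable (\<lambda>j. (\<delta> j)\<^sup>2)"
      by (rule summable_comparison_test'[OF sD, of 0]) (auto simp: \<delta>_def)
    have "(\<Sum>j. (\<delta> j)\<^sup>2) = (\<Sum>i. (\<delta> (i + N'))\<^sup>2) + (\<Sum>i<N'. (\<delta> i)\<^sup>2)" by (rule suminf_split_initial_segment[OF s])
    also have "(\<Sum>i<N'. (\<delta> i)\<^sup>2) = 0" by (simp add: \<delta>_def)
    also have "(\<Sum>i. (\<delta> (i + N'))\<^sup>2) = (\<Sum>i. (D / (real (i + N') + 1))\<^sup>2)" by (simp add: \<delta>_def)
    finally have eq: "(\<Sum>j. (\<delta> j)\<^sup>2) = (\<Sum>i. (D / (real (i + N') + 1))\<^sup>2)" by simp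
    have "N' \<ge> N1" by (simp add: N'_def)
    from N1[OF this] have "(\<Sum>j. (\<delta> j)\<^sup>2) < 1 / pi" unfolding eq real_norm_def by linarith
    then show "pi * (\<Sum>j. (\<delta> j)\<^sup>2) < 1" by (simp add: pos_less_divide_eq mult.commute)
  qed
  define M where "M j = complex_of_real (if j < N' then (real j + \<kappa>)\<^sup>2 else m j)" for j
  define n where "n j = complex_of_real (c * (if j < N' then real j + \<kappa> else sqrt (m j)))" for j
  have mpos: "m j > 0" if "j \<ge> N'" for j using as[of j] that by (auto simp: N'_def)
  have \<kappa>0: "\<kappa> > 0" using \<kappa> by auto
  have "sine_basis \<kappa> j x + d j x = n j * sin_sol (M j) x" for j x
  proof (cases "j < N'")
    case True
    define r where "r = real j + \<kappa>"
    have "r > 0" using \<kappa>0 by (simp add: r_def)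
    then have "M j \<noteq> 0" "(complex_of_real r)\<^sup>2 = M j" using True by (simp_all add: M_def flip: r_def)
    from sin_eq_sin_sol[OF this(2,1), of x]
    have "of_real (sin (r * x)) = of_real r * sin_sol (M j) x" by (simp add: sin_of_real[symmetric])
    then show ?thesis
      using True by (simp add: sine_basis_def d_def n_def c_def mult.assoc flip: r_def)
  next
    case False
    have "sine_basis \<kappa> j x + d j x = of_real (c * sin (sqrt (m j) * x))"
      using False by (simp add: sine_basis_def d_def c_def right_diff_distrib)
    moreover have "M j \<noteq> 0" "(complex_of_real (sqrt (m j)))\<^sup>2 = M j" using False mpos[of j] by (auto simp: M_def simp flip: of_real_power)
    from sin_eq_sin_sol[OF this(2,1), of x]
    have "of_real (sin (sqrt (m j) * x)) = of_real (sqrt (m j)) * sin_sol (M j) x" by (simp add: sin_of_real[symmetric])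
    ultimately show ?thesis using False by (simp add: n_def mult.assoc)
  qed
  with \<open>riesz_basis_L2 LP UNIV (\<lambda>j x. sine_basis \<kappa> j x + d j x)\<close>
  have R0: "riesz_basis_L2 LP UNIV (\<lambda>j x. n j * sin_sol (M j) x)" by simp
  have n0: "n j \<noteq> 0" for j
    using c0 \<kappa>0 mpos[of j] by (cases "j < N'") (simp_all add: n_def del: of_real_add of_real_mult)
  have MM: "M j \<noteq> M k" if jk: "j \<noteq> k" for j k
  proof -
    have lt: "(real j + \<kappa>)\<^sup>2 \<noteq> m k" if "j < N'" "k \<ge> N'" for j k
    proof
      assume eq: "(real j + \<kappa>)\<^sup>2 = m k"
      have "sqrt (m k) = real j + \<kappa>" unfolding eq[symmetric] using \<kappa>0 by simp
      then show False using near[OF that(2)] that by auto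
    qed
    have "(if j < N' then (real j + \<kappa>)\<^sup>2 else m j) \<noteq> (if k < N' then (real k + \<kappa>)\<^sup>2 else m k)"
      using lt[of j k] lt[of k j] jk inj \<kappa>0 by (auto simp: inj_def power2_eq_iff_nonneg dest: sym)
    then show ?thesis unfolding M_def of_real_eq_iff .
  qed
  \<comment> \<open>Exchanging through non-real parameters keeps the parameters distinct at every step.\<close>
  define w where "w j = \<i> * of_real (real j + 1)" for j
  have wne: "of_real r \<noteq> w j" for r j by (simp add: w_def complex_eq_iff)
  have R1: "riesz_basis_L2 LP UNIV (\<lambda>j x. (if j \<in> {..<N'} then 1 else n j) * sin_sol (if j \<in> {..<N'} then w j else M j) x)"
  proof (rule riesz_basis_replace_finite[OF R0])
    show "M j \<noteq> w k" for j k unfolding M_def by (rule wne)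
  qed (use n0 MM in \<open>auto simp: w_def\<close>)
  \<comment> \<open>For l j = 0 the function x is \<open>sin_sol\<close> 0 itself, hence the factor
    1.\<close>
  define nl where "nl j = (if l j = 0 then 1 else l j)" for j
  \<comment> \<open>The exchanged functions also receive the factor c, so that the whole system is c
    times the required one and c can be removed at the end.\<close>
  have R2: "riesz_basis_L2 LP UNIV (\<lambda>j x. (if j \<in> {..<N'} then of_real c * nl j else (if j \<in> {..<N'} then 1 else n j))
      * sin_sol (if j \<in> {..<N'} then of_real (m j) else (if j \<in> {..<N'} then w j else M j)) x)"
  proof (rule riesz_basis_replace_finite[OF R1])
    show "(if j \<in> {..<N'} then w j else M j) \<noteq> (if k \<in> {..<N'} then w k else M k)" if "j \<noteq> k" for j k
      using that MM[OF that] wne unfolding M_def by (auto simp: w_def dest: sym)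
    show "(if j \<in> {..<N'} then w j else M j) \<noteq> of_real (m k)" if "k \<in> {..<N'}" "j \<noteq> k" for j k
      using that inj wne by (auto simp: M_def inj_def dest: sym)
    show "complex_of_real (m j) \<noteq> of_real (m k)" if "j \<noteq> k" for j k using that inj by (auto simp: inj_def)
  qed (use n0 c0 in \<open>auto simp: nl_def\<close>)
  have fl: "(if l j = 0 then of_real x else sin (l j * of_real x)) = nl j * sin_sol (of_real (m j)) x" for j x
  proof (cases "l j = 0")
    case True
    then have "m j = 0" using l[of j] by simp
    then show ?thesis using True by (simp add: nl_def sin_sol_def)
  next
    case False
    then have "complex_of_real (m j) \<noteq> 0" using l[of j] by (metis power_eq_0_iff)
    then show ?thesis using False sin_eq_sin_sol[OF l] by (simp add: nl_def)
  qed
  have "(\<lambda>j x. (if j \<in> {..<N'} then of_real c * nl j else (if j \<in> {..<N'} then 1 else n j))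
      * sin_sol (if j \<in> {..<N'} then of_real (m j) else (if j \<in> {..<N'} then w j else M j)) x) =
     (\<lambda>j x. of_real c * (if l j = 0 then of_real x else sin (l j * of_real x)))"
  proof (intro ext)
    fix j x
    show "(if j \<in> {..<N'} then of_real c * nl j else (if j \<in> {..<N'} then 1 else n j))
      * sin_sol (if j \<in> {..<N'} then of_real (m j) else (if j \<in> {..<N'} then w j else M j)) x =
      of_real c * (if l j = 0 then of_real x else sin (l j * of_real x))"
    proof (cases "j < N'")
      case False
      then have "l j = of_real (sqrt (m j))" "m j > 0" using as[of j] by (auto simp: N'_def)
      then show ?thesis unfolding fl using False by (simp add: n_def nl_def M_def)
    qed (simp add: fl)
  qed
  with R2 have "riesz_basis_L2 LP UNIV (\<lambda>j x. of_real c * (if l j = 0 then of_real x else sin (l j * of_real x)))" by simp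
  from riesz_basis_L2_cmult[OF this, of "1 / of_real c"] show ?thesis using c0 by simp
qed

theorem theorem1p2:
  fixes q :: "real \<Rightarrow> real" and \<alpha> \<beta> :: real
    and \<mu> :: "nat \<Rightarrow> real" and lam :: "nat \<Rightarrow> complex"
  assumes q: "q absolutely_integrable_on {0..pi}"
    and \<alpha>: "\<alpha> \<in> {0<..pi}"
    and \<beta>: "\<beta> \<in> {0..<pi}"
    and \<mu>: "sl_eigenvalue_enumeration q \<alpha> \<beta> \<mu>"
    and lam_square: "\<And>n. (lam n)\<^sup>2 = of_real (\<mu> n)"
    and lam_nonneg: "\<And>n. \<mu> n \<ge> 0 \<Longrightarrow> lam n = of_real (sqrt (\<mu> n))"
  shows
    "(\<alpha> \<in> {0<..<pi} \<and> \<beta> \<in> {0<..<pi} \<longrightarrow>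
       ((\<forall>n. lam n \<noteq> 0) \<longrightarrow>
          riesz_basis_L2 (lebesgue_on {0..pi}) {1..} (\<lambda>n x. sin (lam n * of_real x))) \<and>
       (\<forall>n0. lam n0 = 0 \<longrightarrow>
          riesz_basis_L2 (lebesgue_on {0..pi}) (UNIV - {n0}) (\<lambda>n x. sin (lam n * of_real x))))
     \<and>
     ((\<alpha> = pi \<and> \<beta> \<in> {0<..<pi}) \<or> (\<alpha> \<in> {0<..<pi} \<and> \<beta> = 0) \<longrightarrow>
       ((\<forall>n. lam n \<noteq> 0) \<longrightarrow>
          riesz_basis_L2 (lebesgue_on {0..pi}) UNIV (\<lambda>n x. sin (lam n * of_real x))) \<and>
       (\<forall>n0. lam n0 = 0 \<longrightarrow>
          riesz_basis_L2 (lebesgue_on {0..pi}) UNIV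
            (\<lambda>n x. if n = n0 then of_real x else sin (lam n * of_real x))))
     \<and>
     (\<alpha> = pi \<and> \<beta> = 0 \<longrightarrow>
       ((\<forall>n. lam n \<noteq> 0) \<longrightarrow>
          riesz_basis_L2 (lebesgue_on {0..pi}) UNIV (\<lambda>n x. sin (lam n * of_real x))) \<and>
       (\<forall>n0. lam n0 = 0 \<longrightarrow>
          riesz_basis_L2 (lebesgue_on {0..pi}) UNIV
            (\<lambda>n x. if n = n0 then of_real x else sin (lam n * of_real x))))"
proof -
  have inj: "inj \<mu>"
    using \<mu> strict_mono_imp_inj_on unfolding sl_eigenvalue_enumeration_def by blast
  obtain N B where as: "\<And>n. n \<ge> N \<Longrightarrow> \<mu> n > 0 \<and> \<bar>sqrt (\<mu> n) - (real n + sl_kappa \<alpha> \<beta>)\<bar> \<le> B / (real n + 1)"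
    using sl_eigenvalue_asymptotics[OF q \<alpha> \<beta> \<mu>] by blast
  have lam_inj: "lam n \<noteq> 0" if "lam n0 = 0" "n \<noteq> n0" for n n0
  proof
    assume "lam n = 0"
    then have "\<mu> n = \<mu> n0" using lam_square[of n] lam_square[of n0] that by simp
    then show False using inj that by (auto simp: inj_def)
  qed
  have dirichlet: "riesz_basis_L2 LP UNIV (\<lambda>n x. if lam n = 0 then of_real x else sin (lam n * of_real x))"
    if \<kappa>: "sl_kappa \<alpha> \<beta> \<in> {1/2, 1}"
  proof (rule sine_riesz_basis[OF \<kappa> inj lam_square])
    show "\<mu> n > 0 \<and> lam n = of_real (sqrt (\<mu> n)) \<and> \<bar>sqrt (\<mu> n) - (real n + sl_kappa \<alpha> \<beta>)\<bar> \<le> B / (real n + 1)" if "n \<ge> N" for n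
      using as[OF that] lam_nonneg[of n] by auto
  qed
  \<comment> \<open>For \<kappa> = 0 one index is to be left out, and \<sigma> runs through the
    others; then sqrt (\<mu> (\<sigma> j)) is close to j + 1, which is the asymptotics that belongs
    to the sine basis with parameter 1.\<close>
  have robin: "riesz_basis_L2 LP UNIV (\<lambda>j x. if lam (\<sigma> j) = 0 then of_real x else sin (lam (\<sigma> j) * of_real x))"
    if \<kappa>: "sl_kappa \<alpha> \<beta> = 0" and \<sigma>: "inj \<sigma>" "\<And>j. j \<ge> N' \<Longrightarrow> \<sigma> j = Suc j" for \<sigma> :: "nat \<Rightarrow> nat" and N'
  proof (rule sine_riesz_basis[of 1])
    show "inj (\<lambda>j. \<mu> (\<sigma> j))" using inj_compose[OF inj \<sigma>(1)] by (simp add: o_def)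
    show "\<mu> (\<sigma> j) > 0 \<and> lam (\<sigma> j) = of_real (sqrt (\<mu> (\<sigma> j))) \<and> \<bar>sqrt (\<mu> (\<sigma> j)) - (real j + 1)\<bar> \<le> \<bar>B\<bar> / (real j + 1)"
      if "j \<ge> max N N'" for j
    proof -
      have "\<mu> (Suc j) > 0" "\<bar>sqrt (\<mu> (Suc j)) - (real (Suc j) + 0)\<bar> \<le> B / (real (Suc j) + 1)"
        using as[of "Suc j"] that \<kappa> by auto
      \<comment> \<open>Lowering the denominator by one enlarges the bound only for a nonnegative
        numerator, hence |B|.\<close>
      moreover have "B / (real (Suc j) + 1) \<le> \<bar>B\<bar> / (real j + 1)" by (intro frac_le) auto
      ultimately show ?thesis using \<sigma>(2)[of j] that lam_nonneg[of "Suc j"] by (auto simp: add.commute)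
    qed
  qed (use lam_square in auto)
  have part1: "riesz_basis_L2 LP {1..} (\<lambda>n x. sin (lam n * of_real x))" if "sl_kappa \<alpha> \<beta> = 0" "\<forall>n. lam n \<noteq> 0"
  proof -
    have "riesz_basis_L2 LP UNIV (\<lambda>j x. sin (lam (Suc j) * of_real x))"
      using robin[OF that(1), of Suc 0] that(2) by simp
    moreover have "bij_betw (\<lambda>n. n - 1) {1..} (UNIV :: nat set)"
      by (rule bij_betw_byWitness[of _ Suc]) auto
    ultimately have "riesz_basis_L2 LP {1..} (\<lambda>n x. sin (lam (Suc (n - 1)) * of_real x))"
      by (rule riesz_basis_L2_reindex)
    \<comment> \<open>Only the indices in {1..} enter, and there Suc (n - 1) = n.\<close>
    then show ?thesis unfolding riesz_basis_L2_def by simp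
  qed
  have part2: "riesz_basis_L2 LP (UNIV - {n0}) (\<lambda>n x. sin (lam n * of_real x))" if "sl_kappa \<alpha> \<beta> = 0" "lam n0 = 0" for n0
  proof -
    \<comment> \<open>\<sigma> enumerates the naturals other than n0 in increasing order, and \<pi>'
      is its inverse.\<close>
    define \<sigma> where "\<sigma> j = (if j < n0 then j else Suc j)" for j
    define \<pi>' where "\<pi>' n = (if n < n0 then n else n - 1)" for n
    have "\<sigma> j \<noteq> n0" for j by (auto simp: \<sigma>_def)
    moreover have "inj \<sigma>" by (auto simp: inj_def \<sigma>_def split: if_splits)
    ultimately have "riesz_basis_L2 LP UNIV (\<lambda>j x. sin (lam (\<sigma> j) * of_real x))"
      using robin[OF that(1), of \<sigma> n0] lam_inj[OF that(2)] by (simp add: \<sigma>_def)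
    moreover have "bij_betw \<pi>' (UNIV - {n0}) UNIV"
      by (rule bij_betw_byWitness[of _ \<sigma>]) (auto simp: \<pi>'_def \<sigma>_def)
    ultimately have "riesz_basis_L2 LP (UNIV - {n0}) (\<lambda>n x. sin (lam (\<sigma> (\<pi>' n)) * of_real x))"
      by (rule riesz_basis_L2_reindex)
    moreover have "\<sigma> (\<pi>' n) = n" if "n \<in> UNIV - {n0}" for n using that by (auto simp: \<pi>'_def \<sigma>_def)
    ultimately show ?thesis unfolding riesz_basis_L2_def by simp
  qed
  have part3: "riesz_basis_L2 LP UNIV (\<lambda>n x. sin (lam n * of_real x))"
    if "sl_kappa \<alpha> \<beta> \<in> {1/2, 1}" "\<forall>n. lam n \<noteq> 0"
    using dirichlet[OF that(1)] that(2) by simp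
  have part4: "riesz_basis_L2 LP UNIV (\<lambda>n x. if n = n0 then of_real x else sin (lam n * of_real x))"
    if "sl_kappa \<alpha> \<beta> \<in> {1/2, 1}" "lam n0 = 0" for n0
  proof -
    have "lam n = 0 \<longleftrightarrow> n = n0" for n using lam_inj[OF that(2), of n] that(2) by auto
    then show ?thesis using dirichlet[OF that(1)] by simp
  qed
  have k: "\<alpha> \<in> {0<..<pi} \<and> \<beta> \<in> {0<..<pi} \<Longrightarrow> sl_kappa \<alpha> \<beta> = 0"
    "(\<alpha> = pi \<and> \<beta> \<in> {0<..<pi}) \<or> (\<alpha> \<in> {0<..<pi} \<and> \<beta> = 0) \<Longrightarrow> sl_kappa \<alpha> \<beta> \<in> {1/2, 1}"
    "\<alpha> = pi \<and> \<beta> = 0 \<Longrightarrow> sl_kappa \<alpha> \<beta> \<in> {1/2, 1}"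
    by (auto simp: sl_kappa_def)
  show ?thesis
    by (intro conjI impI allI; rule part1 part2 part3 part4; (assumption | erule k))
qed

end
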